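(* Let $\tilde\beta(m_3):=\beta/(1+c\,m_3)$ and consider the ODE system ($'=d/d\xi$) $$\theta'=\sin(\theta)\tilde p,\quad \tilde p'=h+(q^2-\mu)\cos\theta-(\Omega-sq)-\alpha s\tilde p-\cos(\theta)\tilde p^2,\quad q'=\alpha(\Omega-sq)-\tilde\beta(\cos\theta)-(s+2\cos(\theta)q)\tilde p\qquad( * )$$ with $\alpha>0$, $|c|<1$, and real parameters $\beta,h,\mu,\Omega,s$. For $s\neq0$ set $$q(m_3):=\frac{\Omega-\tilde\beta(m_3)/\alpha}{s},\qquad \tilde\Gamma(m_3):=\frac{\tilde\beta(m_3)}{\alpha}-\big(q(m_3)^2-\mu\big)m_3-h .$$ Consider $\theta_0\in\{0,\pi\}$ and set $m_3^0:=\cos\theta_0$. Suppose that the parameters of $( * )$ are such that $s\neq0$, $\tilde\Gamma(m_3^0)=0$ and $\partial_{m_3}\tilde\Gamma(m_3^0)\neq0$. Then the equilibrium point $(\theta_0,0,q(m_3^0))$ of $( * )$ undergoes a pitchfork bifurcation upon any perturbation of $h$ or $\mu$. More precisely, let $S_\varepsilon=(\alpha_\varepsilon,\beta_\varepsilon,h_\varepsilon,\mu_\varepsilon,\Omega_\varepsilon,c_\varepsilon,s_\varepsilon)$, $\varepsilon\in(-\varepsilon_0,\varepsilon_0)$ for some $\varepsilon_0>0$, be a curve in the parameter space of $( * )$ with $|c_\varepsilon|<1$, $\alpha_\varepsilon>0$, $s_\varepsilon\neq0$ and such that $S_0$ satisfies $\tilde\Gamma(m_3^0)=0$ and $\tilde\gamma:=\partial_{m_3}\tilde\Gamma(m_3^0)\neq0$.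 Then $( * )$ has a curve of equilibria $(\theta_0,\tilde p_\varepsilon,q_\varepsilon)$, with possibly adjusted $\varepsilon_0$, such that $\tilde p_0=0$, $q_0=q(m_3^0)$, and two equilibria with $\theta\neq\theta_0$ bifurcate from $(\theta_0,0,q(m_3^0))$ for increasing $\varepsilon$ if, with parameters $S_\varepsilon$, $m_3^0\,\tilde\gamma\,\partial_\varepsilon\tilde\Gamma(m_3^0)|_{\varepsilon=0}>0$. The bifurcating equilibria are connected to $(\theta_0,\tilde p_\varepsilon,q_\varepsilon)$ by heteroclinic orbits which converge to $(\theta_0,\tilde p_\varepsilon,q_\varepsilon)$ as $\ell\xi\to\infty$ for $\ell=-m_3^0\tilde p_\varepsilon$. Specifically, this occurs if $h_\varepsilon=h_0-m_3^0\tilde\gamma\varepsilon$ or $\mu_\varepsilon=\mu_0+\tilde\gamma\varepsilon$, and $\ell=\tilde\gamma s$, or if $\beta_\varepsilon=\beta_0+m_3^0\tilde\gamma\varepsilon$ and $\ell=-(2q(m_3^0)m_3^0+s)\tilde\gamma$, with all other parameters fixed in each case.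
   Context: The system $( * )$ describes coherent structures $\xi=x-st$, $\varphi=\phi(\xi)+\Omega t$, $\theta=\theta(\xi)$, $q=\phi'$, $\theta'=\sin(\theta)\tilde p$ of the equation $\partial_t\boldsymbol m=\boldsymbol m\times[\alpha\partial_t\boldsymbol m-\partial_x^2\boldsymbol m+(\mu m_3-h)\boldsymbol{\hat e}_3+\frac{\beta}{1+c\,m_3}\boldsymbol m\times\boldsymbol{\hat e}_3]$ for $\boldsymbol m=(e^{i\varphi}\sin\theta,\cos\theta)\in\mathbb{S}^2$, $x\in\mathbb{R}$, where the $(m_1,m_2)$-plane is identified with $\mathbb{C}$. Equilibria of $( * )$ with $\tilde p=0$ and $\cos\theta=m_3$ have $q=q(m_3)$ and satisfy $\tilde\Gamma(m_3)=0$. The set $\{\theta=\theta_0\}$ is invariant for $( * )$, and $( * )$ is symmetric under reflection of $\theta$ about $\theta_0$; the pitchfork bifurcation is with respect to this reflection.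
   Formalization: The β case is false as printed. With K=2q(m_3^0)m_3^0+s it is corrected: if sK>0, β_ε=β_0+m_3^0γ̃ε with ℓ=Kγ̃; if sK<0, β_ε=β_0−m_3^0γ̃ε with ℓ=−Kγ̃; K=0 (where ℓ=0) is excluded. *)

theory Defs
  imports "HOL-Analysis.Analysis"
begin

section \<open>Bifurcation notions\<close>

text \<open>Reflection about \<open>x0\<close> with linear part \<open>L\<close>.\<close>

definition reflect_about :: "('a \<Rightarrow> 'a) \<Rightarrow> 'a \<Rightarrow> 'a \<Rightarrow> 'a::real_vector" where
  "reflect_about L x0 x = x0 + L (x - x0)"

text \<open>
  Pitchfork bifurcation of the equilibrium \<open>x0\<close> of \<open>x' = f \<nu> x\<close> at \<open>\<nu> = \<nu>0\<close>, with respect to the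
  reflection about \<open>x0\<close> with linear part \<open>L\<close>.  In order, the clauses say:

  \<^item> \<open>f \<nu>\<close> is equivariant;
  \<^item> the linearization \<open>A \<nu>0\<close> in \<open>x0\<close> has an algebraically simple eigenvalue 0 with an eigenvector
    \<open>v\<close> that is odd under the reflection, and no eigenvalue \<open>\<i> \<omega>\<close>, \<open>\<omega> \<noteq> 0\<close> (the last clause of that
    group is \<open>A (a + \<i> b) = \<i> \<omega> (a + \<i> b)\<close> split into real and imaginary part);
  \<^item> along a curve \<open>xs\<close> of symmetric equilibria the odd critical eigenvalue \<open>\<kappa>\<close> crosses 0 with
    nonzero speed;
  \<^item> near \<open>x0\<close> there is no other equilibrium on one side of \<open>\<nu>0\<close> (selected by the sign \<open>\<sigma>\<close>), and
    exactly one further pair, exchanged by the reflection, on the other side;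
  \<^item> that pair leaves \<open>xs\<close> in the direction \<open>v\<close> at a square root rate, which for smooth \<open>f\<close> is the
    nondegeneracy of the cubic term in the normal form.
\<close>

definition pitchfork_bifurcation ::
    "('a \<Rightarrow> 'a) \<Rightarrow> (real \<Rightarrow> 'a \<Rightarrow> 'a) \<Rightarrow> real \<Rightarrow> 'a::euclidean_space \<Rightarrow> bool" where
  "pitchfork_bifurcation L f \<nu>0 x0 \<longleftrightarrow>
     linear L \<and> (\<forall>x. L (L x) = x) \<and>
     (\<exists>\<delta>>0. \<exists>U xs y A \<kappa> \<kappa>' w v \<sigma>.
        (\<forall>\<nu> x. \<bar>\<nu> - \<nu>0\<bar> < \<delta> \<longrightarrow> f \<nu> (reflect_about L x0 x) = L (f \<nu> x)) \<and>
        (\<forall>\<nu>. \<bar>\<nu> - \<nu>0\<bar> < \<delta> \<longrightarrow> (f \<nu> has_derivative A \<nu>) (at (xs \<nu>))) \<and>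
        v \<noteq> 0 \<and> L v = - v \<and> {x. A \<nu>0 x = 0} = span {v} \<and> v \<notin> range (A \<nu>0) \<and>
        (\<forall>a b. \<forall>\<omega>. \<omega> \<noteq> 0 \<and> A \<nu>0 a = - (\<omega> *\<^sub>R b) \<and> A \<nu>0 b = \<omega> *\<^sub>R a \<longrightarrow> a = 0 \<and> b = 0) \<and>
        xs C1_differentiable_on {\<nu>0 - \<delta> <..< \<nu>0 + \<delta>} \<and> xs \<nu>0 = x0 \<and>
        (\<forall>\<nu>. \<bar>\<nu> - \<nu>0\<bar> < \<delta> \<longrightarrow> reflect_about L x0 (xs \<nu>) = xs \<nu>) \<and>
        (\<forall>\<nu>. \<bar>\<nu> - \<nu>0\<bar> < \<delta> \<longrightarrow> A \<nu> (w \<nu>) = \<kappa> \<nu> *\<^sub>R w \<nu> \<and> L (w \<nu>) = - w \<nu>) \<and>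
        isCont w \<nu>0 \<and> w \<nu>0 = v \<and>
        (\<kappa> has_real_derivative \<kappa>') (at \<nu>0) \<and> \<kappa>' \<noteq> 0 \<and>
        open U \<and> x0 \<in> U \<and> \<sigma> \<in> {-1, 1} \<and>
        (\<forall>\<nu>. \<bar>\<nu> - \<nu>0\<bar> < \<delta> \<and> \<sigma> * (\<nu> - \<nu>0) \<le> 0 \<longrightarrow> {x \<in> U. f \<nu> x = 0} = {xs \<nu>}) \<and>
        (\<forall>\<nu>. \<bar>\<nu> - \<nu>0\<bar> < \<delta> \<and> \<sigma> * (\<nu> - \<nu>0) > 0 \<longrightarrow>
            reflect_about L x0 (y \<nu>) \<noteq> y \<nu> \<and>
            {x \<in> U. f \<nu> x = 0} = {xs \<nu>, y \<nu>, reflect_about L x0 (y \<nu>)}) \<and>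
        ((\<lambda>\<nu>. (y \<nu> - xs \<nu>) /\<^sub>R sqrt (\<sigma> * (\<nu> - \<nu>0))) \<longlongrightarrow> v)
            (at \<nu>0 within {\<nu>. \<sigma> * (\<nu> - \<nu>0) > 0}))"

text \<open>
  There is a heteroclinic orbit of \<open>x' = f x\<close> between \<open>a\<close> and \<open>b\<close>, which converges to \<open>b\<close> as
  \<open>l \<xi> \<longrightarrow> \<infinity>\<close> and to \<open>a\<close> as \<open>l \<xi> \<longrightarrow> -\<infinity>\<close>; only the sign of \<open>l\<close> matters.
\<close>

definition heteroclinic :: "('a \<Rightarrow> 'a) \<Rightarrow> real \<Rightarrow> 'a \<Rightarrow> 'a::real_normed_vector \<Rightarrow> bool" where
  "heteroclinic f l a b \<longleftrightarrow>
     l \<noteq> 0 \<and> a \<noteq> b \<and> f a = 0 \<and> f b = 0 \<and>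
     (\<exists>X. (\<forall>\<xi>. (X has_vector_derivative f (X \<xi>)) (at \<xi>)) \<and>
          ((\<lambda>\<tau>. X (\<tau> / l)) \<longlongrightarrow> a) at_bot \<and>
          ((\<lambda>\<tau>. X (\<tau> / l)) \<longlongrightarrow> b) at_top)"


section \<open>The coherent structure equations\<close>

text \<open>Parameters are ordered \<open>(\<alpha>, \<beta>, h, \<mu>, \<Omega>, c, s)\<close>, states \<open>(\<theta>, p, q)\<close>.\<close>

type_synonym params = "real \<times> real \<times> real \<times> real \<times> real \<times> real \<times> real"
type_synonym state = "real \<times> real \<times> real"

fun beta_tilde :: "params \<Rightarrow> real \<Rightarrow> real" where
  "beta_tilde (\<alpha>, \<beta>, h, \<mu>, \<Omega>, c, s) m = \<beta> / (1 + c * m)"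

fun coh_field :: "params \<Rightarrow> state \<Rightarrow> state" where
  "coh_field (\<alpha>, \<beta>, h, \<mu>, \<Omega>, c, s) (\<theta>, p, q) =
     (sin \<theta> * p,
      h + (q\<^sup>2 - \<mu>) * cos \<theta> - (\<Omega> - s * q) - \<alpha> * s * p - cos \<theta> * p\<^sup>2,
      \<alpha> * (\<Omega> - s * q) - beta_tilde (\<alpha>, \<beta>, h, \<mu>, \<Omega>, c, s) (cos \<theta>) - (s + 2 * cos \<theta> * q) * p)"

fun q_eq :: "params \<Rightarrow> real \<Rightarrow> real" where
  "q_eq (\<alpha>, \<beta>, h, \<mu>, \<Omega>, c, s) m =
     (\<Omega> - beta_tilde (\<alpha>, \<beta>, h, \<mu>, \<Omega>, c, s) m / \<alpha>) / s"

fun Gamma_tilde :: "params \<Rightarrow> real \<Rightarrow> real" where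
  "Gamma_tilde (\<alpha>, \<beta>, h, \<mu>, \<Omega>, c, s) m =
     beta_tilde (\<alpha>, \<beta>, h, \<mu>, \<Omega>, c, s) m / \<alpha>
       - ((q_eq (\<alpha>, \<beta>, h, \<mu>, \<Omega>, c, s) m)\<^sup>2 - \<mu>) * m - h"

fun admissible :: "params \<Rightarrow> bool" where
  "admissible (\<alpha>, \<beta>, h, \<mu>, \<Omega>, c, s) \<longleftrightarrow> \<alpha> > 0 \<and> \<bar>c\<bar> < 1 \<and> s \<noteq> 0"

fun flip_theta :: "state \<Rightarrow> state" where
  "flip_theta (\<theta>, p, q) = (- \<theta>, p, q)"

definition equilibrium_curve ::
    "(real \<Rightarrow> params) \<Rightarrow> real \<Rightarrow> real \<Rightarrow> (real \<Rightarrow> real) \<Rightarrow> (real \<Rightarrow> real) \<Rightarrow> bool" where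
  "equilibrium_curve S \<theta>0 \<epsilon>1 p q \<longleftrightarrow>
     p C1_differentiable_on {-\<epsilon>1 <..< \<epsilon>1} \<and> q C1_differentiable_on {-\<epsilon>1 <..< \<epsilon>1} \<and>
     p 0 = 0 \<and> q 0 = q_eq (S 0) (cos \<theta>0) \<and>
     (\<forall>\<epsilon> \<in> {-\<epsilon>1 <..< \<epsilon>1}. coh_field (S \<epsilon>) (\<theta>0, p \<epsilon>, q \<epsilon>) = 0)"

text \<open>
  Two equilibria \<open>y \<epsilon>\<close> and its mirror image, with \<open>\<theta> \<noteq> \<theta>0\<close>, bifurcate from \<open>(\<theta>0, p 0, q 0)\<close> for
  increasing \<open>\<epsilon>\<close>: locally they exist for \<open>\<epsilon> > 0\<close> only, they are the only equilibria off the curve,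
  and each is connected to \<open>(\<theta>0, p \<epsilon>, q \<epsilon>)\<close> by a heteroclinic orbit with direction \<open>l \<epsilon>\<close>.
\<close>

definition pair_bifurcates ::
    "(real \<Rightarrow> params) \<Rightarrow> real \<Rightarrow> real \<Rightarrow> (real \<Rightarrow> real) \<Rightarrow> (real \<Rightarrow> real) \<Rightarrow> (real \<Rightarrow> real) \<Rightarrow> bool" where
  "pair_bifurcates S \<theta>0 \<epsilon>1 p q l \<longleftrightarrow>
     (let x0 = (\<theta>0, p 0, q 0); R = reflect_about flip_theta x0 in
      \<exists>U y. open U \<and> x0 \<in> U \<and> (y \<longlongrightarrow> x0) (at_right 0) \<and>
        (\<forall>\<epsilon> \<in> {-\<epsilon>1 <.. 0}. {x \<in> U. coh_field (S \<epsilon>) x = 0} = {(\<theta>0, p \<epsilon>, q \<epsilon>)}) \<and>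
        (\<forall>\<epsilon> \<in> {0 <..< \<epsilon>1}.
           fst (y \<epsilon>) \<noteq> \<theta>0 \<and>
           {x \<in> U. coh_field (S \<epsilon>) x = 0} = {(\<theta>0, p \<epsilon>, q \<epsilon>), y \<epsilon>, R (y \<epsilon>)} \<and>
           heteroclinic (coh_field (S \<epsilon>)) (l \<epsilon>) (y \<epsilon>) (\<theta>0, p \<epsilon>, q \<epsilon>) \<and>
           heteroclinic (coh_field (S \<epsilon>)) (l \<epsilon>) (R (y \<epsilon>)) (\<theta>0, p \<epsilon>, q \<epsilon>)))"

end

theory Submission
  imports Defs
begin

text \<open>
  Write \<open>w = p + \<i> q\<close> and \<open>m = cos \<theta>\<close>.  The three equations then become
  \<open>m' = - (1 - m\<^sup>2) Re w\<close> and the scalar complex Riccati equation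
  \<open>w' = C(m) - (\<alpha> + \<i>) s w - m w\<^sup>2\<close>.  Everything rests on this form.

  On the invariant plane \<open>\<theta> = \<theta>0\<close>, where \<open>m = m0 = \<plusminus>1\<close>, equilibria solve a quadratic equation with
  constant coefficients.  The quadratic formula gives the curve \<open>(\<theta>0, Re W, Im W)\<close> as a \<open>C\<^sup>1\<close>
  function of the parameters.  The linearization there has the eigenvalue \<open>m0 Re W\<close> in the direction
  of \<open>\<theta>\<close> and, when \<open>Re W = 0\<close>, the pair \<open>- \<alpha> s \<plusminus> \<i> (s + 2 m0 q)\<close>, which stays off the imaginary
  axis.  Off the plane an equilibrium has \<open>p = 0\<close>, \<open>q = q(m)\<close> and \<open>\<Gamma>(m) = 0\<close>.  Since
  \<open>\<gamma> = \<Gamma>'(m0) \<noteq> 0\<close>, there is one root \<open>m1\<close> near \<open>m0\<close>.  It is the cosine of an angle only if it falls on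
  the inner side of \<open>\<plusminus>1\<close>, and then of two angles \<open>\<theta>0 \<plusminus> arccos (m0 m1)\<close>.  This turns the passage of
  \<open>m1\<close> through \<open>m0\<close> into a pitchfork, with the square root rate of \<open>arccos\<close> at 1 (\<open>branching\<close>,
  \<open>pitchfork\<close>).

  The heteroclinic orbits come from an explicit approximation.  On the straight segment in \<open>(m, w)\<close>
  between the two equilibria, parametrized by \<open>t \<in> [0, 1]\<close>, the Riccati field is
  \<open>\<Delta>\<^sup>2 t (1 - t)\<close> times a bounded factor, \<open>\<Delta> = m0 - m1\<close> (\<open>riccati_chord\<close>).  In the ansatz
  \<open>w = segment + \<Delta> t (1 - t) x\<close> with the time scale in which \<open>t\<close> is the logistic function, the
  remainder \<open>x\<close> solves \<open>x' = k - g x / \<Delta>\<close>, where \<open>g\<close> is close to a constant with nonzero real part.  For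
  small \<open>\<Delta>\<close> the contraction principle yields a bounded solution on the whole line
  (\<open>slow_fast_bounded_solution\<close>), and the factor \<open>t (1 - t)\<close> makes it a connection
  (\<open>connecting_orbit\<close>).  No invariant manifold theory enters, and attracting and repelling fast
  directions (\<open>s > 0\<close> and \<open>s < 0\<close>) are treated alike.

  The direction of the orbits is that of the new time scale, which is the sign of \<open>\<gamma> s\<close>
  (\<open>Re_\<kappa>0_sign\<close>).  It agrees with the sign of \<open>- m0 Re W\<close> (\<open>Re_W_sign\<close>), as it must, because orbits
  can approach the invariant plane only along an attracting direction of \<open>\<theta>\<close>.
\<close>

section \<open>Bounded solutions of perturbed linear equations\<close>

lemma expanding_integrable:
  fixes A :: complex and g :: "real \<Rightarrow> complex"
  assumes A: "Re A < 0" and g: "continuous_on UNIV g" and M: "\<And>t. norm (g t) \<le> M"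
  shows "(\<lambda>\<sigma>. exp (A * of_real \<sigma>) * g \<sigma>) integrable_on {t..}"
    and "norm (integral {t..} (\<lambda>\<sigma>. exp (A * of_real \<sigma>) * g \<sigma>)) \<le> M * (exp (Re A * t) / - Re A)"
proof -
  have cont: "continuous_on S (\<lambda>\<sigma>. exp (A * of_real \<sigma>) * g \<sigma>)" for S
    by (intro continuous_intros continuous_on_subset[OF g]) auto
  have hi: "((\<lambda>\<sigma>. M * exp (Re A * \<sigma>)) has_integral M * (exp (Re A * t) / - Re A)) {t..}"
    using has_integral_mult_right[OF has_integral_exp_minus_to_infinity[of "- Re A" t], of M] A by simp
  have bd: "norm (exp (A * of_real \<sigma>) * g \<sigma>) \<le> M * exp (Re A * \<sigma>)" for \<sigma>
    using mult_left_mono[OF M, of "exp (Re A * \<sigma>)" \<sigma>] by (simp add: norm_mult mult.commute)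
  show int: "(\<lambda>\<sigma>. exp (A * of_real \<sigma>) * g \<sigma>) integrable_on {t..}"
  proof (rule integrable_on_all_intervals_integrable_bound[OF _ bd])
    fix a b :: real
    have "(\<lambda>\<sigma>. exp (A * of_real \<sigma>) * g \<sigma>) integrable_on {max a t..b}"
      by (rule integrable_continuous_real) (rule cont)
    moreover have "{a..b} \<inter> {t..} = {max a t..b}" by auto
    ultimately have "(\<lambda>\<sigma>. exp (A * of_real \<sigma>) * g \<sigma>) integrable_on ({t..} \<inter> {a..b})"
      by (metis inf_commute)
    then show "(\<lambda>\<sigma>. if \<sigma> \<in> {t..} then exp (A * of_real \<sigma>) * g \<sigma> else 0) integrable_on cbox a b"
      unfolding cbox_interval using integrable_restrict_Int[of "{t..}" "\<lambda>\<sigma>. exp (A * of_real \<sigma>) * g \<sigma>" "{a..b}"] by blast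
  next
    show "(\<lambda>\<sigma>. M * exp (Re A * \<sigma>)) integrable_on {t..}" using hi by (rule has_integral_integrable)
  qed
  show "norm (integral {t..} (\<lambda>\<sigma>. exp (A * of_real \<sigma>) * g \<sigma>)) \<le> M * (exp (Re A * t) / - Re A)"
    using integral_norm_bound_integral[OF int has_integral_integrable[OF hi] bd] integral_unique[OF hi] by simp
qed

text \<open>
  For \<open>Re A < 0\<close> the homogeneous solutions of \<open>u' = - A u + g\<close> grow forward in time.  The unique bounded
  solution is therefore determined by the future of \<open>g\<close>.
\<close>

definition expanding_response :: "complex \<Rightarrow> (real \<Rightarrow> complex) \<Rightarrow> real \<Rightarrow> complex" where
  "expanding_response A g t = - exp (- A * of_real t) * integral {t..} (\<lambda>\<sigma>. exp (A * of_real \<sigma>) * g \<sigma>)"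

lemma norm_expanding_response_le:
  assumes A: "Re A < 0" and g: "continuous_on UNIV g" and M: "\<And>t. norm (g t) \<le> M"
  shows "norm (expanding_response A g t) \<le> M / - Re A"
proof -
  have "norm (expanding_response A g t)
      \<le> exp (- Re A * t) * (M * (exp (Re A * t) / - Re A))"
    unfolding expanding_response_def norm_mult norm_minus_cancel
    using expanding_integrable(2)[OF assms] by (intro mult_mono) auto
  also have "\<dots> = M / - Re A" by (simp add: exp_minus field_simps)
  finally show ?thesis .
qed

lemma expanding_response_diff:
  assumes A: "Re A < 0" and g: "continuous_on UNIV g" and M: "\<And>t. norm (g t) \<le> M"
    and f: "continuous_on UNIV f" and N: "\<And>t. norm (f t) \<le> N"
  shows "expanding_response A g t - expanding_response A f t = expanding_response A (\<lambda>t. g t - f t) t"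
  unfolding expanding_response_def right_diff_distrib
  by (subst integral_diff[OF expanding_integrable(1)[OF A g M] expanding_integrable(1)[OF A f N]])
     (simp add: algebra_simps)

text \<open>
  The integral over \<open>{t..}\<close> is a constant minus an integral over a compact interval with moving right
  end, to which the fundamental theorem of calculus applies.
\<close>

lemma expanding_response_has_vector_derivative:
  assumes A: "Re A < 0" and g: "continuous_on UNIV g" and M: "\<And>t. norm (g t) \<le> M"
  shows "(expanding_response A g has_vector_derivative (- A * expanding_response A g t + g t)) (at t)"
proof -
  define f where "f = (\<lambda>\<sigma>. exp (A * of_real \<sigma>) * g \<sigma>)"
  have cont: "continuous_on S f" for S
    unfolding f_def by (intro continuous_intros continuous_on_subset[OF g]) auto
  have split: "integral {u..} f = integral {t-1..} f - integral {t-1..u} f" if "u \<in> {t-1..}" for u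
  proof -
    have "(f has_integral (integral {t-1..u} f + integral {u..} f)) ({t-1..u} \<union> {u..})"
      using that expanding_integrable(1)[OF assms]
      by (intro has_integral_Un integrable_integral integrable_continuous_real cont)
         (auto simp: f_def intro: negligible_subset[of "{u}"])
    moreover have "{t-1..u} \<union> {u..} = {t-1..}" using that by auto
    ultimately show ?thesis by (simp add: integral_unique)
  qed
  have "((\<lambda>u. integral {t-1..u} f) has_vector_derivative f t) (at t within {t-1..t+1})"
    by (rule integral_has_vector_derivative[OF cont]) auto
  then have d1: "((\<lambda>u. integral {t-1..u} f) has_vector_derivative f t) (at t)"
    by (simp add: at_within_Icc_at)
  have d2: "((\<lambda>u. integral {u..} f) has_vector_derivative - f t) (at t)"
  proof (rule has_vector_derivative_transform_within_open)
    show "((\<lambda>u. integral {t-1..} f - integral {t-1..u} f) has_vector_derivative - f t) (at t)"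
      using d1 by (auto intro!: derivative_eq_intros)
    show "open {t-1<..}" by simp
    show "t \<in> {t-1<..}" by simp
    show "integral {t-1..} f - integral {t-1..u} f = integral {u..} f" if "u \<in> {t-1<..}" for u
      using split[of u] that by simp
  qed
  have d3: "((\<lambda>u. exp (- A * of_real u)) has_vector_derivative - A * exp (- A * of_real t)) (at t)"
    by (auto intro!: derivative_eq_intros has_vector_derivative_real_field)
  have "((\<lambda>u. - (exp (- A * of_real u) * integral {u..} f)) has_vector_derivative
     - (exp (- A * of_real t) * - f t + - A * exp (- A * of_real t) * integral {t..} f)) (at t)"
    by (intro has_vector_derivative_minus has_vector_derivative_mult d2 d3)
  moreover have "exp (- A * of_real t) * f t = g t"
    unfolding f_def by (simp add: exp_minus)
  ultimately show ?thesis
    unfolding expanding_response_def f_def[symmetric]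
    by (simp add: algebra_simps fun_eq_iff)
qed

text \<open>
  A bounded solution is a fixed point of \<open>x \<mapsto> expanding_response A (n _ (x _))\<close>.  The response operator
  has norm \<open>1 / \<bar>Re A\<bar>\<close> on bounded functions, so a Lipschitz constant below \<open>\<bar>Re A\<bar>\<close> makes this map a
  contraction.
\<close>

lemma bounded_solution_expanding:
  fixes n :: "real \<Rightarrow> complex \<Rightarrow> complex" and A :: complex
  assumes A: "Re A < 0" and r: "0 \<le> r" and K: "0 \<le> K" "K < - Re A"
    and cont: "continuous_on (UNIV \<times> cball 0 r) (\<lambda>(t, x). n t x)"
    and lip: "\<And>t x y. norm x \<le> r \<Longrightarrow> norm y \<le> r \<Longrightarrow> norm (n t x - n t y) \<le> K * norm (x - y)"
    and bnd: "\<And>t x. norm x \<le> r \<Longrightarrow> norm (n t x) \<le> - Re A * r"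
  shows "\<exists>x. \<forall>t. norm (x t) \<le> r \<and> (x has_vector_derivative (- A * x t + n t (x t))) (at t)"
proof -
  define B where "B = (cball 0 r :: (real \<Rightarrow>\<^sub>C complex) set)"
  define N where "N = (\<lambda>(x :: real \<Rightarrow>\<^sub>C complex) t. n t (x t))"
  define T where "T x = Bcontfun (expanding_response A (N x))" for x
  have inB: "norm (apply_bcontfun x t) \<le> r" if "x \<in> B" for x t
    using that norm_bounded[of x t] unfolding B_def by simp
  have Nc: "continuous_on UNIV (N x)" if "x \<in> B" for x
  proof -
    have "continuous_on UNIV ((\<lambda>(t, x). n t x) \<circ> (\<lambda>t. (t, x t)))"
    proof (rule continuous_on_compose)
      show "continuous_on UNIV (\<lambda>t. (t, x t))" by (intro continuous_intros) auto
      show "continuous_on ((\<lambda>t. (t, x t)) ` UNIV) (\<lambda>(t, x). n t x)"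
        by (rule continuous_on_subset[OF cont]) (use inB[OF that] in auto)
    qed
    then show ?thesis unfolding N_def o_def by simp
  qed
  have Nb: "norm (N x t) \<le> - Re A * r" if "x \<in> B" for x t
    unfolding N_def by (rule bnd[OF inB[OF that]])
  have Jb: "norm (expanding_response A (N x) t) \<le> r" if "x \<in> B" for x t
    using norm_expanding_response_le[OF A Nc[OF that] Nb[OF that]] A by simp
  have Jd: "(expanding_response A (N x) has_vector_derivative
      (- A * expanding_response A (N x) t + N x t)) (at t)" if "x \<in> B" for x t
    by (rule expanding_response_has_vector_derivative[OF A Nc[OF that] Nb[OF that]])
  have Ta: "apply_bcontfun (T x) = expanding_response A (N x)" if "x \<in> B" for x
    unfolding T_def
  proof (rule Bcontfun_inverse)
    have "continuous_on UNIV (expanding_response A (N x))"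
      using Jd[OF that] by (meson continuous_at_imp_continuous_on has_vector_derivative_continuous)
    then show "expanding_response A (N x) \<in> bcontfun"
      using Jb[OF that] by (auto simp: bcontfun_def bounded_iff)
  qed
  have "\<exists>!x\<in>B. T x = x"
  proof (rule Banach_fix)
    show "complete B" unfolding B_def by (simp add: complete_eq_closed)
    show "B \<noteq> {}" unfolding B_def using r by simp
    show "0 \<le> K / - Re A" "K / - Re A < 1" using K A by (auto simp: field_simps)
    show "T ` B \<subseteq> B"
      using Jb Ta r unfolding B_def by (auto intro!: norm_bound)
    show "dist (T x) (T y) \<le> K / - Re A * dist x y" if x: "x \<in> B" and y: "y \<in> B" for x y
    proof (rule dist_bound)
      fix t
      have "norm (expanding_response A (\<lambda>t. N x t - N y t) t) \<le> K * dist x y / - Re A"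
      proof (rule norm_expanding_response_le[OF A])
        show "continuous_on UNIV (\<lambda>t. N x t - N y t)"
          by (intro continuous_intros Nc x y)
        fix t
        have "norm (N x t - N y t) \<le> K * dist (x t) (y t)"
          unfolding N_def dist_norm by (rule lip[OF inB[OF x] inB[OF y]])
        also have "\<dots> \<le> K * dist x y" by (intro mult_left_mono dist_bounded K)
        finally show "norm (N x t - N y t) \<le> K * dist x y" .
      qed
      then show "dist (T x t) (T y t) \<le> K / - Re A * dist x y"
        unfolding Ta[OF x] Ta[OF y] dist_norm
        by (simp add: expanding_response_diff[OF A Nc[OF x] Nb[OF x] Nc[OF y] Nb[OF y]])
    qed
  qed
  then obtain x where x: "x \<in> B" "T x = x" by blast
  then have eq: "apply_bcontfun x = expanding_response A (N x)" using Ta by metis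
  show ?thesis
    using inB[OF x(1)] Jd[OF x(1)] unfolding eq[symmetric]
    by (intro exI[of _ "apply_bcontfun x"]) (simp add: N_def)
qed

text \<open>
  Reversal of time exchanges the two signs of \<open>Re A\<close>.
\<close>

lemma bounded_solution:
  fixes n :: "real \<Rightarrow> complex \<Rightarrow> complex" and A :: complex
  assumes r: "0 \<le> r" and K: "0 \<le> K" "K < \<bar>Re A\<bar>"
    and cont: "continuous_on (UNIV \<times> cball 0 r) (\<lambda>(t, x). n t x)"
    and lip: "\<And>t x y. norm x \<le> r \<Longrightarrow> norm y \<le> r \<Longrightarrow> norm (n t x - n t y) \<le> K * norm (x - y)"
    and bnd: "\<And>t x. norm x \<le> r \<Longrightarrow> norm (n t x) \<le> \<bar>Re A\<bar> * r"
  shows "\<exists>x. \<forall>t. norm (x t) \<le> r \<and> (x has_vector_derivative (- A * x t + n t (x t))) (at t)"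
proof (cases "Re A < 0")
  case True
  then show ?thesis using bounded_solution_expanding[OF True r K(1) _ cont lip] K(2) bnd by simp
next
  case False
  define n' where "n' = (\<lambda>t x. - n (- t) x)"
  have "\<exists>x. \<forall>t. norm (x t) \<le> r \<and> (x has_vector_derivative (- (- A) * x t + n' t (x t))) (at t)"
  proof (rule bounded_solution_expanding[OF _ r K(1)])
    show "Re (- A) < 0" "K < - Re (- A)" using False K by auto
    have "continuous_on (UNIV \<times> cball 0 r) ((\<lambda>(t, x). n t x) \<circ> (\<lambda>(t, x). (- t, x)))"
    proof (rule continuous_on_compose)
      show "continuous_on ((\<lambda>(t, x). (- t, x)) ` (UNIV \<times> cball 0 r)) (\<lambda>(t, x). n t x)"
        by (rule continuous_on_subset[OF cont]) auto
    qed (auto simp: case_prod_beta intro!: continuous_intros)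
    then show "continuous_on (UNIV \<times> cball 0 r) (\<lambda>(t, x). n' t x)"
      unfolding n'_def by (auto simp: o_def case_prod_beta intro: continuous_on_minus)
    show "norm (n' t x - n' t y) \<le> K * norm (x - y)" if "norm x \<le> r" "norm y \<le> r" for t x y
      using lip[OF that, of "- t"] unfolding n'_def by (simp add: norm_minus_commute)
    show "norm (n' t x) \<le> - Re (- A) * r" if "norm x \<le> r" for t x
      using bnd[OF that, of "- t"] False unfolding n'_def by simp
  qed
  then obtain x where x: "\<And>t. norm (x t) \<le> r"
    "\<And>t. (x has_vector_derivative (A * x t + n' t (x t))) (at t)" by auto
  have "((\<lambda>t. x (- t)) has_vector_derivative (- A * x (- t) + n t (x (- t)))) (at t)" for t
  proof -
    have "((x \<circ> uminus) has_vector_derivative (-1) *\<^sub>R (A * x (- t) + n' (- t) (x (- t)))) (at t)"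
      by (rule vector_diff_chain_at) (auto intro!: derivative_eq_intros x)
    then show ?thesis unfolding n'_def o_def by simp
  qed
  then show ?thesis using x(1) by (intro exI[of _ "\<lambda>t. x (- t)"]) auto
qed

section \<open>Heteroclinic orbits from rescaled orbits\<close>

text \<open>
  A curve with velocity \<open>g f\<close> is turned into one with velocity \<open>f\<close> by the inverse of an antiderivative of
  \<open>g\<close>.  The bound \<open>l g \<ge> e > 0\<close> makes the new time run through the whole line, in the direction given by
  the sign of \<open>l\<close>.
\<close>

lemma inverse_time:
  fixes g :: "real \<Rightarrow> real"
  assumes g: "continuous_on UNIV g" and e: "e > 0" "\<And>\<tau>. l * g \<tau> \<ge> e"
  obtains T where "\<And>\<xi>. (T has_real_derivative 1 / g (T \<xi>)) (at \<xi>)"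
    and "LIM \<tau> at_top. T (\<tau> / l) :> at_top" and "LIM \<tau> at_bot. T (\<tau> / l) :> at_bot"
proof -
  have l: "l \<noteq> 0" using e(2)[of 0] e(1) by auto
  have "\<exists>P. \<forall>x::real. -\<infinity> < ereal x \<longrightarrow> ereal x < \<infinity> \<longrightarrow> (P has_vector_derivative l * g x) (at x)"
    by (rule einterval_antiderivative)
       (use g in \<open>auto intro!: continuous_intros simp: continuous_on_eq_continuous_at\<close>)
  then obtain P where P: "\<And>x. (P has_real_derivative l * g x) (at x)"
    by (auto simp: has_real_derivative_iff_has_vector_derivative)
  have grow: "P b - P a \<ge> e * (b - a)" if "a \<le> b" for a b
  proof -
    have "P a - e * a \<le> P b - e * b"
      by (rule DERIV_nonneg_imp_nondecreasing[OF that])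
         (auto intro!: exI[of _ "l * g _ - e"] derivative_eq_intros P e(2) simp: le_diff_eq)
    then show ?thesis by (simp add: algebra_simps)
  qed
  have mono: "P a < P b" if "a < b" for a b
  proof -
    have "0 < e * (b - a)" using that e(1) by simp
    then show ?thesis using grow[of a b] that by linarith
  qed
  then have inj: "inj P" by (metis injI linorder_neqE_linordered_idom less_irrefl)
  have Pc: "isCont P x" for x using P DERIV_isCont by blast
  have surj: "\<exists>x. P x = y" for y
  proof -
    define d where "d = \<bar>y - P 0\<bar> / e"
    have d: "d \<ge> 0" "e * d = \<bar>y - P 0\<bar>" using e(1) by (auto simp: d_def)
    have "P (- d) \<le> y" "y \<le> P d" using grow[of "- d" 0] grow[of 0 d] d by auto
    then show ?thesis using IVT[of P "- d" y d] Pc d(1) by auto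
  qed
  define S where "S = inv P"
  have PS: "P (S y) = y" for y unfolding S_def using surj by (metis f_inv_into_f rangeI)
  have SP: "S (P x) = x" for x unfolding S_def by (rule inv_f_f[OF inj])
  have Smono: "a \<le> S y \<longleftrightarrow> P a \<le> y" for a y
    by (metis PS mono leD leI order_le_less)
  have Smono': "S y \<le> a \<longleftrightarrow> y \<le> P a" for a y
    by (metis PS mono leD leI order_le_less)
  have Sd: "(S has_real_derivative inverse (l * g (S y))) (at y)" for y
  proof -
    have "l * g (S y) \<noteq> 0" using e(2)[of "S y"] e(1) by auto
    then have "(S has_derivative (*) (inverse (l * g (S y)))) (at (P (S y)))"
      using P[of "S y"] unfolding has_field_derivative_def
      by (intro has_derivative_inverse_strong[of UNIV _ P _ "(*) (l * g (S y))"])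
         (auto intro!: SP Pc continuous_at_imp_continuous_on simp: fun_eq_iff field_simps)
    then have "(S has_real_derivative inverse (l * g (S y))) (at (P (S y)))"
      unfolding has_field_derivative_def .
    then show ?thesis by (simp add: PS)
  qed
  have Stop: "filterlim S at_top at_top"
    unfolding filterlim_at_top Smono by (auto intro: eventually_ge_at_top)
  have Sbot: "filterlim S at_bot at_bot"
    unfolding filterlim_at_bot Smono' by (auto intro: eventually_le_at_bot)
  show ?thesis
  proof (rule that[of "\<lambda>\<xi>. S (l * \<xi>)"])
    fix \<xi>
    have "((\<lambda>\<xi>. S (l * \<xi>)) has_real_derivative inverse (l * g (S (l * \<xi>))) * l) (at \<xi>)"
      by (rule DERIV_chain2[OF Sd]) (auto intro!: derivative_eq_intros)
    then show "((\<lambda>\<xi>. S (l * \<xi>)) has_real_derivative 1 / g (S (l * \<xi>))) (at \<xi>)"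
      using l by (simp add: field_simps)
  qed (use l Stop Sbot in simp_all)
qed

lemma heteroclinic_of_rescaled_orbit:
  fixes f :: "'a::real_normed_vector \<Rightarrow> 'a"
  assumes Y: "\<And>\<tau>. (Y has_vector_derivative g \<tau> *\<^sub>R f (Y \<tau>)) (at \<tau>)"
    and a: "(Y \<longlongrightarrow> a) at_bot" and b: "(Y \<longlongrightarrow> b) at_top"
    and eq: "f a = 0" "f b = 0" "a \<noteq> b"
    and g: "continuous_on UNIV g" and e: "e > 0" "\<And>\<tau>. l * g \<tau> \<ge> e"
  shows "heteroclinic f l a b"
proof -
  obtain T where T: "\<And>\<xi>. (T has_real_derivative 1 / g (T \<xi>)) (at \<xi>)"
    and top: "LIM \<tau> at_top. T (\<tau> / l) :> at_top" and bot: "LIM \<tau> at_bot. T (\<tau> / l) :> at_bot"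
    using inverse_time[OF g e] by metis
  have "g \<tau> \<noteq> 0" for \<tau> using e(2)[of \<tau>] e(1) by auto
  then have "((Y \<circ> T) has_vector_derivative f ((Y \<circ> T) \<xi>)) (at \<xi>)" for \<xi>
    using vector_diff_chain_at[OF T[of \<xi>, unfolded has_real_derivative_iff_has_vector_derivative] Y]
    by simp
  moreover have "l \<noteq> 0" using e(2)[of 0] e(1) by auto
  ultimately show ?thesis
    unfolding heteroclinic_def
    using eq filterlim_compose[OF a bot] filterlim_compose[OF b top]
    by (intro conjI exI[of _ "Y \<circ> T"]) auto
qed

section \<open>The Riccati form of the system\<close>

text \<open>
  The equations for \<open>p\<close> and \<open>q\<close>, written for \<open>w = p + \<i> q\<close> at fixed \<open>cos \<theta> = m\<close>.
\<close>

fun riccati :: "params \<Rightarrow> real \<Rightarrow> complex \<Rightarrow> complex" where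
  "riccati (\<alpha>, \<beta>, h, \<mu>, \<Omega>, c, s) m w =
     Complex (h - \<mu> * m - \<Omega>) (\<alpha> * \<Omega> - \<beta> / (1 + c * m))
       - Complex \<alpha> 1 * of_real s * w - of_real m * w\<^sup>2"

lemma coh_field_eq_riccati:
  "coh_field P (\<theta>, Re w, Im w) =
     (sin \<theta> * Re w, Re (riccati P (cos \<theta>) w), Im (riccati P (cos \<theta>) w))"
  by (cases P) (simp add: power2_eq_square algebra_simps)

text \<open>
  A solution in the variables \<open>m = cos \<theta>\<close> and \<open>w\<close> lifts to two solutions, one on each side of \<open>\<theta>0\<close>: since
  \<open>cos (\<theta> - \<theta>0) = m0 m\<close>, the angle is \<open>\<theta>0 \<plusminus> arccos (m0 m)\<close>.
\<close>

lemma orbit_lift: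
  fixes m g :: "real \<Rightarrow> real" and w :: "real \<Rightarrow> complex"
  assumes th: "sin \<theta>0 = 0" "m0 = cos \<theta>0" and \<sigma>: "\<sigma> \<in> {-1, 1}"
    and m: "(m has_real_derivative - g \<tau> * (1 - (m \<tau>)\<^sup>2) * Re (w \<tau>)) (at \<tau>)" "\<bar>m \<tau>\<bar> < 1"
    and w: "(w has_vector_derivative g \<tau> *\<^sub>R riccati P (m \<tau>) (w \<tau>)) (at \<tau>)"
  shows "((\<lambda>\<tau>. (\<theta>0 + \<sigma> * arccos (m0 * m \<tau>), Re (w \<tau>), Im (w \<tau>))) has_vector_derivative
     g \<tau> *\<^sub>R coh_field P (\<theta>0 + \<sigma> * arccos (m0 * m \<tau>), Re (w \<tau>), Im (w \<tau>))) (at \<tau>)"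
proof -
  have m0: "m0 = 1 \<or> m0 = -1"
    using th sin_cos_squared_add[of \<theta>0] by (simp add: power2_eq_1_iff)
  have lt: "\<bar>m0 * m \<tau>\<bar> < 1" using m0 m(2) by auto
  have cs: "cos (\<theta>0 + \<sigma> * arccos (m0 * m \<tau>)) = m \<tau>"
    using m0 \<sigma> lt th by (auto simp: cos_add cos_arccos_abs)
  have sq: "sqrt (1 - (m0 * m \<tau>)\<^sup>2) = sqrt (1 - (m \<tau>)\<^sup>2)" using m0 by auto
  have sn: "sin (\<theta>0 + \<sigma> * arccos (m0 * m \<tau>)) = m0 * \<sigma> * sqrt (1 - (m \<tau>)\<^sup>2)"
    using m0 \<sigma> lt th by (auto simp: sin_add sin_arccos_abs sq)
  have pos: "1 - (m \<tau>)\<^sup>2 > 0" using m(2) by (simp add: abs_square_less_1)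
  have "((\<lambda>\<tau>. \<theta>0 + \<sigma> * arccos (m0 * m \<tau>)) has_real_derivative
      \<sigma> * (inverse (- sqrt (1 - (m0 * m \<tau>)\<^sup>2)) * (m0 * (- g \<tau> * (1 - (m \<tau>)\<^sup>2) * Re (w \<tau>))))) (at \<tau>)"
    using lt by (auto intro!: derivative_eq_intros m(1) DERIV_chain2[OF DERIV_arccos])
  also have "\<sigma> * (inverse (- sqrt (1 - (m0 * m \<tau>)\<^sup>2)) * (m0 * (- g \<tau> * (1 - (m \<tau>)\<^sup>2) * Re (w \<tau>))))
     = g \<tau> * (m0 * \<sigma> * ((1 - (m \<tau>)\<^sup>2) / sqrt (1 - (m \<tau>)\<^sup>2)) * Re (w \<tau>))"
    unfolding sq by (simp add: divide_inverse)
  also have "(1 - (m \<tau>)\<^sup>2) / sqrt (1 - (m \<tau>)\<^sup>2) = sqrt (1 - (m \<tau>)\<^sup>2)"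
    using pos by (simp add: real_div_sqrt)
  finally have "((\<lambda>\<tau>. \<theta>0 + \<sigma> * arccos (m0 * m \<tau>)) has_vector_derivative
      g \<tau> * (sin (\<theta>0 + \<sigma> * arccos (m0 * m \<tau>)) * Re (w \<tau>))) (at \<tau>)"
    unfolding sn by (simp add: has_real_derivative_iff_has_vector_derivative mult.assoc)
  moreover have "((\<lambda>\<tau>. Re (w \<tau>)) has_vector_derivative Re (g \<tau> *\<^sub>R riccati P (m \<tau>) (w \<tau>))) (at \<tau>)"
    "((\<lambda>\<tau>. Im (w \<tau>)) has_vector_derivative Im (g \<tau> *\<^sub>R riccati P (m \<tau>) (w \<tau>))) (at \<tau>)"
    using bounded_linear.has_vector_derivative[OF bounded_linear_Re w]
      bounded_linear.has_vector_derivative[OF bounded_linear_Im w] by auto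
  ultimately show ?thesis
    unfolding coh_field_eq_riccati cs scaleR_Pair
    by (intro has_vector_derivative_Pair) simp_all
qed

section \<open>Connections between nearby zeros of the Riccati field\<close>

text \<open>
  For small \<open>\<Delta>\<close> the equation \<open>x' = k - g x / \<Delta>\<close> is dominated by the constant coefficient \<open>a / \<Delta>\<close>.  The
  deviation of \<open>g\<close> from \<open>a\<close> is divided by \<open>\<Delta>\<close> as well and has to be small relative to \<open>Re a\<close>.  The
  term \<open>k\<close> only has to be bounded, as its contribution carries a factor \<open>\<Delta>\<close>.
\<close>

lemma slow_fast_bounded_solution:
  fixes g k :: "real \<Rightarrow> complex \<Rightarrow> complex" and a :: complex and \<Delta> :: real
  assumes r: "0 < r" and \<Delta>: "\<Delta> \<noteq> 0" and a: "Re a \<noteq> 0"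
    and gc: "continuous_on (UNIV \<times> cball 0 r) (\<lambda>(t, x). g t x)"
    and kc: "continuous_on (UNIV \<times> cball 0 r) (\<lambda>(t, x). k t x)"
    and ga: "\<And>t x. norm x \<le> r \<Longrightarrow> norm (g t x - a) \<le> \<bar>Re a\<bar> / 8"
    and gl: "\<And>t x y. norm x \<le> r \<Longrightarrow> norm y \<le> r \<Longrightarrow> norm (g t x - g t y) \<le> L * norm (x - y)"
    and kl: "\<And>t x y. norm x \<le> r \<Longrightarrow> norm y \<le> r \<Longrightarrow> norm (k t x - k t y) \<le> N * norm (x - y)"
    and k0: "\<And>t. norm (k t 0) \<le> N"
    and L: "L * r \<le> \<bar>Re a\<bar> / 8"
    and N: "\<bar>\<Delta>\<bar> * N \<le> \<bar>Re a\<bar> / 8" "\<bar>\<Delta>\<bar> * N \<le> \<bar>Re a\<bar> / 8 * r"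
  shows "\<exists>x. \<forall>t. norm (x t) \<le> r \<and>
    (x has_vector_derivative (k t (x t) - g t (x t) * x t / of_real \<Delta>)) (at t)"
proof -
  \<comment> \<open>The constant part \<open>a\<close> of \<open>g\<close> goes into the linear equation, the rest is the perturbation \<open>n\<close>.\<close>
  define n where "n = (\<lambda>t x. k t x - (g t x - a) * x / of_real \<Delta>)"
  define A where "A = a / of_real \<Delta>"
  define \<rho> where "\<rho> = \<bar>Re a\<bar>"
  have \<rho>: "\<rho> > 0" using a by (simp add: \<rho>_def)
  have ReA: "\<bar>Re A\<bar> = \<rho> / \<bar>\<Delta>\<bar>" by (simp add: A_def \<rho>_def Re_divide_of_real)
  have L0: "0 \<le> L * norm (x - y)" if "norm x \<le> r" "norm y \<le> r" for x y :: complex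
    using order_trans[OF norm_ge_zero gl[OF that]] by blast
  have lip: "norm (n t x - n t y) \<le> (\<rho> / 2 / \<bar>\<Delta>\<bar>) * norm (x - y)"
    if x: "norm x \<le> r" and y: "norm y \<le> r" for t x y
  proof -
    have "n t x - n t y = (k t x - k t y) - ((g t x - a) * (x - y) + (g t x - g t y) * y) / of_real \<Delta>"
      unfolding n_def using \<Delta> by (simp add: field_simps)
    also have "norm \<dots> \<le> norm (k t x - k t y)
        + norm ((g t x - a) * (x - y) + (g t x - g t y) * y) / \<bar>\<Delta>\<bar>"
      by (rule order_trans[OF norm_triangle_ineq4]) (simp add: norm_divide)
    also have "\<dots> \<le> N * norm (x - y) + (\<rho> / 8 * norm (x - y) + L * norm (x - y) * r) / \<bar>\<Delta>\<bar>"
    proof (intro add_mono divide_right_mono kl x y)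
      show "norm ((g t x - a) * (x - y) + (g t x - g t y) * y)
          \<le> \<rho> / 8 * norm (x - y) + L * norm (x - y) * r"
        unfolding \<rho>_def
        using mult_right_mono[OF ga[OF x, of t] norm_ge_zero[of "x - y"]]
          mult_mono[OF gl[OF x y, of t] y L0[OF x y] norm_ge_zero]
        by (intro order_trans[OF norm_triangle_ineq] add_mono) (simp_all add: norm_mult)
    qed simp
    also have "\<dots> = (\<bar>\<Delta>\<bar> * N + \<rho> / 8 + L * r) / \<bar>\<Delta>\<bar> * norm (x - y)"
      using \<Delta> by (simp add: field_simps)
    also have "\<dots> \<le> (\<rho> / 2 / \<bar>\<Delta>\<bar>) * norm (x - y)"
      using N(1) L \<rho> \<Delta> by (intro mult_right_mono divide_right_mono) (auto simp: \<rho>_def)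
    finally show ?thesis .
  qed
  have bnd: "norm (n t x) \<le> \<bar>Re A\<bar> * r" if x: "norm x \<le> r" for t x
  proof -
    have "norm (n t x) \<le> norm (n t 0) + norm (n t x - n t 0)"
      by (metis add.commute diff_add_cancel norm_triangle_ineq)
    also have "\<dots> \<le> \<rho> / 8 * r / \<bar>\<Delta>\<bar> + (\<rho> / 2 / \<bar>\<Delta>\<bar>) * r"
    proof (rule add_mono)
      have "norm (n t 0) \<le> N" using k0[of t] by (simp add: n_def)
      then have "\<bar>\<Delta>\<bar> * norm (n t 0) \<le> \<rho> / 8 * r"
        using N(2) mult_left_mono[of "norm (n t 0)" N "\<bar>\<Delta>\<bar>"] unfolding \<rho>_def by linarith
      then show "norm (n t 0) \<le> \<rho> / 8 * r / \<bar>\<Delta>\<bar>" using \<Delta> by (simp add: field_simps)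
      show "norm (n t x - n t 0) \<le> (\<rho> / 2 / \<bar>\<Delta>\<bar>) * r"
        using lip[OF x, of 0 t] r x \<rho> mult_left_mono[OF x, of "\<rho> / 2 / \<bar>\<Delta>\<bar>"] by simp
    qed
    also have "\<dots> \<le> \<rho> / \<bar>\<Delta>\<bar> * r"
      using r \<rho> \<Delta> by (simp add: field_simps)
    finally show ?thesis unfolding ReA .
  qed
  have "\<exists>x. \<forall>t. norm (x t) \<le> r \<and> (x has_vector_derivative (- A * x t + n t (x t))) (at t)"
  proof (rule bounded_solution[OF _ _ _ _ lip bnd])
    show "0 \<le> r" using r by simp
    show "0 \<le> \<rho> / 2 / \<bar>\<Delta>\<bar>" using \<rho> by simp
    show "\<rho> / 2 / \<bar>\<Delta>\<bar> < \<bar>Re A\<bar>" unfolding ReA using \<rho> \<Delta> by (simp add: field_simps)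
    show "continuous_on (UNIV \<times> cball 0 r) (\<lambda>(t, x). n t x)"
      unfolding n_def using gc kc \<Delta> by (auto simp: case_prod_beta intro!: continuous_intros)
  qed
  moreover have "- A * x + n t x = k t x - g t x * x / of_real \<Delta>" for t x
    unfolding A_def n_def using \<Delta> by (simp add: field_simps)
  ultimately show ?thesis by simp
qed

definition logistic :: "real \<Rightarrow> real" where
  "logistic \<tau> = 1 / (1 + exp (- \<tau>))"

lemma logistic_bounds: "0 < logistic \<tau>" "logistic \<tau> < 1"
  by (simp_all add: logistic_def field_simps add_pos_pos)

lemma logistic_has_derivative:
  "(logistic has_real_derivative logistic \<tau> * (1 - logistic \<tau>)) (at \<tau>)"
proof -
  have nz: "1 + exp (- \<tau>) \<noteq> 0" by (smt (verit) exp_gt_zero)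
  have "((\<lambda>\<tau>. 1 / (1 + exp (- \<tau>))) has_real_derivative
     exp (- \<tau>) / ((1 + exp (- \<tau>)) * (1 + exp (- \<tau>)))) (at \<tau>)"
    using nz by (auto intro!: derivative_eq_intros)
  moreover have "exp (- \<tau>) / ((1 + exp (- \<tau>)) * (1 + exp (- \<tau>))) = logistic \<tau> * (1 - logistic \<tau>)"
    unfolding logistic_def using nz by (simp add: field_simps)
  ultimately show ?thesis unfolding logistic_def by (simp add: logistic_def[abs_def])
qed

lemma logistic_at_top: "(logistic \<longlongrightarrow> 1) at_top"
proof -
  have "((\<lambda>\<tau>::real. exp (- \<tau>)) \<longlongrightarrow> 0) at_top"
    by (rule filterlim_compose[OF exp_at_bot filterlim_uminus_at_bot_at_top])
  then have "((\<lambda>\<tau>::real. 1 / (1 + exp (- \<tau>))) \<longlongrightarrow> 1 / (1 + 0)) at_top"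
    by (intro tendsto_intros) auto
  then show ?thesis by (simp add: logistic_def[abs_def])
qed

lemma logistic_at_bot: "(logistic \<longlongrightarrow> 0) at_bot"
proof -
  have "filterlim (\<lambda>\<tau>::real. exp (- \<tau>)) at_top at_bot"
    by (rule filterlim_compose[OF exp_at_top filterlim_uminus_at_top_at_bot])
  then have "filterlim (\<lambda>\<tau>::real. 1 + exp (- \<tau>)) at_top at_bot"
    by (intro filterlim_tendsto_add_at_top[OF tendsto_const])
  then have "((\<lambda>\<tau>::real. 1 / (1 + exp (- \<tau>))) \<longlongrightarrow> 0) at_bot"
    by (intro tendsto_divide_0[OF tendsto_const] filterlim_at_top_imp_at_infinity)
  then show ?thesis by (simp add: logistic_def[abs_def])
qed

text \<open>
  Error of linear interpolation: a product of the distances to the two nodes with a second divided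
  difference.
\<close>

lemma reciprocal_interpolation_error:
  fixes c x y t :: "'a::field"
  assumes "1 + c * x \<noteq> 0" "1 + c * y \<noteq> 0" "1 + c * (x + (y - x) * t) \<noteq> 0"
  shows "1 / (1 + c * (x + (y - x) * t)) - (1 - t) / (1 + c * x) - t / (1 + c * y)
    = - (y - x)\<^sup>2 * t * (1 - t) * c\<^sup>2 / ((1 + c * x) * (1 + c * y) * (1 + c * (x + (y - x) * t)))"
  using assms by (simp add: divide_simps) algebra

text \<open>
  The quotient of the Riccati field along the chord from \<open>(m1, w1)\<close> to \<open>(m0, w1 + (m0 - m1) \<kappa>)\<close> by
  \<open>(m0 - m1)\<^sup>2 t (1 - t)\<close>, in a form that stays bounded as the chord shrinks.
\<close>

definition riccati_defect :: "params \<Rightarrow> real \<Rightarrow> real \<Rightarrow> complex \<Rightarrow> complex \<Rightarrow> real \<Rightarrow> complex" where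
  "riccati_defect P m0 m1 w1 \<kappa> t = (case P of (\<alpha>, \<beta>, h, \<mu>, \<Omega>, c, s) \<Rightarrow>
     of_real m1 * \<kappa>\<^sup>2 + 2 * w1 * \<kappa> + of_real ((1 + t) * (m0 - m1)) * \<kappa>\<^sup>2
       + \<i> * of_real (\<beta> * c\<^sup>2 / ((1 + c * m1) * (1 + c * m0) * (1 + c * (m1 + (m0 - m1) * t)))))"

text \<open>
  Along a chord the field is a cubic polynomial in \<open>t\<close> plus a multiple of \<open>1 / (1 + c m)\<close>.  It vanishes at
  both ends, so it equals its own linear interpolation error, which is divisible by \<open>t (1 - t)\<close>.
\<close>

lemma riccati_chord:
  fixes m0 m1 t :: real and w1 \<kappa> :: complex
  assumes P: "P = (\<alpha>, \<beta>, h, \<mu>, \<Omega>, c, s)"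
    and nz: "1 + c * m1 \<noteq> 0" "1 + c * m0 \<noteq> 0" "1 + c * (m1 + (m0 - m1) * t) \<noteq> 0"
    and z1: "riccati P m1 w1 = 0"
    and z0: "riccati P m0 (w1 + of_real (m0 - m1) * \<kappa>) = 0"
  shows "riccati P (m1 + (m0 - m1) * t) (w1 + of_real ((m0 - m1) * t) * \<kappa>)
    = of_real ((m0 - m1)\<^sup>2 * t * (1 - t)) * riccati_defect P m0 m1 w1 \<kappa> t"
proof -
  define D where "D = m0 - m1"
  have m0: "m0 = m1 + D" by (simp add: D_def)
  define F where "F m = 1 / (1 + c * m)" for m
  define E where "E = F (m1 + D * t) - (1 - t) * F m1 - t * F m0"
  define d where "d = c\<^sup>2 / ((1 + c * m1) * (1 + c * m0) * (1 + c * (m1 + D * t)))"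
  have E: "E = - D\<^sup>2 * t * (1 - t) * d"
    using reciprocal_interpolation_error[of c m1 m0 t] nz unfolding E_def F_def D_def d_def by simp
  have R: "riccati P m w = of_real (h - \<mu> * m - \<Omega>) + \<i> * of_real (\<alpha> * \<Omega> - \<beta> * F m)
       - Complex \<alpha> 1 * of_real s * w - of_real m * w\<^sup>2" for m w
    unfolding P F_def by (simp add: Complex_eq)
  \<comment> \<open>Subtracting the linear interpolant, which is zero, isolates the interpolation error.\<close>
  have "riccati P (m1 + D * t) (w1 + of_real (D * t) * \<kappa>)
     = riccati P (m1 + D * t) (w1 + of_real (D * t) * \<kappa>)
        - of_real (1 - t) * riccati P m1 w1 - of_real t * riccati P m0 (w1 + of_real D * \<kappa>)"
    using z1 z0 by (simp add: D_def)
  also have "\<dots> = of_real (D\<^sup>2 * t * (1 - t)) * (of_real m1 * \<kappa>\<^sup>2 + 2 * w1 * \<kappa> + of_real ((1 + t) * D) * \<kappa>\<^sup>2)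
      - \<i> * of_real (\<beta> * E)"
    unfolding R E_def m0
    by (simp add: algebra_simps power2_eq_square)
  also have "\<dots> = of_real (D\<^sup>2 * t * (1 - t)) * riccati_defect P m0 m1 w1 \<kappa> t"
    unfolding E riccati_defect_def P prod.case D_def[symmetric] times_divide_eq_right[symmetric] d_def[symmetric]
    by (simp add: algebra_simps)
  finally show ?thesis unfolding D_def .
qed

lemma riccati_add:
  assumes "P = (\<alpha>, \<beta>, h, \<mu>, \<Omega>, c, s)"
  shows "riccati P m (w + z) =
     riccati P m w - (of_real m * (2 * w + z) + Complex \<alpha> 1 * of_real s) * z"
  unfolding assms by (simp add: algebra_simps power2_eq_square)

lemma eventually_mult_le_at_right_0:
  fixes C r :: real
  assumes "r > 0"
  shows "\<forall>\<^sub>F \<eta> in at_right 0. C * \<eta> \<le> r"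
proof -
  have "((\<lambda>\<eta>. C * \<eta>) \<longlongrightarrow> C * 0) (at_right 0)" by (intro tendsto_intros)
  then have "\<forall>\<^sub>F \<eta> in at_right 0. C * \<eta> < r" using assms by (intro order_tendstoD) auto
  then show ?thesis by eventually_elim simp
qed

lemma abs_chord_le_1:
  fixes m0 m1 t :: real
  assumes "\<bar>m0\<bar> \<le> 1" "\<bar>m1\<bar> \<le> 1" "0 \<le> t" "t \<le> 1"
  shows "\<bar>m1 + (m0 - m1) * t\<bar> \<le> 1"
proof -
  have "m1 + (m0 - m1) * t = (1 - t) * m1 + t * m0" by (simp add: algebra_simps)
  also have "\<bar>\<dots>\<bar> \<le> \<bar>(1 - t) * m1\<bar> + \<bar>t * m0\<bar>" by (rule abs_triangle_ineq)
  also have "\<dots> \<le> (1 - t) + t"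
    using assms by (intro add_mono) (auto simp: abs_mult intro: mult_left_le)
  finally show ?thesis by simp
qed

text \<open>
  In the blended ansatz \<open>B\<close> is the coefficient of \<open>- x\<close> in the equation for \<open>x\<close>, and \<open>\<Delta> t (1 - t) \<phi>\<close> is
  the velocity of \<open>t\<close>.  Both are near their values \<open>b0\<close> and \<open>\<phi>0\<close> at the bifurcation point, uniformly in
  \<open>t\<close>, and they depend on \<open>x\<close> in a Lipschitz way.
\<close>

lemma blended_coefficient_bounds:
  fixes m0 m1 f M \<eta> t :: real and b0 \<kappa>0 \<kappa> w1 S x :: complex
  defines "\<Delta> \<equiv> m0 - m1"
  defines "m \<equiv> m1 + \<Delta> * t"
  defines "B \<equiv> \<lambda>x. of_real m * (2 * (w1 + of_real (\<Delta> * t) * \<kappa>) + of_real (\<Delta> * t * (1 - t)) * x) + S"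
  defines "\<phi> \<equiv> \<lambda>x. - (m0 + m) * (Re \<kappa> + (1 - t) * Re x)"
  defines "\<phi>0 \<equiv> - 2 * m0 * Re \<kappa>0"
  assumes m0: "m0 = 1 \<or> m0 = -1" and m1: "\<bar>m1\<bar> < 1" and t: "0 \<le> t" "t \<le> 1"
    and f: "f = \<bar>Re \<kappa>0\<bar>" "f > 0" and \<eta>: "0 < \<eta>" "\<eta> \<le> 1"
    and M: "norm w1 \<le> M" "norm b0 \<le> M" "norm \<kappa>0 + 1 \<le> M"
    and close: "\<bar>\<Delta>\<bar> \<le> \<eta>" "norm (\<kappa> - \<kappa>0) \<le> \<eta>" "norm (2 * of_real m0 * w1 + S - b0) \<le> \<eta>"
    and \<eta>f: "(M + 5) * \<eta> \<le> f" and \<eta>M: "(4 * M + 2) * \<eta> \<le> 1"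
    and x: "norm x \<le> \<eta>"
  shows "norm (B x - b0) \<le> (4 * M + 2) * \<eta>" "\<bar>\<phi> x - \<phi>0\<bar> \<le> (M + 5) * \<eta>"
    and "norm (B x) \<le> M + 1" "f \<le> \<bar>\<phi> x\<bar>" "\<phi> x * \<phi>0 > 0" "\<bar>\<phi> x\<bar> \<le> 3 * f"
    and "norm (B x - B y) \<le> norm (x - y)" "\<bar>\<phi> x - \<phi> y\<bar> \<le> 2 * norm (x - y)"
    and "norm \<kappa> \<le> M"
proof -
  have M0: "M \<ge> 1" using M(3) norm_ge_zero[of \<kappa>0] by linarith
  show \<kappa>M: "norm \<kappa> \<le> M"
    using norm_triangle_sub[of \<kappa> \<kappa>0] close(2) M(3) \<eta>(2) by linarith
  have m: "\<bar>m\<bar> \<le> 1"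
    unfolding m_def \<Delta>_def using m0 m1 t by (intro abs_chord_le_1) auto
  have mm: "\<bar>m - m0\<bar> \<le> \<eta>" "m - m0 = - \<Delta> * (1 - t)"
  proof -
    show "m - m0 = - \<Delta> * (1 - t)" by (simp add: m_def \<Delta>_def algebra_simps)
    then have "\<bar>m - m0\<bar> = \<bar>\<Delta>\<bar> * (1 - t)" using t by (simp add: abs_mult)
    also have "\<dots> \<le> \<eta> * 1" using close(1) t \<eta> by (intro mult_mono) auto
    finally show "\<bar>m - m0\<bar> \<le> \<eta>" by simp
  qed
  have "B x - b0 = (2 * of_real m0 * w1 + S - b0) + 2 * of_real (m - m0) * w1
     + 2 * of_real (m * (\<Delta> * t)) * \<kappa> + of_real (m * (\<Delta> * (t * (1 - t)))) * x"
    unfolding B_def by (simp add: algebra_simps)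
  also have "norm \<dots> \<le> \<eta> + 2 * \<eta> * M + 2 * (1 * (\<eta> * 1)) * M + 1 * (\<eta> * (1 * 1)) * 1"
  proof (intro order_trans[OF norm_triangle_ineq] add_mono close)
    show "norm (2 * of_real (m - m0) * w1) \<le> 2 * \<eta> * M"
      unfolding norm_mult norm_of_real using mm M \<eta> by (intro mult_mono) auto
    show "norm (2 * of_real (m * (\<Delta> * t)) * \<kappa>) \<le> 2 * (1 * (\<eta> * 1)) * M"
      unfolding norm_mult norm_of_real abs_mult using m t close \<kappa>M \<eta> by (intro mult_mono) auto
    show "norm (of_real (m * (\<Delta> * (t * (1 - t)))) * x) \<le> 1 * (\<eta> * (1 * 1)) * 1"
      unfolding norm_mult norm_of_real abs_mult using m t close x \<eta> by (intro mult_mono) auto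
  qed
  finally show Bb: "norm (B x - b0) \<le> (4 * M + 2) * \<eta>" by (simp add: algebra_simps)
  have "norm (B x) \<le> norm b0 + norm (B x - b0)" by (metis add.commute diff_add_cancel norm_triangle_ineq)
  then show "norm (B x) \<le> M + 1" using Bb \<eta>M M(2) by linarith
  have rx: "\<bar>Re x\<bar> \<le> \<eta>" using abs_Re_le_cmod[of x] x by linarith
  have "\<phi> x - \<phi>0 = - (m - m0) * (Re \<kappa> + (1 - t) * Re x) - 2 * m0 * (Re (\<kappa> - \<kappa>0) + (1 - t) * Re x)"
    unfolding \<phi>_def \<phi>0_def by (simp add: algebra_simps)
  also have "\<bar>\<dots>\<bar> \<le> \<eta> * (M + 1 * 1) + 2 * 1 * (\<eta> + 1 * \<eta>)"
  proof (intro order_trans[OF abs_triangle_ineq4] add_mono)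
    have "\<bar>Re \<kappa> + (1 - t) * Re x\<bar> \<le> M + 1 * 1"
      using abs_Re_le_cmod[of \<kappa>] \<kappa>M t rx \<eta>
      by (intro order_trans[OF abs_triangle_ineq] add_mono) (auto simp: abs_mult intro!: mult_le_one)
    then show "\<bar>- (m - m0) * (Re \<kappa> + (1 - t) * Re x)\<bar> \<le> \<eta> * (M + 1 * 1)"
      unfolding abs_mult using mm \<eta> by (intro mult_mono) auto
    have "\<bar>Re (\<kappa> - \<kappa>0) + (1 - t) * Re x\<bar> \<le> \<eta> + 1 * \<eta>"
    proof (intro order_trans[OF abs_triangle_ineq] add_mono)
      show "\<bar>Re (\<kappa> - \<kappa>0)\<bar> \<le> \<eta>" using abs_Re_le_cmod[of "\<kappa> - \<kappa>0"] close(2) by linarith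
      show "\<bar>(1 - t) * Re x\<bar> \<le> 1 * \<eta>" unfolding abs_mult using t rx by (intro mult_mono) auto
    qed
    then show "\<bar>2 * m0 * (Re (\<kappa> - \<kappa>0) + (1 - t) * Re x)\<bar> \<le> 2 * 1 * (\<eta> + 1 * \<eta>)"
      unfolding abs_mult using m0 by (intro mult_mono) auto
  qed
  finally show \<phi>b: "\<bar>\<phi> x - \<phi>0\<bar> \<le> (M + 5) * \<eta>" by (simp add: algebra_simps)
  have \<phi>0: "\<bar>\<phi>0\<bar> = 2 * f" unfolding \<phi>0_def f(1) using m0 by (auto simp: abs_mult)
  have d: "\<bar>\<phi> x - \<phi>0\<bar> \<le> f" using \<phi>b \<eta>f by linarith
  show "f \<le> \<bar>\<phi> x\<bar>" "\<bar>\<phi> x\<bar> \<le> 3 * f" using d \<phi>0 by linarith+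
  show "\<phi> x * \<phi>0 > 0"
  proof (cases "\<phi>0 > 0")
    case True then show ?thesis using d \<phi>0 f(2) by (intro mult_pos_pos) linarith+
  next
    case False then show ?thesis using d \<phi>0 f(2) by (intro mult_neg_neg) linarith+
  qed
  have "B x - B y = of_real (m * (\<Delta> * (t * (1 - t)))) * (x - y)"
    unfolding B_def by (simp add: algebra_simps)
  also have "norm \<dots> \<le> 1 * (1 * (1 * 1)) * norm (x - y)"
    unfolding norm_mult norm_of_real abs_mult using m t close \<eta> by (intro mult_mono) auto
  finally show "norm (B x - B y) \<le> norm (x - y)" by simp
  have "\<phi> x - \<phi> y = - (m0 + m) * ((1 - t) * Re (x - y))"
    unfolding \<phi>_def by (simp add: algebra_simps)
  also have "\<bar>\<dots>\<bar> \<le> 2 * (1 * norm (x - y))"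
    unfolding abs_mult using m m0 t abs_Re_le_cmod[of "x - y"] by (intro mult_mono) auto
  finally show "\<bar>\<phi> x - \<phi> y\<bar> \<le> 2 * norm (x - y)" by simp
qed

lemma quotient_lipschitz:
  fixes u v :: complex and a b :: real
  assumes "0 < f" "f \<le> \<bar>a\<bar>" "f \<le> \<bar>b\<bar>" "norm v \<le> N" "norm (u - v) \<le> k" "\<bar>a - b\<bar> \<le> l"
  shows "norm (u / of_real a - v / of_real b) \<le> k / f + N * l / f\<^sup>2"
proof -
  have nz: "a \<noteq> 0" "b \<noteq> 0" using assms by auto
  have "u / of_real a - v / of_real b = (u - v) / of_real a + v * of_real (b - a) / of_real (a * b)"
    using nz by (simp add: field_simps)
  also have "norm \<dots> \<le> norm (u - v) / \<bar>a\<bar> + norm v * \<bar>a - b\<bar> / \<bar>a * b\<bar>"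
    by (rule order_trans[OF norm_triangle_ineq])
       (simp add: norm_divide norm_mult abs_minus_commute flip: of_real_mult of_real_diff)
  also have "\<dots> \<le> k / f + N * l / f\<^sup>2"
  proof (rule add_mono)
    show "norm (u - v) / \<bar>a\<bar> \<le> k / f"
      using assms order_trans[OF norm_ge_zero assms(5)] by (intro frac_le) auto
    have N: "0 \<le> N" using order_trans[OF norm_ge_zero assms(4)] .
    have l: "0 \<le> l" using order_trans[OF abs_ge_zero assms(6)] .
    have "f\<^sup>2 \<le> \<bar>a * b\<bar>" unfolding power2_eq_square abs_mult using assms by (intro mult_mono) auto
    then show "norm v * \<bar>a - b\<bar> / \<bar>a * b\<bar> \<le> N * l / f\<^sup>2"
      using assms N l by (intro frac_le mult_mono) auto
  qed
  finally show ?thesis .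
qed

lemma riccati_defect_bound:
  fixes m0 m1 t M :: real
  assumes P: "P = (\<alpha>, \<beta>, h, \<mu>, \<Omega>, c, s)" and c: "\<bar>c\<bar> < 1" "\<bar>\<beta>\<bar> * c\<^sup>2 \<le> M * (1 - \<bar>c\<bar>) ^ 3"
    and m: "\<bar>m0\<bar> \<le> 1" "\<bar>m1\<bar> \<le> 1" "\<bar>m0 - m1\<bar> \<le> 1" and t: "0 \<le> t" "t \<le> 1"
    and M: "norm w1 \<le> M" "norm \<kappa> \<le> M"
  shows "norm (riccati_defect P m0 m1 w1 \<kappa> t) \<le> 5 * M\<^sup>2 + M"
proof -
  have M0: "0 \<le> M" using order_trans[OF norm_ge_zero M(1)] .
  define d where "d = (1 + c * m1) * (1 + c * m0) * (1 + c * (m1 + (m0 - m1) * t))"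
  have fac: "1 - \<bar>c\<bar> \<le> 1 + c * u" if "\<bar>u\<bar> \<le> 1" for u
    using mult_left_mono[OF that, of "\<bar>c\<bar>"] abs_mult[of c u] by linarith
  have mt: "\<bar>m1 + (m0 - m1) * t\<bar> \<le> 1"
    by (rule abs_chord_le_1[OF m(1,2) t])
  have d: "(1 - \<bar>c\<bar>) ^ 3 \<le> d"
    unfolding d_def power3_eq_cube using c fac[OF m(1)] fac[OF m(2)] fac[OF mt]
    by (intro mult_mono) auto
  have dpos: "0 < (1 - \<bar>c\<bar>) ^ 3" using c by simp
  have "\<bar>\<beta> * c\<^sup>2 / d\<bar> = \<bar>\<beta>\<bar> * c\<^sup>2 / d"
    using order_less_le_trans[OF dpos d] by (simp add: abs_mult)
  also have "\<dots> \<le> M * (1 - \<bar>c\<bar>) ^ 3 / (1 - \<bar>c\<bar>) ^ 3"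
    using c(2) d dpos M0 by (intro frac_le) auto
  also have "\<dots> = M" using dpos by simp
  finally have q: "\<bar>\<beta> * c\<^sup>2 / d\<bar> \<le> M" .
  have sq: "norm (\<kappa>\<^sup>2) \<le> M\<^sup>2" unfolding norm_power using M by (intro power_mono) auto
  have "norm (riccati_defect P m0 m1 w1 \<kappa> t) \<le> 1 * M\<^sup>2 + 2 * M * M + 2 * 1 * M\<^sup>2 + 1 * M"
    unfolding riccati_defect_def P prod.case d_def[symmetric]
  proof (intro order_trans[OF norm_triangle_ineq] add_mono)
    show "norm (of_real m1 * \<kappa>\<^sup>2) \<le> 1 * M\<^sup>2"
      unfolding norm_mult norm_of_real using m sq by (intro mult_mono) auto
    show "norm (2 * w1 * \<kappa>) \<le> 2 * M * M"
      unfolding norm_mult using M M0 by (intro mult_mono) auto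
    show "norm (of_real ((1 + t) * (m0 - m1)) * \<kappa>\<^sup>2) \<le> 2 * 1 * M\<^sup>2"
      unfolding norm_mult norm_of_real abs_mult using m t sq by (intro mult_mono) auto
    show "norm (\<i> * of_real (\<beta> * c\<^sup>2 / d)) \<le> 1 * M"
      unfolding norm_mult norm_of_real using q by simp
  qed
  then show ?thesis by (simp add: power2_eq_square)
qed

text \<open>
  A connection from \<open>(m1, w1)\<close> to \<open>(m0, w0)\<close> up to the time change \<open>g\<close>.  The constant \<open>k\<close> records the
  direction of true time through the sign of \<open>g\<close>, and the lower bound on \<open>k g\<close> lets true time cover the
  whole line.
\<close>

definition rescaled_connection :: "params \<Rightarrow> real \<Rightarrow> real \<Rightarrow> complex \<Rightarrow> real \<Rightarrow> complex \<Rightarrow> bool" where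
  "rescaled_connection P k m1 w1 m0 w0 \<longleftrightarrow>
     (\<exists>m w g e. continuous_on UNIV g \<and> e > 0 \<and> (\<forall>\<tau>. k * g \<tau> \<ge> e) \<and>
        (\<forall>\<tau>. (m has_real_derivative - g \<tau> * (1 - (m \<tau>)\<^sup>2) * Re (w \<tau>)) (at \<tau>)) \<and>
        (\<forall>\<tau>. \<bar>m \<tau>\<bar> < 1) \<and>
        (\<forall>\<tau>. (w has_vector_derivative g \<tau> *\<^sub>R riccati P (m \<tau>) (w \<tau>)) (at \<tau>)) \<and>
        (m \<longlongrightarrow> m1) at_bot \<and> (w \<longlongrightarrow> w1) at_bot \<and>
        (m \<longlongrightarrow> m0) at_top \<and> (w \<longlongrightarrow> w0) at_top)"

text \<open>
  The connection is the chord plus \<open>\<Delta> t (1 - t) x\<close> with a small bounded \<open>x\<close>.  Here \<open>b0\<close> is the limit of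
  the rate of the fast variable and \<open>\<kappa>0\<close> the limit of the slope \<open>\<kappa>\<close>.  The real part of \<open>b0\<close> makes the fast
  direction hyperbolic, that of \<open>\<kappa>0\<close> makes \<open>m\<close> move along the chord.  One radius \<open>\<eta>\<close> serves all
  parameters.  The distance
  is bounded by \<open>\<eta>\<^sup>2\<close> since the forcing of \<open>x\<close>, of size \<open>\<Delta>\<close>, has to be small even relative to the bound
  \<open>\<eta>\<close> on \<open>x\<close>.
\<close>

lemma connecting_orbit:
  fixes m0 :: real and b0 \<kappa>0 :: complex
  assumes m0: "m0 = 1 \<or> m0 = -1" and b0: "Re b0 \<noteq> 0" and \<kappa>0: "Re \<kappa>0 \<noteq> 0"
    and M: "norm b0 \<le> M" "norm \<kappa>0 + 1 \<le> M"
  obtains \<eta> where "\<eta> > 0"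
    and "\<And>P \<alpha> \<beta> h \<mu> \<Omega> c s m1 w1 \<kappa>. P = (\<alpha>, \<beta>, h, \<mu>, \<Omega>, c, s) \<Longrightarrow> \<bar>c\<bar> < 1 \<Longrightarrow>
       \<bar>\<beta>\<bar> * c\<^sup>2 \<le> M * (1 - \<bar>c\<bar>) ^ 3 \<Longrightarrow> norm w1 \<le> M \<Longrightarrow> \<bar>m1\<bar> < 1 \<Longrightarrow> \<bar>m0 - m1\<bar> \<le> \<eta>\<^sup>2 \<Longrightarrow>
       norm (\<kappa> - \<kappa>0) \<le> \<eta> \<Longrightarrow> norm (2 * of_real m0 * w1 + Complex \<alpha> 1 * of_real s - b0) \<le> \<eta> \<Longrightarrow>
       riccati P m1 w1 = 0 \<Longrightarrow> Re w1 = 0 \<Longrightarrow> riccati P m0 (w1 + of_real (m0 - m1) * \<kappa>) = 0 \<Longrightarrow>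
       rescaled_connection P (- Re \<kappa>0) m1 w1 m0 (w1 + of_real (m0 - m1) * \<kappa>)"
proof -
  define f where "f = \<bar>Re \<kappa>0\<bar>"
  define \<phi>0 where "\<phi>0 = - 2 * m0 * Re \<kappa>0"
  define \<rho> where "\<rho> = \<bar>Re b0\<bar> / (2 * f)"
  \<comment> \<open>\<open>R\<close> bounds the defect; \<open>L\<close> and \<open>N\<close> are Lipschitz constants of \<open>B / \<phi>\<close> and of the forcing, and
    \<open>C \<eta>\<close> bounds the deviation of \<open>B / \<phi>\<close> from its limit \<open>b0 / \<phi>0\<close>.\<close>
  define R where "R = 5 * M\<^sup>2 + M"
  define L where "L = 1 / f + (M + 1) * 2 / f\<^sup>2"
  define N where "N = R * 2 / f\<^sup>2 + 1 + (R / f + M)"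
  define C where "C = (4 * M + 2) / f + M * (M + 5) / f\<^sup>2"
  have f: "f > 0" using \<kappa>0 by (simp add: f_def)
  have \<phi>0: "\<bar>\<phi>0\<bar> = 2 * f" unfolding \<phi>0_def f_def using m0 by (auto simp: abs_mult)
  have \<rho>: "\<rho> > 0" "\<bar>Re (b0 / of_real \<phi>0)\<bar> = \<rho>"
    using b0 f by (simp_all add: \<rho>_def Re_divide_of_real \<phi>0)
  have M1: "M \<ge> 1" using M(2) norm_ge_zero[of \<kappa>0] by linarith
  have R0: "R \<ge> 0" unfolding R_def using M1 by simp
  have "\<forall>\<^sub>F \<eta> in at_right 0. \<eta> > 0 \<and> 1 * \<eta> \<le> 1 \<and> (M + 5) * \<eta> \<le> f \<and> (4 * M + 2) * \<eta> \<le> 1 \<and>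
      C * \<eta> \<le> \<rho> / 8 \<and> L * \<eta> \<le> \<rho> / 8 \<and> N * \<eta> \<le> \<rho> / 8"
    using f \<rho>(1) by (intro eventually_conj eventually_mult_le_at_right_0 eventually_at_right_less) auto
  then obtain \<eta> where \<eta>: "\<eta> > 0" "\<eta> \<le> 1" "(M + 5) * \<eta> \<le> f" "(4 * M + 2) * \<eta> \<le> 1"
      "C * \<eta> \<le> \<rho> / 8" "L * \<eta> \<le> \<rho> / 8" "N * \<eta> \<le> \<rho> / 8"
    using eventually_happens'[OF trivial_limit_at_right_real] by (auto simp only: mult_1)
  show thesis
  proof (rule that[OF \<eta>(1)])
    fix P \<alpha> \<beta> h \<mu> \<Omega> c s m1 and w1 \<kappa> :: complex
    assume P: "P = (\<alpha>, \<beta>, h, \<mu>, \<Omega>, c, s)" and c: "\<bar>c\<bar> < 1" "\<bar>\<beta>\<bar> * c\<^sup>2 \<le> M * (1 - \<bar>c\<bar>) ^ 3"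
      and w1: "norm w1 \<le> M" and m1: "\<bar>m1\<bar> < 1" and \<Delta>\<eta>: "\<bar>m0 - m1\<bar> \<le> \<eta>\<^sup>2"
      and \<kappa>: "norm (\<kappa> - \<kappa>0) \<le> \<eta>"
      and S\<eta>: "norm (2 * of_real m0 * w1 + Complex \<alpha> 1 * of_real s - b0) \<le> \<eta>"
      and z1: "riccati P m1 w1 = 0" "Re w1 = 0"
      and z0: "riccati P m0 (w1 + of_real (m0 - m1) * \<kappa>) = 0"
    define \<Delta> where "\<Delta> = m0 - m1"
    define S where "S = Complex \<alpha> 1 * of_real s"
    define mm where "mm t = m1 + \<Delta> * t" for t
    define B where "B t x = of_real (mm t) * (2 * (w1 + of_real (\<Delta> * t) * \<kappa>) + of_real (\<Delta> * t * (1 - t)) * x) + S" for t x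
    define \<phi> where "\<phi> t x = - (m0 + mm t) * (Re \<kappa> + (1 - t) * Re x)" for t x
    \<comment> \<open>Division of the equation for \<open>x\<close> by \<open>\<Delta> \<phi>\<close>, the rate of \<open>t\<close> relative to the logistic one, splits
      it into the fast part \<open>- G x / \<Delta>\<close> and the bounded part \<open>K\<close>.\<close>
    define G where "G = (\<lambda>t x. B t x / of_real (\<phi> t x))"
    define K where "K = (\<lambda>t x. riccati_defect P m0 m1 w1 \<kappa> t / of_real (\<phi> t x) - \<kappa> - of_real (1 - 2 * t) * x)"
    have \<Delta>0: "\<Delta> \<noteq> 0" using m0 m1 by (auto simp: \<Delta>_def)
    have \<Delta>1: "\<bar>\<Delta>\<bar> \<le> \<eta>"
      using \<eta>(1,2) by (intro order_trans[OF \<Delta>\<eta>[folded \<Delta>_def]])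
        (simp add: power2_eq_square mult_left_le)
    note bnds = blended_coefficient_bounds[OF m0 m1 _ _ f_def f \<eta>(1,2) w1 M \<Delta>1[unfolded \<Delta>_def] \<kappa> S\<eta>[folded S_def] \<eta>(3,4)]
    have Bb: "norm (B t x - b0) \<le> (4 * M + 2) * \<eta>" "\<bar>\<phi> t x - \<phi>0\<bar> \<le> (M + 5) * \<eta>"
      "norm (B t x) \<le> M + 1" "f \<le> \<bar>\<phi> t x\<bar>" "\<phi> t x * \<phi>0 > 0" "\<bar>\<phi> t x\<bar> \<le> 3 * f"
      "norm (B t x - B t y) \<le> norm (x - y)" "\<bar>\<phi> t x - \<phi> t y\<bar> \<le> 2 * norm (x - y)" "norm \<kappa> \<le> M"
      if "0 < t" "t < 1" "norm x \<le> \<eta>" for t x y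
      unfolding B_def \<phi>_def mm_def \<Delta>_def \<phi>0_def
      by (rule bnds[OF less_imp_le[OF that(1)] less_imp_le[OF that(2)] that(3)])+
    have \<phi>nz: "\<phi> t x \<noteq> 0" if "0 < t" "t < 1" "norm x \<le> \<eta>" for t x
      using Bb(5)[OF that] by auto
    have rd: "norm (riccati_defect P m0 m1 w1 \<kappa> t) \<le> R" if "0 < t" "t < 1" for t
      unfolding R_def using that m0 m1 \<Delta>1 \<eta>(2) Bb(9)[of "1/2" 0] \<eta>(1)
      by (intro riccati_defect_bound[OF P c _ _ _ _ _ w1]) (auto simp: \<Delta>_def)
    have nz: "1 + c * u \<noteq> 0" if "\<bar>u\<bar> \<le> 1" for u
      using mult_left_mono[OF that, of "\<bar>c\<bar>"] abs_mult[of c u] c(1) by (intro notI) linarith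
    have mm1: "\<bar>mm t\<bar> \<le> 1" if "0 \<le> t" "t \<le> 1" for t
      unfolding mm_def \<Delta>_def using m0 m1 that by (intro abs_chord_le_1) auto
    have lc: "continuous_on A logistic" for A
      by (meson DERIV_isCont continuous_at_imp_continuous_on logistic_has_derivative)
    note lb = logistic_bounds
    have lc': "continuous_on A (\<lambda>p. logistic (fst p))" for A :: "(real \<times> complex) set"
      by (rule continuous_on_compose2[OF lc[of UNIV]]) (auto intro!: continuous_intros)
    have \<phi>c: "continuous_on (UNIV \<times> cball 0 \<eta>) (\<lambda>p. \<phi> (logistic (fst p)) (snd p))"
      unfolding \<phi>_def mm_def by (intro continuous_intros lc')
    have nzl: "1 + c * (m1 + (m0 - m1) * logistic \<tau>) \<noteq> 0" for \<tau>
      using nz[OF mm1[of "logistic \<tau>"]] lb[of \<tau>] unfolding mm_def \<Delta>_def by simp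
    have Rc: "continuous_on (UNIV \<times> cball 0 \<eta>) (\<lambda>p :: real \<times> complex. riccati_defect P m0 m1 w1 \<kappa> (logistic (fst p)))"
      unfolding riccati_defect_def P prod.case using m0 m1 nzl
      by (intro continuous_intros lc') (auto intro!: nz)
    have "\<exists>x. \<forall>\<tau>. norm (x \<tau>) \<le> \<eta> \<and> (x has_vector_derivative
        (K (logistic \<tau>) (x \<tau>) - G (logistic \<tau>) (x \<tau>) * x \<tau> / of_real \<Delta>)) (at \<tau>)"
    proof (rule slow_fast_bounded_solution[where a = "b0 / of_real \<phi>0" and L = L and N = N, OF \<eta>(1) \<Delta>0, unfolded \<rho>(2)])
      show "Re (b0 / of_real \<phi>0) \<noteq> 0" using \<rho> by auto
      show "continuous_on (UNIV \<times> cball 0 \<eta>) (\<lambda>(\<tau>, x). G (logistic \<tau>) x)"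
        unfolding G_def case_prod_beta B_def mm_def using \<phi>nz lb
        by (intro continuous_intros lc' \<phi>c) auto
      show "continuous_on (UNIV \<times> cball 0 \<eta>) (\<lambda>(\<tau>, x). K (logistic \<tau>) x)"
        unfolding K_def case_prod_beta using \<phi>nz lb
        by (intro continuous_intros lc' \<phi>c Rc) auto
      show "L * \<eta> \<le> \<rho> / 8" by fact
      have "\<bar>\<Delta>\<bar> * N \<le> \<eta>\<^sup>2 * N"
        using \<Delta>\<eta> R0 M1 f by (intro mult_right_mono) (auto simp: \<Delta>_def N_def)
      also have "\<eta>\<^sup>2 * N = (N * \<eta>) * \<eta>" by (simp add: power2_eq_square)
      also have "\<dots> \<le> \<rho> / 8 * \<eta>" using \<eta>(1,7) by (intro mult_right_mono) auto
      finally show N: "\<bar>\<Delta>\<bar> * N \<le> \<rho> / 8 * \<eta>" .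
      also have "\<dots> \<le> \<rho> / 8" using \<rho>(1) \<eta>(2) by (intro mult_left_le) auto
      finally show "\<bar>\<Delta>\<bar> * N \<le> \<rho> / 8" .
      fix \<tau> and x y :: complex
      show "norm (K (logistic \<tau>) 0) \<le> N"
      proof -
        have "norm (riccati_defect P m0 m1 w1 \<kappa> (logistic \<tau>) / of_real (\<phi> (logistic \<tau>) 0)) \<le> R / f"
          unfolding norm_divide norm_of_real
          using rd[OF lb] Bb(4)[OF lb, of 0] \<eta>(1) f R0 by (intro frac_le) auto
        then have "norm (K (logistic \<tau>) 0) \<le> R / f + M"
          unfolding K_def using Bb(9)[OF lb, of 0] \<eta>(1)
            norm_triangle_ineq4[of "riccati_defect P m0 m1 w1 \<kappa> (logistic \<tau>) / of_real (\<phi> (logistic \<tau>) 0)" \<kappa>]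
          by simp
        also have "\<dots> \<le> N" unfolding N_def using R0 f by simp
        finally show ?thesis .
      qed
      assume x: "norm x \<le> \<eta>"
      have "norm (B (logistic \<tau>) x / of_real (\<phi> (logistic \<tau>) x) - b0 / of_real \<phi>0)
          \<le> ((4 * M + 2) * \<eta>) / f + M * ((M + 5) * \<eta>) / f\<^sup>2"
        using f \<phi>0 M x Bb[OF lb] by (intro quotient_lipschitz) auto
      also have "\<dots> = C * \<eta>" unfolding C_def by (simp add: algebra_simps)
      finally show "norm (G (logistic \<tau>) x - b0 / of_real \<phi>0) \<le> \<rho> / 8"
        unfolding G_def using \<eta>(5) by linarith
      assume y: "norm y \<le> \<eta>"
      have "norm (G (logistic \<tau>) x - G (logistic \<tau>) y)
          \<le> norm (x - y) / f + (M + 1) * (2 * norm (x - y)) / f\<^sup>2"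
        unfolding G_def using f x y Bb[OF lb] by (intro quotient_lipschitz) auto
      also have "\<dots> = L * norm (x - y)" unfolding L_def by (simp add: algebra_simps)
      finally show "norm (G (logistic \<tau>) x - G (logistic \<tau>) y) \<le> L * norm (x - y)" .
      have "K (logistic \<tau>) x - K (logistic \<tau>) y
         = (riccati_defect P m0 m1 w1 \<kappa> (logistic \<tau>) / of_real (\<phi> (logistic \<tau>) x)
            - riccati_defect P m0 m1 w1 \<kappa> (logistic \<tau>) / of_real (\<phi> (logistic \<tau>) y))
           - of_real (1 - 2 * logistic \<tau>) * (x - y)"
        unfolding K_def by (simp add: algebra_simps)
      also have "norm \<dots> \<le> (0 / f + R * (2 * norm (x - y)) / f\<^sup>2) + 1 * norm (x - y)"
      proof (rule order_trans[OF norm_triangle_ineq4], rule add_mono)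
        show "norm (riccati_defect P m0 m1 w1 \<kappa> (logistic \<tau>) / of_real (\<phi> (logistic \<tau>) x)
            - riccati_defect P m0 m1 w1 \<kappa> (logistic \<tau>) / of_real (\<phi> (logistic \<tau>) y))
          \<le> 0 / f + R * (2 * norm (x - y)) / f\<^sup>2"
          using f x y Bb[OF lb] rd[OF lb] by (intro quotient_lipschitz) auto
        show "norm (of_real (1 - 2 * logistic \<tau>) * (x - y)) \<le> 1 * norm (x - y)"
          unfolding norm_mult norm_of_real using lb[of \<tau>] by (intro mult_right_mono) auto
      qed
      also have "\<dots> \<le> N * norm (x - y)"
      proof -
        have "0 \<le> (R / f + M) * norm (x - y)" using R0 f M1 by simp
        then show ?thesis unfolding N_def by (simp add: algebra_simps)
      qed
      finally show "norm (K (logistic \<tau>) x - K (logistic \<tau>) y) \<le> N * norm (x - y)" .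
    qed
    then obtain x where x\<eta>: "\<And>\<tau>. norm (x \<tau>) \<le> \<eta>"
      and xd: "\<And>\<tau>. (x has_vector_derivative
        (K (logistic \<tau>) (x \<tau>) - G (logistic \<tau>) (x \<tau>) * x \<tau> / of_real \<Delta>)) (at \<tau>)" by blast
    have xc: "continuous_on A x" for A
      by (meson continuous_at_imp_continuous_on has_vector_derivative_continuous xd)
    define m where "m \<tau> = mm (logistic \<tau>)" for \<tau>
    define z where "z \<tau> = of_real (\<Delta> * (logistic \<tau> * (1 - logistic \<tau>))) * x \<tau>" for \<tau>
    define w where "w \<tau> = w1 + of_real (\<Delta> * logistic \<tau>) * \<kappa> + z \<tau>" for \<tau>
    define g where "g \<tau> = 1 / (\<Delta> * \<phi> (logistic \<tau>) (x \<tau>))" for \<tau>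
    have p: "\<phi> (logistic \<tau>) (x \<tau>) \<noteq> 0" for \<tau> using \<phi>nz[OF lb x\<eta>] .
    have z_lim: "(z \<longlongrightarrow> 0) F" if "((\<lambda>\<tau>. \<Delta> * (logistic \<tau> * (1 - logistic \<tau>))) \<longlongrightarrow> 0) F" for F
    proof (rule Lim_null_comparison)
      show "\<forall>\<^sub>F \<tau> in F. norm (z \<tau>) \<le> \<bar>\<Delta> * (logistic \<tau> * (1 - logistic \<tau>))\<bar> * 1"
        unfolding z_def norm_mult norm_of_real
        using order_trans[OF x\<eta> \<eta>(2)] by (intro always_eventually allI mult_left_mono) auto
      show "((\<lambda>\<tau>. \<bar>\<Delta> * (logistic \<tau> * (1 - logistic \<tau>))\<bar> * 1) \<longlongrightarrow> 0) F"
        using tendsto_rabs[OF that] by simp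
    qed
    show "rescaled_connection P (- Re \<kappa>0) m1 w1 m0 (w1 + of_real (m0 - m1) * \<kappa>)"
      unfolding rescaled_connection_def
    proof (rule exI[of _ m], rule exI[of _ w], rule exI[of _ g],
        rule exI[of _ "1 / (9 * \<bar>\<Delta>\<bar>)"], intro conjI allI)
      show "continuous_on UNIV g"
        unfolding g_def \<phi>_def mm_def using p \<Delta>0
        by (intro continuous_intros lc xc) (auto simp: \<phi>_def mm_def)
      show "1 / (9 * \<bar>\<Delta>\<bar>) > 0" using \<Delta>0 by simp
      \<comment> \<open>The root \<open>m1\<close> lies on the inner side of \<open>m0\<close>, so \<open>m0 \<Delta>\<close> is positive and the direction of time
        does not depend on the sign of \<open>\<Delta>\<close>.\<close>
      have m0sq: "m0\<^sup>2 = 1" "m0 * m0 = 1" "m0 * \<Delta> = \<bar>\<Delta>\<bar>" using m0 m1 by (auto simp: \<Delta>_def)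
      fix \<tau>
      define t where "t = logistic \<tau>"
      define \<psi> where "\<psi> = \<phi> t (x \<tau>)"
      have t: "0 < t" "t < 1" using lb unfolding t_def by auto
      have \<psi>: "\<psi> \<noteq> 0" "\<psi> * \<phi>0 > 0" "\<bar>\<psi>\<bar> \<le> 3 * f" "g \<tau> = 1 / (\<Delta> * \<psi>)"
        using p[of \<tau>] Bb[OF lb x\<eta>[of \<tau>]] unfolding \<psi>_def t_def g_def by auto
      show "1 / (9 * \<bar>\<Delta>\<bar>) \<le> - Re \<kappa>0 * g \<tau>"
      proof -
        have "- Re \<kappa>0 = m0 * \<phi>0 / 2" unfolding \<phi>0_def using m0 by auto
        then have "- Re \<kappa>0 * g \<tau> = m0 * \<phi>0 / 2 * (1 / (\<Delta> * \<psi>))" unfolding \<psi>(4) by (simp only:)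
        also have "\<dots> = (m0 * m0) * (\<phi>0 * \<psi>) / (2 * (m0 * \<Delta>) * \<psi>\<^sup>2)"
          using \<psi>(1) \<Delta>0 m0 by (auto simp: power2_eq_square field_simps)
        also have "\<dots> = \<bar>\<phi>0 * \<psi>\<bar> / (2 * \<bar>\<Delta>\<bar> * \<psi>\<^sup>2)"
          using \<psi>(2) unfolding m0sq by (simp add: mult.commute)
        also have "\<dots> = f / (\<bar>\<Delta>\<bar> * \<bar>\<psi>\<bar>)"
        proof -
          have "\<psi>\<^sup>2 = \<bar>\<psi>\<bar> * \<bar>\<psi>\<bar>" by (simp add: power2_eq_square)
          then show ?thesis unfolding abs_mult \<phi>0 using \<psi>(1) \<Delta>0 by (simp add: field_simps)
        qed
        also have "\<dots> \<ge> f / (\<bar>\<Delta>\<bar> * (3 * f))"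
          using \<psi> \<Delta>0 f by (intro divide_left_mono mult_left_mono) auto
        finally have "1 / (3 * \<bar>\<Delta>\<bar>) \<le> - Re \<kappa>0 * g \<tau>" using f by simp
        moreover have "1 / (9 * \<bar>\<Delta>\<bar>) \<le> 1 / (3 * \<bar>\<Delta>\<bar>)" using \<Delta>0 by (simp add: field_simps)
        ultimately show ?thesis by linarith
      qed
      have md: "(m has_real_derivative \<Delta> * (t * (1 - t))) (at \<tau>)"
        unfolding m_def mm_def t_def
        by (auto intro!: derivative_eq_intros logistic_has_derivative)
      have "1 - (m \<tau>)\<^sup>2 = (m0 - m \<tau>) * (m0 + m \<tau>)"
        using m0sq by (simp add: power2_eq_square algebra_simps)
      also have "m0 - m \<tau> = \<Delta> * (1 - t)" unfolding m_def mm_def t_def \<Delta>_def by (simp add: algebra_simps)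
      finally have 1: "1 - (m \<tau>)\<^sup>2 = \<Delta> * (1 - t) * (m0 + m \<tau>)" .
      have Rew: "Re (w \<tau>) = \<Delta> * t * (Re \<kappa> + (1 - t) * Re (x \<tau>))"
        unfolding w_def z_def t_def[symmetric] using z1(2) by (simp add: algebra_simps)
      have "- (1 - (m \<tau>)\<^sup>2) * Re (w \<tau>) = \<Delta> * t * (\<Delta> * (1 - t)) * \<psi>"
        unfolding 1 Rew unfolding \<psi>_def \<phi>_def m_def t_def by (simp add: algebra_simps)
      then have "g \<tau> * (- (1 - (m \<tau>)\<^sup>2) * Re (w \<tau>)) = g \<tau> * (\<Delta> * t * (\<Delta> * (1 - t)) * \<psi>)"
        by (simp only:)
      also have "\<dots> = \<Delta> * (t * (1 - t))"
        unfolding \<psi>(4) using \<psi>(1) \<Delta>0 by (simp add: field_simps)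
      finally have 2: "g \<tau> * (- (1 - (m \<tau>)\<^sup>2) * Re (w \<tau>)) = \<Delta> * (t * (1 - t))" .
      have "- g \<tau> * (1 - (m \<tau>)\<^sup>2) * Re (w \<tau>) = \<Delta> * (t * (1 - t))"
        unfolding 2[symmetric] by (simp add: algebra_simps)
      then show "(m has_real_derivative - g \<tau> * (1 - (m \<tau>)\<^sup>2) * Re (w \<tau>)) (at \<tau>)"
        using md by (simp only:)
      show "\<bar>m \<tau>\<bar> < 1"
      proof -
        have "0 < (\<Delta> * (1 - t)) * (m0 + m \<tau>)"
        proof -
          have "m0 * (\<Delta> * (1 - t)) > 0" using m0sq(3) t \<Delta>0 by (simp add: mult.assoc[symmetric])
          moreover have "m0 * (m0 + m \<tau>) > 0"
          proof -
            have "m0 * (m0 + m \<tau>) = (1 - t) * (1 + m0 * m1) + 2 * t"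
              unfolding m_def mm_def \<Delta>_def t_def using m0sq by (simp add: algebra_simps)
            also have "\<dots> > 0" using t m0 m1 by (intro add_pos_pos[OF mult_pos_pos]) auto
            finally show ?thesis .
          qed
          ultimately have "0 < (m0 * (\<Delta> * (1 - t))) * (m0 * (m0 + m \<tau>))" by (rule mult_pos_pos)
          also have "\<dots> = (m0 * m0) * ((\<Delta> * (1 - t)) * (m0 + m \<tau>))" by (simp only: mult_ac)
          finally show ?thesis by (simp only: m0sq(2) mult_1)
        qed
        then show ?thesis using 1 by (simp add: abs_square_less_1[symmetric])
      qed
      have l1: "((\<lambda>\<tau>. \<Delta> * logistic \<tau>) has_real_derivative \<Delta> * (t * (1 - t))) (at \<tau>)"
        unfolding t_def by (auto intro!: derivative_eq_intros logistic_has_derivative)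
      have l2: "((\<lambda>\<tau>. \<Delta> * (logistic \<tau> * (1 - logistic \<tau>))) has_real_derivative
          \<Delta> * (t * (1 - t) * (1 - 2 * t))) (at \<tau>)"
        unfolding t_def
        by (auto intro!: derivative_eq_intros logistic_has_derivative simp: algebra_simps)
      have "((\<lambda>\<tau>. w1 + of_real (\<Delta> * logistic \<tau>) * \<kappa> + z \<tau>) has_vector_derivative
           0 + of_real (\<Delta> * (t * (1 - t))) * \<kappa>
           + (of_real (\<Delta> * (logistic \<tau> * (1 - logistic \<tau>)))
                * (K (logistic \<tau>) (x \<tau>) - G (logistic \<tau>) (x \<tau>) * x \<tau> / of_real \<Delta>)
              + of_real (\<Delta> * (t * (1 - t) * (1 - 2 * t))) * x \<tau>)) (at \<tau>)"
        unfolding z_def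
        by (intro has_vector_derivative_add has_vector_derivative_const has_vector_derivative_mult
              has_vector_derivative_mult_left has_vector_derivative_of_real xd l1 l2)
      then have wd: "(w has_vector_derivative of_real (\<Delta> * (t * (1 - t))) * \<kappa>
           + (of_real (\<Delta> * (t * (1 - t))) * (K t (x \<tau>) - G t (x \<tau>) * x \<tau> / of_real \<Delta>)
              + of_real (\<Delta> * (t * (1 - t) * (1 - 2 * t))) * x \<tau>)) (at \<tau>)"
        unfolding w_def t_def by simp
      have "riccati P (m \<tau>) (w \<tau>) = riccati P (m \<tau>) (w1 + of_real (\<Delta> * t) * \<kappa>) - B t (x \<tau>) * z \<tau>"
        unfolding w_def riccati_add[OF P] B_def S_def m_def t_def z_def by (simp add: algebra_simps)
      also have "riccati P (m \<tau>) (w1 + of_real (\<Delta> * t) * \<kappa>)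
          = of_real (\<Delta>\<^sup>2 * t * (1 - t)) * riccati_defect P m0 m1 w1 \<kappa> t"
        unfolding m_def mm_def t_def \<Delta>_def
        using m0 m1 nzl by (intro riccati_chord[OF P _ _ _ z1(1) z0]) (auto intro!: nz)
      finally have ric: "riccati P (m \<tau>) (w \<tau>) = of_real (\<Delta> * (t * (1 - t))) *
          (of_real \<Delta> * riccati_defect P m0 m1 w1 \<kappa> t - B t (x \<tau>) * x \<tau>)"
        unfolding z_def t_def by (simp add: algebra_simps power2_eq_square)
      show "(w has_vector_derivative g \<tau> *\<^sub>R riccati P (m \<tau>) (w \<tau>)) (at \<tau>)"
      proof -
        have "of_real (\<Delta> * (t * (1 - t))) * \<kappa>
           + (of_real (\<Delta> * (t * (1 - t))) * (K t (x \<tau>) - G t (x \<tau>) * x \<tau> / of_real \<Delta>)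
              + of_real (\<Delta> * (t * (1 - t) * (1 - 2 * t))) * x \<tau>)
          = g \<tau> *\<^sub>R riccati P (m \<tau>) (w \<tau>)"
          unfolding ric \<psi>(4) K_def G_def \<psi>_def[symmetric] scaleR_conv_of_real using \<psi>(1) \<Delta>0
          by (simp add: field_simps)
        then show ?thesis using wd by simp
      qed
    next
      show "(m \<longlongrightarrow> m1) at_bot" "(m \<longlongrightarrow> m0) at_top"
        unfolding m_def mm_def \<Delta>_def
        by (auto intro!: tendsto_eq_intros logistic_at_bot logistic_at_top)
      show "(w \<longlongrightarrow> w1) at_bot" "(w \<longlongrightarrow> w1 + of_real (m0 - m1) * \<kappa>) at_top"
        unfolding w_def \<Delta>_def[symmetric]
        by (auto intro!: tendsto_eq_intros z_lim logistic_at_bot logistic_at_top)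
    qed
  qed
qed

section \<open>Equilibria and their linearization\<close>

lemma one_plus_mult_pos: "\<bar>c\<bar> < 1 \<Longrightarrow> \<bar>m\<bar> \<le> 1 \<Longrightarrow> 0 < 1 + c * (m::real)"
  using mult_left_mono[of "\<bar>m\<bar>" 1 "\<bar>c\<bar>"] abs_mult[of c m] by linarith

lemma coh_field_eq_0_iff:
  "coh_field P (\<theta>, p, q) = 0 \<longleftrightarrow> sin \<theta> * p = 0 \<and> riccati P (cos \<theta>) (Complex p q) = 0"
  using coh_field_eq_riccati[of P \<theta> "Complex p q"]
  by (simp add: zero_prod_def complex_eq_iff)

text \<open>
  On the imaginary axis the imaginary part of the field determines \<open>q\<close>, and what remains of the real part
  is \<open>- \<Gamma>\<close>.
\<close>

lemma riccati_imaginary: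
  assumes "admissible P"
  shows "riccati P m (Complex 0 (q_eq P m)) = - of_real (Gamma_tilde P m)"
    and "riccati P m (Complex 0 q) = 0 \<longleftrightarrow> q = q_eq P m \<and> Gamma_tilde P m = 0"
proof -
  obtain \<alpha> \<beta> h \<mu> \<Omega> c s where P: "P = (\<alpha>, \<beta>, h, \<mu>, \<Omega>, c, s)" by (metis prod_cases7)
  have nz: "\<alpha> \<noteq> 0" "s \<noteq> 0" using assms P by auto
  show *: "riccati P m (Complex 0 (q_eq P m)) = - of_real (Gamma_tilde P m)"
  proof -
    define b where "b = \<beta> / (1 + c * m)"
    show ?thesis
      unfolding P riccati.simps Gamma_tilde.simps q_eq.simps beta_tilde.simps b_def[symmetric]
      using nz by (simp add: complex_eq_iff power2_eq_square field_simps)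
  qed
  have "q = q_eq P m" if "riccati P m (Complex 0 q) = 0"
  proof -
    define b where "b = \<beta> / (1 + c * m)"
    show ?thesis
      using arg_cong[OF that, of Im] nz
      unfolding P riccati.simps q_eq.simps beta_tilde.simps b_def[symmetric]
      by (simp add: power2_eq_square field_simps)
  qed
  then show "riccati P m (Complex 0 q) = 0 \<longleftrightarrow> q = q_eq P m \<and> Gamma_tilde P m = 0"
    using * by auto
qed

text \<open>
  Used with \<open>m0 = m1\<close> to separate the two roots of the quadratic and to express
  \<open>w0\<close> through \<open>\<Gamma>\<close>, and with \<open>m0 \<noteq> m1\<close> to obtain the slope of the chord between two equilibria without
  differentiating either of them.
\<close>

lemma riccati_secant:
  assumes P: "P = (\<alpha>, \<beta>, h, \<mu>, \<Omega>, c, s)"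
    and nz: "1 + c * m0 \<noteq> 0" "1 + c * m1 \<noteq> 0"
  shows "riccati P m1 w1 - riccati P m0 w0
    = (w0 - w1) * (of_real m0 * (w0 + w1) + Complex \<alpha> 1 * of_real s)
      + of_real (m0 - m1) * (w1\<^sup>2 + Complex \<mu> (- \<beta> * c / ((1 + c * m0) * (1 + c * m1))))"
proof -
  have "\<beta> / (1 + c * m1) - \<beta> / (1 + c * m0) = (m0 - m1) * (\<beta> * c / ((1 + c * m0) * (1 + c * m1)))"
    using nz by (simp add: field_simps)
  then have *: "\<i> * (of_real (\<beta> / (1 + c * m1)) - of_real (\<beta> / (1 + c * m0)))
      = \<i> * (of_real (m0 - m1) * of_real (\<beta> * c / ((1 + c * m0) * (1 + c * m1))))"
    by (metis of_real_diff of_real_mult)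
  show ?thesis
    unfolding P using * by (simp add: Complex_eq algebra_simps power2_eq_square)
qed

text \<open>
  The difference quotient of \<open>Gamma_tilde\<close> in closed form, continuous in all arguments across the
  diagonal.
\<close>

fun Gamma_slope :: "params \<Rightarrow> real \<Rightarrow> real \<Rightarrow> real" where
  "Gamma_slope (\<alpha>, \<beta>, h, \<mu>, \<Omega>, c, s) m n =
     - (\<beta> * c / (\<alpha> * ((1 + c * m) * (1 + c * n))))
     - ((q_eq (\<alpha>, \<beta>, h, \<mu>, \<Omega>, c, s) n)\<^sup>2 - \<mu>)
     - m * (q_eq (\<alpha>, \<beta>, h, \<mu>, \<Omega>, c, s) m + q_eq (\<alpha>, \<beta>, h, \<mu>, \<Omega>, c, s) n)
         * (\<beta> * c / (\<alpha> * s * ((1 + c * m) * (1 + c * n))))"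

lemma Gamma_tilde_diff:
  assumes "admissible P" "\<bar>m\<bar> \<le> 1" "\<bar>n\<bar> \<le> 1"
  shows "Gamma_tilde P m - Gamma_tilde P n = (m - n) * Gamma_slope P m n"
proof -
  obtain \<alpha> \<beta> h \<mu> \<Omega> c s where P: "P = (\<alpha>, \<beta>, h, \<mu>, \<Omega>, c, s)" by (metis prod_cases7)
  have nz: "\<alpha> \<noteq> 0" "s \<noteq> 0" "1 + c * m \<noteq> 0" "1 + c * n \<noteq> 0"
    using assms P one_plus_mult_pos[of c m] one_plus_mult_pos[of c n] by auto
  define D where "D = (1 + c * m) * (1 + c * n)"
  define u where "u = q_eq P m"
  define v where "v = q_eq P n"
  have b: "beta_tilde P m - beta_tilde P n = (n - m) * (\<beta> * c / D)"
    unfolding P D_def using nz by (simp add: field_simps)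
  have qb: "q_eq P k = (\<Omega> - beta_tilde P k / \<alpha>) / s" for k unfolding P by simp
  have "u - v = - (beta_tilde P m - beta_tilde P n) / (\<alpha> * s)"
    unfolding u_def v_def qb using nz by (simp add: field_simps)
  also have "\<dots> = (m - n) * (\<beta> * c / (\<alpha> * s * D))"
  proof -
    have "D \<noteq> 0" using nz by (simp add: D_def)
    then show ?thesis unfolding b using nz by (simp add: field_simps)
  qed
  finally have uv: "u - v = (m - n) * (\<beta> * c / (\<alpha> * s * D))" .
  have "Gamma_tilde P m - Gamma_tilde P n
      = (beta_tilde P m - beta_tilde P n) / \<alpha> - m * ((u - v) * (u + v)) - (m - n) * (v\<^sup>2 - \<mu>)"
    unfolding u_def v_def P by (simp add: algebra_simps power2_eq_square diff_divide_distrib)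
  also have "\<dots> = (m - n) * (- (\<beta> * c / (\<alpha> * D)) - (v\<^sup>2 - \<mu>) - m * (u + v) * (\<beta> * c / (\<alpha> * s * D)))"
    unfolding b uv by (simp add: algebra_simps add_divide_distrib[symmetric])
  also have "\<dots> = (m - n) * Gamma_slope P m n"
    unfolding P D_def u_def v_def by simp
  finally show ?thesis .
qed

lemma Gamma_slope_diagonal:
  assumes "P = (\<alpha>, \<beta>, h, \<mu>, \<Omega>, c, s)" "admissible P"
  shows "Gamma_slope P m m = - ((q_eq P m)\<^sup>2 - \<mu>)
     - (s + 2 * m * q_eq P m) * (\<beta> * c / (\<alpha> * s * (1 + c * m)\<^sup>2))"
proof -
  have nz: "\<alpha> \<noteq> 0" "s \<noteq> 0" using assms by auto
  define u where "u = q_eq P m"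
  define d where "d = \<beta> * c / (\<alpha> * s * (1 + c * m)\<^sup>2)"
  have "\<beta> * c / (\<alpha> * ((1 + c * m) * (1 + c * m))) = s * d"
    unfolding d_def using nz by (simp add: power2_eq_square)
  moreover have "\<beta> * c / (\<alpha> * s * ((1 + c * m) * (1 + c * m))) = d"
    unfolding d_def by (simp add: power2_eq_square)
  ultimately have "Gamma_slope P m m = - (s * d) - (u\<^sup>2 - \<mu>) - m * (u + u) * d"
    unfolding assms(1) u_def Gamma_slope.simps by (simp only:)
  then show ?thesis unfolding u_def d_def[symmetric] by (simp add: algebra_simps)
qed

lemma Gamma_tilde_has_derivative:
  assumes "admissible P" "\<bar>m\<bar> \<le> 1"
  shows "(Gamma_tilde P has_real_derivative Gamma_slope P m m) (at m)"
proof -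
  obtain \<alpha> \<beta> h \<mu> \<Omega> c s where P: "P = (\<alpha>, \<beta>, h, \<mu>, \<Omega>, c, s)" by (metis prod_cases7)
  have nz: "\<alpha> \<noteq> 0" "s \<noteq> 0" "1 + c * m \<noteq> 0"
    using assms P one_plus_mult_pos[of c m] by auto
  define d where "d = \<beta> * c / (1 + c * m)\<^sup>2"
  have b: "(beta_tilde P has_real_derivative - d) (at m)"
    unfolding P d_def beta_tilde.simps[abs_def] using nz
    by (auto intro!: derivative_eq_intros simp: power2_eq_square)
  have q: "q_eq P = (\<lambda>m. (\<Omega> - beta_tilde P m / \<alpha>) / s)"
    "Gamma_tilde P = (\<lambda>m. beta_tilde P m / \<alpha> - ((q_eq P m)\<^sup>2 - \<mu>) * m - h)"
    unfolding P by auto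
  have qd: "(q_eq P has_real_derivative d / (\<alpha> * s)) (at m)"
    unfolding q(1) using nz by (auto intro!: derivative_eq_intros b)
  have "(Gamma_tilde P has_real_derivative
      - d / \<alpha> - (2 * q_eq P m * (d / (\<alpha> * s)) * m + ((q_eq P m)\<^sup>2 - \<mu>))) (at m)"
    unfolding q(2) using nz by (auto intro!: derivative_eq_intros b qd simp: power2_eq_square)
  moreover have "- d / \<alpha> - (2 * q_eq P m * (d / (\<alpha> * s)) * m + ((q_eq P m)\<^sup>2 - \<mu>)) = Gamma_slope P m m"
  proof -
    have "Gamma_slope P m m = - ((q_eq P m)\<^sup>2 - \<mu>) - (s + 2 * m * q_eq P m) * (d / (\<alpha> * s))"
      unfolding Gamma_slope_diagonal[OF P assms(1)] d_def by (simp add: mult.commute)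
    also have "\<dots> = - d / \<alpha> - (2 * q_eq P m * (d / (\<alpha> * s)) * m + ((q_eq P m)\<^sup>2 - \<mu>))"
      using nz by (simp add: field_simps)
    finally show ?thesis by simp
  qed
  ultimately show ?thesis by simp
qed

lemma coh_field_has_derivative:
  assumes "\<bar>c\<bar> < 1" "sin \<theta>0 = 0" "m0 = cos \<theta>0"
  shows "(coh_field (\<alpha>, \<beta>, h, \<mu>, \<Omega>, c, s) has_derivative (\<lambda>(a, b, d).
     (m0 * p * a, - (\<alpha> * s + 2 * m0 * p) * b + (s + 2 * m0 * q) * d,
      - (s + 2 * m0 * q) * b - (\<alpha> * s + 2 * m0 * p) * d))) (at (\<theta>0, p, q))"
proof -
  have nz: "1 + c * cos \<theta>0 \<noteq> 0" using one_plus_mult_pos[OF assms(1), of "cos \<theta>0"] by simp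
  have f: "coh_field (\<alpha>, \<beta>, h, \<mu>, \<Omega>, c, s) = (\<lambda>x. (sin (fst x) * fst (snd x),
      h + ((snd (snd x))\<^sup>2 - \<mu>) * cos (fst x) - (\<Omega> - s * snd (snd x)) - \<alpha> * s * fst (snd x)
        - cos (fst x) * (fst (snd x))\<^sup>2,
      \<alpha> * (\<Omega> - s * snd (snd x)) - \<beta> / (1 + c * cos (fst x))
        - (s + 2 * cos (fst x) * snd (snd x)) * fst (snd x)))"
    by (auto simp: fun_eq_iff)
  show ?thesis
    unfolding f
    by (rule has_derivative_eq_rhs, (rule derivative_intros nz | simp add: nz)+)
       (use assms in \<open>auto simp: fun_eq_iff algebra_simps power2_eq_square\<close>)
qed

text \<open>
  With \<open>u = arccos x / 2\<close> the denominator is \<open>2 sin u\<close>.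
\<close>

lemma arccos_near_1:
  "((\<lambda>x. arccos x / sqrt (2 * (1 - x))) \<longlongrightarrow> 1) (at_left 1)"
proof -
  have half: "((\<lambda>x. arccos x / 2) \<longlongrightarrow> 0) (at_left 1)"
  proof -
    have "continuous_on {-1..1} arccos" by (rule continuous_on_arccos')
    then have "(arccos \<longlongrightarrow> arccos 1) (at 1 within {-1..1})" unfolding continuous_on by (rule bspec) simp
    then have "(arccos \<longlongrightarrow> 0) (at_left 1)"
      by (simp add: at_within_Icc_at_left)
    then show ?thesis by (auto intro!: tendsto_eq_intros)
  qed
  have ev: "\<forall>\<^sub>F x::real in at_left 1. x \<in> {-1<..<1}"
    by (rule eventually_at_left_real) simp
  have "\<forall>\<^sub>F x in at_left 1. arccos x / 2 \<noteq> 0"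
    using ev by eventually_elim (use arccos_lt_bounded in force)
  then have "filterlim (\<lambda>x. arccos x / 2) (at 0) (at_left (1::real))"
    unfolding filterlim_at using half by simp
  moreover have "((\<lambda>u::real. u / sin u) \<longlongrightarrow> 1) (at 0)"
  proof -
    have "((\<lambda>u::real. sin u / u) \<longlongrightarrow> 1) (at 0)"
      using DERIV_sin[of 0] by (simp add: has_field_derivative_iff)
    from tendsto_inverse[OF this] show ?thesis by simp
  qed
  ultimately have "((\<lambda>x. (arccos x / 2) / sin (arccos x / 2)) \<longlongrightarrow> 1) (at_left 1)"
    by (rule filterlim_compose[rotated])
  moreover have "\<forall>\<^sub>F x in at_left 1. (arccos x / 2) / sin (arccos x / 2) = arccos x / sqrt (2 * (1 - x))"
    using ev
  proof eventually_elim
    case (elim x)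
    then have "0 < arccos x" "arccos x < pi" using arccos_lt_bounded[of x] by auto
    then have "sin (arccos x / 2) > 0" by (intro sin_gt_zero) auto
    moreover have "2 * (1 - x) = (2 * sin (arccos x / 2))\<^sup>2"
      using cos_double_sin[of "arccos x / 2"] elim by (simp add: power_mult_distrib)
    ultimately have "sqrt (2 * (1 - x)) = 2 * sin (arccos x / 2)"
      by (simp only: real_sqrt_abs)
    then show ?case by simp
  qed
  ultimately show ?thesis by (rule Lim_transform_eventually)
qed

text \<open>
  The block \<open>- l + k J\<close>, with the rotation generator \<open>J\<close>, changes the squared norm at rate \<open>- 2 l\<close>, whereas
  a pair \<open>\<plusminus>\<i> \<omega>\<close> of eigenvalues would conserve \<open>\<bar>a\<bar>\<^sup>2 + \<bar>b\<bar>\<^sup>2\<close>.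
\<close>

lemma no_oscillation:
  fixes a1 a2 b1 b2 k l \<omega> :: real
  assumes l: "l \<noteq> 0"
    and "- l * a1 + k * a2 = - \<omega> * b1" "- k * a1 - l * a2 = - \<omega> * b2"
    and "- l * b1 + k * b2 = \<omega> * a1" "- k * b1 - l * b2 = \<omega> * a2"
  shows "a1 = 0 \<and> a2 = 0 \<and> b1 = 0 \<and> b2 = 0"
proof -
  have "l * (a1\<^sup>2 + a2\<^sup>2 + b1\<^sup>2 + b2\<^sup>2)
      = - (a1 * (- l * a1 + k * a2) + a2 * (- k * a1 - l * a2) + b1 * (- l * b1 + k * b2) + b2 * (- k * b1 - l * b2))"
    by (simp add: power2_eq_square algebra_simps)
  also have "\<dots> = 0" unfolding assms(2-5) by (simp add: algebra_simps)
  finally have "a1\<^sup>2 + a2\<^sup>2 + b1\<^sup>2 + b2\<^sup>2 = 0" using l by simp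
  then show ?thesis by (simp add: add_nonneg_eq_0_iff)
qed

lemma linear_flip_theta: "linear flip_theta"
  by (rule linearI) auto

lemma coh_field_flip:
  assumes "\<theta>0 \<in> {0, pi}"
  shows "coh_field P (reflect_about flip_theta (\<theta>0, p0, q0) x) = flip_theta (coh_field P x)"
proof -
  obtain \<theta> p q where x: "x = (\<theta>, p, q)" by (metis prod_cases3)
  obtain \<alpha> \<beta> h \<mu> \<Omega> c s where P: "P = (\<alpha>, \<beta>, h, \<mu>, \<Omega>, c, s)" by (metis prod_cases7)
  have "sin (\<theta>0 + (\<theta>0 - \<theta>)) = - sin \<theta>" "cos (\<theta>0 + (\<theta>0 - \<theta>)) = cos \<theta>"
    using assms by (auto simp: sin_add cos_add sin_diff cos_diff)
  then show ?thesis unfolding x P by (simp add: reflect_about_def)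
qed

section \<open>Continuously differentiable curves\<close>

lemma C1_differentiable_on_bounded_linear:
  assumes "bounded_linear L" "f C1_differentiable_on S"
  shows "(\<lambda>x. L (f x)) C1_differentiable_on S"
proof -
  obtain D where D: "\<forall>x\<in>S. (f has_vector_derivative D x) (at x)" "continuous_on S D"
    using assms(2) unfolding C1_differentiable_on_def by blast
  then show ?thesis
    unfolding C1_differentiable_on_def using assms(1)
    by (intro exI[of _ "\<lambda>x. L (D x)"])
       (auto intro: bounded_linear.has_vector_derivative bounded_linear.continuous_on)
qed

lemma C1_differentiable_on_Pair:
  assumes "f C1_differentiable_on S" "g C1_differentiable_on S"
  shows "(\<lambda>x. (f x, g x)) C1_differentiable_on S"
proof -
  obtain D E where "\<forall>x\<in>S. (f has_vector_derivative D x) (at x)" "continuous_on S D"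
    "\<forall>x\<in>S. (g has_vector_derivative E x) (at x)" "continuous_on S E"
    using assms unfolding C1_differentiable_on_def by blast
  then show ?thesis
    unfolding C1_differentiable_on_def
    by (intro exI[of _ "\<lambda>x. (D x, E x)"]) (auto intro: has_vector_derivative_Pair continuous_intros)
qed

lemma C1_differentiable_on_field_chain:
  fixes f :: "real \<Rightarrow> 'a::real_normed_field"
  assumes f: "f C1_differentiable_on S"
    and F: "\<And>x. x \<in> S \<Longrightarrow> (F has_field_derivative F' (f x)) (at (f x))"
    and c: "continuous_on S (\<lambda>x. F' (f x))"
  shows "(\<lambda>x. F (f x)) C1_differentiable_on S"
proof -
  obtain D where D: "\<forall>x\<in>S. (f has_vector_derivative D x) (at x)" "continuous_on S D"
    using f unfolding C1_differentiable_on_def by blast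
  have "((\<lambda>x. F (f x)) has_vector_derivative D x * F' (f x)) (at x)" if "x \<in> S" for x
    using field_vector_diff_chain_at[OF bspec[OF D(1) that] F[OF that]] by (simp add: o_def)
  then show ?thesis
    unfolding C1_differentiable_on_def using D(2) c
    by (intro exI[of _ "\<lambda>x. D x * F' (f x)"]) (auto intro: continuous_intros)
qed

lemma C1_differentiable_on_imp_continuous_on:
  "f C1_differentiable_on S \<Longrightarrow> continuous_on S f"
  by (meson C1_differentiable_on_def continuous_at_imp_continuous_on has_vector_derivative_continuous)

lemma C1_differentiable_on_imp_isCont:
  "f C1_differentiable_on S \<Longrightarrow> x \<in> S \<Longrightarrow> isCont f x"
  by (meson C1_differentiable_on_def has_vector_derivative_continuous)

lemma C1_differentiable_on_divide_real:
  fixes f g :: "real \<Rightarrow> real"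
  assumes "f C1_differentiable_on S" "g C1_differentiable_on S" "\<And>x. x \<in> S \<Longrightarrow> g x \<noteq> 0"
  shows "(\<lambda>x. f x / g x) C1_differentiable_on S"
proof -
  have "(\<lambda>x. inverse (g x)) C1_differentiable_on S"
  proof (rule C1_differentiable_on_field_chain[where F = inverse and F' = "\<lambda>y. - (inverse y ^ Suc (Suc 0))"])
    show "g C1_differentiable_on S" by (rule assms(2))
    show "(inverse has_real_derivative - (inverse (g x) ^ Suc (Suc 0))) (at (g x))" if "x \<in> S" for x
      by (rule DERIV_inverse) (rule assms(3)[OF that])
    show "continuous_on S (\<lambda>x. - (inverse (g x) ^ Suc (Suc 0)))"
      using assms(3) by (intro continuous_intros C1_differentiable_on_imp_continuous_on assms(2)) auto
  qed
  from C1_differentiable_on_mult[OF assms(1) this] show ?thesis by (simp add: divide_inverse)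
qed

lemma C1_differentiable_on_complex_of_real:
  "f C1_differentiable_on S \<Longrightarrow> (\<lambda>x. complex_of_real (f x)) C1_differentiable_on S"
  by (rule C1_differentiable_on_bounded_linear[OF bounded_linear_of_real])

lemma C1_differentiable_on_Complex:
  assumes "f C1_differentiable_on S" "g C1_differentiable_on S"
  shows "(\<lambda>x. Complex (f x) (g x)) C1_differentiable_on S"
  unfolding Complex_eq
  by (rule C1_differentiable_on_add[OF C1_differentiable_on_complex_of_real[OF assms(1)]
      C1_differentiable_on_mult[OF C1_differentiable_on_const C1_differentiable_on_complex_of_real[OF assms(2)]]])

section \<open>The equilibria on the invariant plane\<close>

text \<open>
  A \<open>C\<^sup>1\<close> curve of parameters that passes at \<open>\<nu>0\<close> through a bifurcation point.  A pitchfork in \<open>h\<close> or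
  \<open>\<mu>\<close> and a pair bifurcating along a general curve are both statements about such a family.
\<close>

locale coherent_family =
  fixes \<alpha> \<beta> h \<mu> \<Omega> c s :: "real \<Rightarrow> real" and \<nu>0 \<delta> \<theta>0 m0 \<gamma> :: real
  assumes \<delta>: "\<delta> > 0"
    and C1: "\<alpha> C1_differentiable_on {\<nu>0 - \<delta> <..< \<nu>0 + \<delta>}" "\<beta> C1_differentiable_on {\<nu>0 - \<delta> <..< \<nu>0 + \<delta>}"
      "h C1_differentiable_on {\<nu>0 - \<delta> <..< \<nu>0 + \<delta>}" "\<mu> C1_differentiable_on {\<nu>0 - \<delta> <..< \<nu>0 + \<delta>}"
      "\<Omega> C1_differentiable_on {\<nu>0 - \<delta> <..< \<nu>0 + \<delta>}" "c C1_differentiable_on {\<nu>0 - \<delta> <..< \<nu>0 + \<delta>}"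
      "s C1_differentiable_on {\<nu>0 - \<delta> <..< \<nu>0 + \<delta>}"
    and adm: "\<And>\<nu>. \<bar>\<nu> - \<nu>0\<bar> < \<delta> \<Longrightarrow> admissible (\<alpha> \<nu>, \<beta> \<nu>, h \<nu>, \<mu> \<nu>, \<Omega> \<nu>, c \<nu>, s \<nu>)"
    and \<theta>0: "\<theta>0 \<in> {0, pi}" and m0: "m0 = cos \<theta>0"
    and zero: "Gamma_tilde (\<alpha> \<nu>0, \<beta> \<nu>0, h \<nu>0, \<mu> \<nu>0, \<Omega> \<nu>0, c \<nu>0, s \<nu>0) m0 = 0"
    and \<gamma>: "\<gamma> = deriv (Gamma_tilde (\<alpha> \<nu>0, \<beta> \<nu>0, h \<nu>0, \<mu> \<nu>0, \<Omega> \<nu>0, c \<nu>0, s \<nu>0)) m0" "\<gamma> \<noteq> 0"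
begin

definition P :: "real \<Rightarrow> params" where
  "P \<nu> = (\<alpha> \<nu>, \<beta> \<nu>, h \<nu>, \<mu> \<nu>, \<Omega> \<nu>, c \<nu>, s \<nu>)"

definition q0 :: real where "q0 = q_eq (P \<nu>0) m0"

definition a :: "real \<Rightarrow> complex" where "a \<nu> = Complex (\<alpha> \<nu>) 1 * of_real (s \<nu>)"

text \<open>
  The derivative of \<open>(\<alpha> + \<i>) s w + m0 w\<^sup>2\<close> at the bifurcating equilibrium: the linearization acts on
  \<open>w\<close> as multiplication by \<open>- b0\<close>.
\<close>

definition b0 :: complex where "b0 = 2 * of_real m0 * Complex 0 q0 + a \<nu>0"

definition G :: "real \<Rightarrow> real" where "G \<nu> = Gamma_tilde (P \<nu>) m0"

text \<open>
  The discriminant of the quadratic equation for the equilibria with \<open>\<theta> = \<theta>0\<close>.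
\<close>

definition disc :: "real \<Rightarrow> complex" where
  "disc \<nu> = (a \<nu>)\<^sup>2 + 4 * of_real m0 *
     Complex (h \<nu> - \<mu> \<nu> * m0 - \<Omega> \<nu>) (\<alpha> \<nu> * \<Omega> \<nu> - \<beta> \<nu> / (1 + c \<nu> * m0))"

text \<open>
  Of the two roots only one passes through \<open>\<i> q0\<close>.  It is singled out by \<open>Re b0 = \<alpha> s\<close>, whose sign is that
  of \<open>s\<close>, while the principal square root has nonnegative real part.
\<close>

definition W :: "real \<Rightarrow> complex" where
  "W \<nu> = (of_real (sgn (s \<nu>0)) * csqrt (disc \<nu>) - a \<nu>) / (2 * of_real m0)"

abbreviation plane_eq :: "real \<Rightarrow> state" where
  "plane_eq \<nu> \<equiv> (\<theta>0, Re (W \<nu>), Im (W \<nu>))"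

abbreviation side_eq :: "real \<Rightarrow> real \<Rightarrow> real \<Rightarrow> state" where
  "side_eq \<sigma> m \<nu> \<equiv> (\<theta>0 + \<sigma> * arccos (m0 * m), 0, q_eq (P \<nu>) m)"

lemma m0_cases: "m0 = 1 \<or> m0 = -1" and sin_\<theta>0: "sin \<theta>0 = 0"
  using \<theta>0 m0 by auto

lemma m0_le: "\<bar>m0\<bar> \<le> 1" and m0_sq: "m0 * m0 = 1" and m0_nz: "m0 \<noteq> 0"
  using m0_cases by auto

lemma admP: "\<bar>\<nu> - \<nu>0\<bar> < \<delta> \<Longrightarrow> admissible (P \<nu>)"
  using adm by (simp add: P_def)

lemma param_signs:
  assumes "\<bar>\<nu> - \<nu>0\<bar> < \<delta>"
  shows "\<alpha> \<nu> > 0" "\<bar>c \<nu>\<bar> < 1" "s \<nu> \<noteq> 0" "\<bar>m\<bar> \<le> 1 \<Longrightarrow> 1 + c \<nu> * m > 0"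
  using adm[OF assms] one_plus_mult_pos by auto

lemma base_signs: "\<alpha> \<nu>0 > 0" "\<bar>c \<nu>0\<bar> < 1" "s \<nu>0 \<noteq> 0" "\<bar>m\<bar> \<le> 1 \<Longrightarrow> 1 + c \<nu>0 * m > 0"
  using param_signs[of \<nu>0] \<delta> by auto

lemma isCont_params:
  "isCont \<alpha> \<nu>0" "isCont \<beta> \<nu>0" "isCont h \<nu>0" "isCont \<mu> \<nu>0" "isCont \<Omega> \<nu>0" "isCont c \<nu>0" "isCont s \<nu>0"
  using C1[THEN C1_differentiable_on_imp_continuous_on] \<delta>
  by (auto simp: continuous_on_eq_continuous_at)

lemma params_tendsto:
  assumes "(v \<longlongrightarrow> \<nu>0) F"
  shows "((\<lambda>x. \<alpha> (v x)) \<longlongrightarrow> \<alpha> \<nu>0) F" "((\<lambda>x. \<beta> (v x)) \<longlongrightarrow> \<beta> \<nu>0) F" "((\<lambda>x. h (v x)) \<longlongrightarrow> h \<nu>0) F"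
    "((\<lambda>x. \<mu> (v x)) \<longlongrightarrow> \<mu> \<nu>0) F" "((\<lambda>x. \<Omega> (v x)) \<longlongrightarrow> \<Omega> \<nu>0) F" "((\<lambda>x. c (v x)) \<longlongrightarrow> c \<nu>0) F"
    "((\<lambda>x. s (v x)) \<longlongrightarrow> s \<nu>0) F"
  by (rule isCont_tendsto_compose[OF isCont_params(1) assms] isCont_tendsto_compose[OF isCont_params(2) assms]
      isCont_tendsto_compose[OF isCont_params(3) assms] isCont_tendsto_compose[OF isCont_params(4) assms]
      isCont_tendsto_compose[OF isCont_params(5) assms] isCont_tendsto_compose[OF isCont_params(6) assms]
      isCont_tendsto_compose[OF isCont_params(7) assms])+

lemma \<gamma>_slope: "\<gamma> = Gamma_slope (P \<nu>0) m0 m0"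
  using Gamma_tilde_has_derivative[OF admP m0_le, of \<nu>0] \<delta> \<gamma>(1)
  by (simp add: P_def DERIV_imp_deriv)

lemma q_eq_tendsto:
  assumes "(v \<longlongrightarrow> \<nu>0) F" "(m \<longlongrightarrow> m0) F"
  shows "((\<lambda>x. q_eq (P (v x)) (m x)) \<longlongrightarrow> q0) F"
  unfolding P_def q0_def q_eq.simps beta_tilde.simps
  using base_signs(1,3) base_signs(4)[OF m0_le]
  by (intro tendsto_intros params_tendsto assms) auto

lemma slope_tendsto:
  assumes "(v \<longlongrightarrow> \<nu>0) F" "(m \<longlongrightarrow> m0) F" "(n \<longlongrightarrow> m0) F"
  shows "((\<lambda>x. Gamma_slope (P (v x)) (m x) (n x)) \<longlongrightarrow> \<gamma>) F"
  unfolding \<gamma>_slope P_def Gamma_slope.simps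
  unfolding P_def[symmetric]
  using base_signs(1,3) base_signs(4)[OF m0_le]
  by (intro tendsto_intros params_tendsto q_eq_tendsto[folded q0_def] assms q_eq_tendsto[unfolded q0_def]) auto

lemma a_tendsto: "(v \<longlongrightarrow> \<nu>0) F \<Longrightarrow> ((\<lambda>x. a (v x)) \<longlongrightarrow> a \<nu>0) F"
  unfolding a_def by (intro tendsto_intros params_tendsto)

lemma Re_b0: "Re b0 = \<alpha> \<nu>0 * s \<nu>0" "Im b0 = s \<nu>0 + 2 * m0 * q0"
  by (simp_all add: b0_def a_def)

lemma Re_b0_nz: "Re b0 \<noteq> 0" and b0_nz: "b0 \<noteq> 0"
  using Re_b0 base_signs by auto

lemma disc_base: "disc \<nu>0 = b0\<^sup>2"
proof -
  have "riccati (P \<nu>0) m0 (Complex 0 q0) = 0"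
  proof -
    have "\<bar>\<nu>0 - \<nu>0\<bar> < \<delta>" using \<delta> by simp
    from riccati_imaginary(2)[OF admP[OF this], of m0 q0] show ?thesis
      using zero unfolding q0_def P_def by blast
  qed
  then have "4 * of_real m0 * riccati (P \<nu>0) m0 (Complex 0 q0) = 0" by simp
  moreover have "complex_of_real m0 * of_real m0 = 1" using m0_sq by (metis of_real_mult of_real_1)
  ultimately show ?thesis
    unfolding disc_def b0_def P_def riccati.simps a_def[symmetric]
    by (simp add: algebra_simps power2_eq_square)
qed

lemma csqrt_disc_base: "of_real (sgn (s \<nu>0)) * csqrt (disc \<nu>0) = b0"
proof -
  have "disc \<nu>0 = (of_real (sgn (s \<nu>0)) * b0)\<^sup>2"
    using base_signs(3) by (simp add: disc_base power_mult_distrib sgn_if)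
  moreover have "0 < Re (of_real (sgn (s \<nu>0)) * b0)"
    using base_signs Re_b0 by (auto simp: sgn_if mult_pos_neg)
  ultimately have "csqrt (disc \<nu>0) = of_real (sgn (s \<nu>0)) * b0"
    using csqrt_square by metis
  then show ?thesis using base_signs(3) by (simp add: sgn_if)
qed

lemma W_base: "W \<nu>0 = Complex 0 q0"
  unfolding W_def csqrt_disc_base using m0_nz by (simp add: b0_def)

lemma riccati_W: "riccati (P \<nu>) m0 (W \<nu>) = 0"
proof -
  have mm: "complex_of_real m0 * of_real m0 = 1" using m0_sq by (metis of_real_mult of_real_1)
  have "2 * of_real m0 * W \<nu> + a \<nu> = of_real (sgn (s \<nu>0)) * csqrt (disc \<nu>)"
    unfolding W_def using m0_nz by simp
  then have "(2 * of_real m0 * W \<nu> + a \<nu>)\<^sup>2 = disc \<nu>"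
    using base_signs(3) by (simp add: power_mult_distrib sgn_if)
  then have "4 * of_real m0 * riccati (P \<nu>) m0 (W \<nu>) = 0"
    unfolding P_def riccati.simps a_def[symmetric] disc_def
    by (simp add: algebra_simps power2_eq_square)
  then show ?thesis using m0_nz by simp
qed

lemma a_C1: "a C1_differentiable_on {\<nu>0 - \<delta> <..< \<nu>0 + \<delta>}"
  unfolding a_def
  by (intro C1_differentiable_on_mult C1_differentiable_on_Complex C1 C1_differentiable_on_const
      C1_differentiable_on_complex_of_real)

lemma beta_C1: "(\<lambda>\<nu>. \<beta> \<nu> / (1 + c \<nu> * m0)) C1_differentiable_on {\<nu>0 - \<delta> <..< \<nu>0 + \<delta>}"
proof (rule C1_differentiable_on_divide_real)
  fix \<nu> assume "\<nu> \<in> {\<nu>0 - \<delta> <..< \<nu>0 + \<delta>}"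
  then have "\<bar>\<nu> - \<nu>0\<bar> < \<delta>" by auto
  from param_signs(4)[OF this m0_le] show "1 + c \<nu> * m0 \<noteq> 0" by simp
qed (intro C1_differentiable_on_add C1_differentiable_on_mult C1_differentiable_on_const C1)+

lemma disc_C1: "disc C1_differentiable_on {\<nu>0 - \<delta> <..< \<nu>0 + \<delta>}"
  unfolding disc_def power2_eq_square
  by (intro C1_differentiable_on_mult C1_differentiable_on_Complex C1 C1_differentiable_on_const
      C1_differentiable_on_add C1_differentiable_on_diff a_C1 beta_C1)

lemma G_C1: "G C1_differentiable_on {\<nu>0 - \<delta> <..< \<nu>0 + \<delta>}"
proof -
  have nz: "\<alpha> \<nu> \<noteq> 0" "s \<nu> \<noteq> 0" if "\<nu> \<in> {\<nu>0 - \<delta> <..< \<nu>0 + \<delta>}" for \<nu>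
    using param_signs[of \<nu>] that by (auto simp: abs_less_iff)
  note div = C1_differentiable_on_divide_real
  have b: "(\<lambda>\<nu>. \<beta> \<nu> / (1 + c \<nu> * m0) / \<alpha> \<nu>) C1_differentiable_on {\<nu>0 - \<delta> <..< \<nu>0 + \<delta>}"
    by (rule div[OF beta_C1 C1(1) nz(1)])
  have q: "(\<lambda>\<nu>. (\<Omega> \<nu> - \<beta> \<nu> / (1 + c \<nu> * m0) / \<alpha> \<nu>) / s \<nu>) C1_differentiable_on {\<nu>0 - \<delta> <..< \<nu>0 + \<delta>}"
    by (rule div[OF C1_differentiable_on_diff[OF C1(5) b] C1(7) nz(2)])
  show ?thesis
    unfolding G_def P_def Gamma_tilde.simps q_eq.simps beta_tilde.simps power2_eq_square
    by (intro C1_differentiable_on_diff C1_differentiable_on_mult b q C1 C1_differentiable_on_const)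
qed

lemma G_has_derivative: "(G has_real_derivative deriv G \<nu>0) (at \<nu>0)"
proof -
  have "\<exists>D. (G has_real_derivative D) (at \<nu>0)"
    using G_C1 \<delta> unfolding C1_differentiable_on_def has_real_derivative_iff_has_vector_derivative by auto
  then show ?thesis using DERIV_imp_deriv by blast
qed

lemma G_base: "G \<nu>0 = 0"
  using zero by (simp add: G_def P_def)

lemma W_C1:
  obtains e where "0 < e" "e \<le> \<delta>" "W C1_differentiable_on {\<nu>0 - e <..< \<nu>0 + e}"
proof -
  have "disc \<nu>0 \<notin> \<real>\<^sub>\<le>\<^sub>0"
  proof
    assume "disc \<nu>0 \<in> \<real>\<^sub>\<le>\<^sub>0"
    then have "Re (csqrt (disc \<nu>0)) = 0"
      by (auto elim!: nonpos_Reals_cases)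
    then have "Re (of_real (sgn (s \<nu>0)) * csqrt (disc \<nu>0)) = 0" by simp
    then show False using csqrt_disc_base Re_b0_nz by simp
  qed
  moreover have "(disc \<longlongrightarrow> disc \<nu>0) (nhds \<nu>0)"
    using isCont_tendsto_compose[OF C1_differentiable_on_imp_isCont[OF disc_C1] filterlim_ident] \<delta> by simp
  ultimately have "\<forall>\<^sub>F \<nu> in nhds \<nu>0. disc \<nu> \<in> - \<real>\<^sub>\<le>\<^sub>0"
    by (intro topological_tendstoD) (auto simp: closed_nonpos_Reals_complex)
  then obtain d where d: "d > 0" "\<And>\<nu>. dist \<nu> \<nu>0 < d \<Longrightarrow> disc \<nu> \<notin> \<real>\<^sub>\<le>\<^sub>0"
    unfolding eventually_nhds_metric by auto
  define e where "e = min d \<delta>"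
  have sub: "{\<nu>0 - e <..< \<nu>0 + e} \<subseteq> {\<nu>0 - \<delta> <..< \<nu>0 + \<delta>}" by (auto simp: e_def)
  have nr: "disc \<nu> \<notin> \<real>\<^sub>\<le>\<^sub>0" if "\<nu> \<in> {\<nu>0 - e <..< \<nu>0 + e}" for \<nu>
    using that by (intro d) (auto simp: e_def dist_real_def)
  have dC: "disc C1_differentiable_on {\<nu>0 - e <..< \<nu>0 + e}" "a C1_differentiable_on {\<nu>0 - e <..< \<nu>0 + e}"
    by (rule C1_differentiable_on_subset[OF _ sub] disc_C1 a_C1)+
  have "continuous_on {\<nu>0 - e <..< \<nu>0 + e} (\<lambda>\<nu>. csqrt (disc \<nu>))"
  proof (rule continuous_on_compose2[of "- \<real>\<^sub>\<le>\<^sub>0" csqrt])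
    show "continuous_on (- \<real>\<^sub>\<le>\<^sub>0) csqrt"
      by (auto intro!: continuous_at_imp_continuous_on continuous_at_csqrt)
  qed (use nr C1_differentiable_on_imp_continuous_on[OF dC(1)] in auto)
  then have ci: "continuous_on {\<nu>0 - e <..< \<nu>0 + e} (\<lambda>\<nu>. inverse (2 * csqrt (disc \<nu>)))"
    using nr by (intro continuous_intros) force+
  have "(\<lambda>\<nu>. csqrt (disc \<nu>)) C1_differentiable_on {\<nu>0 - e <..< \<nu>0 + e}"
    by (rule C1_differentiable_on_field_chain[where F = csqrt and F' = "\<lambda>z. inverse (2 * csqrt z)", OF dC(1) _ ci])
       (rule has_field_derivative_csqrt[OF nr])
  then have "(\<lambda>\<nu>. (of_real (sgn (s \<nu>0)) * csqrt (disc \<nu>) - a \<nu>) * inverse (2 * of_real m0))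
      C1_differentiable_on {\<nu>0 - e <..< \<nu>0 + e}"
    by (intro C1_differentiable_on_mult C1_differentiable_on_const C1_differentiable_on_diff dC)
  then have "W C1_differentiable_on {\<nu>0 - e <..< \<nu>0 + e}"
    unfolding W_def divide_inverse .
  then show thesis using d(1) \<delta> by (intro that[of e]) (auto simp: e_def)
qed

lemma W_isCont: "isCont W \<nu>0"
proof -
  obtain e where "0 < e" "W C1_differentiable_on {\<nu>0 - e <..< \<nu>0 + e}" using W_C1 by metis
  then show ?thesis by (auto intro: C1_differentiable_on_imp_isCont)
qed

lemma W_tendsto: "(v \<longlongrightarrow> \<nu>0) F \<Longrightarrow> ((\<lambda>x. W (v x)) \<longlongrightarrow> Complex 0 q0) F"
  using isCont_tendsto_compose[OF W_isCont] by (simp add: W_base)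

section \<open>Heteroclinic orbits near the bifurcation point\<close>

text \<open>
  The limit, at the bifurcation point, of the slope \<open>dw / dm\<close> of the chord between the equilibrium on the
  invariant plane and a bifurcating one.
\<close>

definition \<kappa>0 :: complex where
  "\<kappa>0 = - ((Complex 0 q0)\<^sup>2 + Complex (\<mu> \<nu>0) (- \<beta> \<nu>0 * c \<nu>0 / ((1 + c \<nu>0 * m0) * (1 + c \<nu>0 * m0)))) / b0"

lemma Re_\<kappa>0: "Re \<kappa>0 = - (\<alpha> \<nu>0 * s \<nu>0 * \<gamma>) / (norm b0)\<^sup>2"
proof -
  define X where "X = \<beta> \<nu>0 * c \<nu>0 / (1 + c \<nu>0 * m0)\<^sup>2"
  have "\<gamma> = - (q0\<^sup>2 - \<mu> \<nu>0) - (s \<nu>0 + 2 * m0 * q0) * (X / (\<alpha> \<nu>0 * s \<nu>0))"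
    unfolding \<gamma>_slope using Gamma_slope_diagonal[OF P_def admP, of \<nu>0 m0] \<delta>
    by (simp add: q0_def X_def mult.commute)
  then have "\<alpha> \<nu>0 * s \<nu>0 * \<gamma> = - (\<alpha> \<nu>0 * s \<nu>0 * (q0\<^sup>2 - \<mu> \<nu>0)) - (s \<nu>0 + 2 * m0 * q0) * X"
    using base_signs by (simp add: field_simps)
  moreover have "- ((Complex 0 q0)\<^sup>2 + Complex (\<mu> \<nu>0) (- \<beta> \<nu>0 * c \<nu>0 / ((1 + c \<nu>0 * m0) * (1 + c \<nu>0 * m0))))
      = Complex (q0\<^sup>2 - \<mu> \<nu>0) X"
    unfolding X_def by (simp add: complex_eq_iff power2_eq_square)
  ultimately have "Re \<kappa>0 = ((q0\<^sup>2 - \<mu> \<nu>0) * (\<alpha> \<nu>0 * s \<nu>0) + X * (s \<nu>0 + 2 * m0 * q0)) / (norm b0)\<^sup>2"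
    and "(q0\<^sup>2 - \<mu> \<nu>0) * (\<alpha> \<nu>0 * s \<nu>0) + X * (s \<nu>0 + 2 * m0 * q0) = - (\<alpha> \<nu>0 * s \<nu>0 * \<gamma>)"
    unfolding \<kappa>0_def by (simp_all add: Re_divide Re_b0 cmod_power2)
  then show ?thesis by simp
qed

lemma Re_\<kappa>0_nz: "Re \<kappa>0 \<noteq> 0"
  using Re_\<kappa>0 base_signs \<gamma>(2) b0_nz by simp

text \<open>
  Together with \<open>rescaled_connection\<close> this fixes the direction of the heteroclinic orbits.
\<close>

lemma Re_\<kappa>0_sign: "0 < - Re \<kappa>0 * (\<gamma> * s \<nu>0)"
proof -
  have "- Re \<kappa>0 * (\<gamma> * s \<nu>0) = \<alpha> \<nu>0 * (s \<nu>0 * \<gamma>)\<^sup>2 / (norm b0)\<^sup>2"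
    unfolding Re_\<kappa>0 by (simp add: power2_eq_square)
  also have "\<dots> > 0" using base_signs \<gamma>(2) b0_nz by (intro divide_pos_pos mult_pos_pos) auto
  finally show ?thesis .
qed

lemma eventually_near:
  assumes "((\<lambda>\<nu>. \<nu>) \<longlongrightarrow> \<nu>0) F" "e > 0"
  shows "\<forall>\<^sub>F \<nu> in F. \<bar>\<nu> - \<nu>0\<bar> < e"
  using tendstoD[OF assms] by (simp add: dist_real_def)

definition chord :: "(real \<Rightarrow> real) \<Rightarrow> real \<Rightarrow> complex" where
  "chord m1 \<nu> = (W \<nu> - Complex 0 (q_eq (P \<nu>) (m1 \<nu>))) / of_real (m0 - m1 \<nu>)"

text \<open>
  Both ends of the chord converge to the same point.  The slope is determinate because
  \<open>riccati_secant\<close> divides out the common factor \<open>m0 - m1\<close>, and the remaining denominator tends to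
  \<open>b0 \<noteq> 0\<close>.
\<close>

lemma chord_tendsto:
  assumes F: "((\<lambda>\<nu>. \<nu>) \<longlongrightarrow> \<nu>0) F" and m1: "(m1 \<longlongrightarrow> m0) F"
    and root: "\<forall>\<^sub>F \<nu> in F. \<bar>m1 \<nu>\<bar> < 1 \<and> Gamma_tilde (P \<nu>) (m1 \<nu>) = 0"
  shows "(chord m1 \<longlongrightarrow> \<kappa>0) F"
proof -
  define w1 where "w1 \<nu> = Complex 0 (q_eq (P \<nu>) (m1 \<nu>))" for \<nu>
  define D where "D \<nu> = of_real m0 * (W \<nu> + w1 \<nu>) + a \<nu>" for \<nu>
  define X where "X \<nu> = (w1 \<nu>)\<^sup>2 + Complex (\<mu> \<nu>) (- \<beta> \<nu> * c \<nu> / ((1 + c \<nu> * m0) * (1 + c \<nu> * m1 \<nu>)))" for \<nu>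
  have w1: "(w1 \<longlongrightarrow> Complex 0 q0) F"
    unfolding w1_def by (intro tendsto_Complex tendsto_const q_eq_tendsto F m1)
  have "(D \<longlongrightarrow> of_real m0 * (Complex 0 q0 + Complex 0 q0) + a \<nu>0) F"
    unfolding D_def by (intro tendsto_intros W_tendsto w1 a_tendsto F)
  then have D: "(D \<longlongrightarrow> b0) F" by (simp add: b0_def algebra_simps)
  have X: "(X \<longlongrightarrow> (Complex 0 q0)\<^sup>2 + Complex (\<mu> \<nu>0) (- \<beta> \<nu>0 * c \<nu>0 / ((1 + c \<nu>0 * m0) * (1 + c \<nu>0 * m0)))) F"
    unfolding X_def using base_signs(4)[OF m0_le]
    by (intro tendsto_intros tendsto_Complex w1 params_tendsto F m1) auto
  have "((\<lambda>\<nu>. - X \<nu> / D \<nu>) \<longlongrightarrow> \<kappa>0) F"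
    unfolding \<kappa>0_def by (intro tendsto_intros X D b0_nz)
  moreover have "\<forall>\<^sub>F \<nu> in F. - X \<nu> / D \<nu> = chord m1 \<nu>"
    using root tendsto_imp_eventually_ne[OF D b0_nz] eventually_near[OF F \<delta>]
  proof eventually_elim
    case (elim \<nu>)
    have z1: "riccati (P \<nu>) (m1 \<nu>) (w1 \<nu>) = 0"
      unfolding w1_def using riccati_imaginary(2)[OF admP[OF elim(3)]] elim(1) by blast
    have ne: "m0 - m1 \<nu> \<noteq> 0" using elim(1) m0_cases by auto
    have "1 + c \<nu> * m0 \<noteq> 0" "1 + c \<nu> * m1 \<nu> \<noteq> 0"
      using param_signs(4)[OF elim(3), of m0] param_signs(4)[OF elim(3), of "m1 \<nu>"] m0_le elim(1) by auto
    from riccati_secant[OF P_def this, of "w1 \<nu>" "W \<nu>"]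
    have "(W \<nu> - w1 \<nu>) * D \<nu> = - (of_real (m0 - m1 \<nu>) * X \<nu>)"
      unfolding z1 riccati_W D_def X_def a_def by (simp add: eq_neg_iff_add_eq_0 del: of_real_diff)
    then show ?case
      unfolding chord_def w1_def[symmetric] using elim(2) ne
      by (simp add: field_simps del: of_real_diff)
  qed
  ultimately show ?thesis by (rule Lim_transform_eventually)
qed

text \<open>
  The smallness conditions of \<open>connecting_orbit\<close> become true along \<open>F\<close> because the chord and the
  coefficients converge; \<open>M\<close> exceeds the limits of the bounded quantities.
\<close>

lemma connecting_orbits:
  assumes F: "((\<lambda>\<nu>. \<nu>) \<longlongrightarrow> \<nu>0) F" and m1: "(m1 \<longlongrightarrow> m0) F"
    and root: "\<forall>\<^sub>F \<nu> in F. \<bar>m1 \<nu>\<bar> < 1 \<and> Gamma_tilde (P \<nu>) (m1 \<nu>) = 0"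
  shows "\<forall>\<^sub>F \<nu> in F. \<forall>l \<sigma>. 0 < l * (\<gamma> * s \<nu>0) \<and> \<sigma> \<in> {-1, 1} \<longrightarrow>
     heteroclinic (coh_field (P \<nu>)) l (side_eq \<sigma> (m1 \<nu>) \<nu>)
       (plane_eq \<nu>)"
proof -
  define B where "B = \<bar>\<beta> \<nu>0\<bar> * (c \<nu>0)\<^sup>2 / (1 - \<bar>c \<nu>0\<bar>) ^ 3"
  define M where "M = norm b0 + norm \<kappa>0 + norm (Complex 0 q0) + B + 1"
  have B0: "0 \<le> B" using base_signs(2) by (simp add: B_def)
  have M: "norm b0 \<le> M" "norm \<kappa>0 + 1 \<le> M" "norm (Complex 0 q0) < M" "B < M"
    using B0 norm_ge_zero[of b0] norm_ge_zero[of \<kappa>0] norm_ge_zero[of "Complex 0 q0"]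
    unfolding M_def by linarith+
  obtain \<eta> where \<eta>: "\<eta> > 0"
    and orbit: "\<And>P \<alpha> \<beta> h \<mu> \<Omega> c s m1 w1 \<kappa>. P = (\<alpha>, \<beta>, h, \<mu>, \<Omega>, c, s) \<Longrightarrow> \<bar>c\<bar> < 1 \<Longrightarrow>
       \<bar>\<beta>\<bar> * c\<^sup>2 \<le> M * (1 - \<bar>c\<bar>) ^ 3 \<Longrightarrow> norm w1 \<le> M \<Longrightarrow> \<bar>m1\<bar> < 1 \<Longrightarrow> \<bar>m0 - m1\<bar> \<le> \<eta>\<^sup>2 \<Longrightarrow>
       norm (\<kappa> - \<kappa>0) \<le> \<eta> \<Longrightarrow> norm (2 * of_real m0 * w1 + Complex \<alpha> 1 * of_real s - b0) \<le> \<eta> \<Longrightarrow>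
       riccati P m1 w1 = 0 \<Longrightarrow> Re w1 = 0 \<Longrightarrow> riccati P m0 (w1 + of_real (m0 - m1) * \<kappa>) = 0 \<Longrightarrow>
       rescaled_connection P (- Re \<kappa>0) m1 w1 m0 (w1 + of_real (m0 - m1) * \<kappa>)"
    using connecting_orbit[OF m0_cases Re_b0_nz Re_\<kappa>0_nz M(1,2)] by metis
  define w1 where "w1 \<nu> = Complex 0 (q_eq (P \<nu>) (m1 \<nu>))" for \<nu>
  have w1: "(w1 \<longlongrightarrow> Complex 0 q0) F"
    unfolding w1_def by (intro tendsto_Complex tendsto_const q_eq_tendsto F m1)
  have "((\<lambda>\<nu>. \<bar>\<beta> \<nu>\<bar> * (c \<nu>)\<^sup>2 / (1 - \<bar>c \<nu>\<bar>) ^ 3) \<longlongrightarrow> B) F"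
    unfolding B_def using base_signs(2) by (intro tendsto_intros params_tendsto F) auto
  then have e1: "\<forall>\<^sub>F \<nu> in F. \<bar>\<beta> \<nu>\<bar> * (c \<nu>)\<^sup>2 / (1 - \<bar>c \<nu>\<bar>) ^ 3 < M"
    using M(4) by (rule order_tendstoD)
  have e2: "\<forall>\<^sub>F \<nu> in F. norm (w1 \<nu>) < M"
    using tendsto_norm[OF w1] M(3) by (rule order_tendstoD)
  have e3: "\<forall>\<^sub>F \<nu> in F. dist (m1 \<nu>) m0 < \<eta>\<^sup>2"
    using m1 by (rule tendstoD) (use \<eta> in simp)
  have e4: "\<forall>\<^sub>F \<nu> in F. dist (chord m1 \<nu>) \<kappa>0 < \<eta>"
    by (rule tendstoD[OF chord_tendsto[OF assms] \<eta>])
  have "((\<lambda>\<nu>. 2 * of_real m0 * w1 \<nu> + a \<nu>) \<longlongrightarrow> b0) F"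
    unfolding b0_def by (intro tendsto_intros w1 a_tendsto F)
  then have e5: "\<forall>\<^sub>F \<nu> in F. dist (2 * of_real m0 * w1 \<nu> + a \<nu>) b0 < \<eta>" by (rule tendstoD[OF _ \<eta>])
  show ?thesis
    using e1 e2 e3 e4 e5 root eventually_near[OF F \<delta>]
  proof eventually_elim
    case (elim \<nu>)
    have ne: "m0 - m1 \<nu> \<noteq> 0" using elim(6) m0_cases by auto
    have z1: "riccati (P \<nu>) (m1 \<nu>) (w1 \<nu>) = 0"
      unfolding w1_def using riccati_imaginary(2)[OF admP[OF elim(7)]] elim(6) by blast
    have W: "w1 \<nu> + of_real (m0 - m1 \<nu>) * chord m1 \<nu> = W \<nu>"
      unfolding chord_def w1_def[symmetric] using ne by (simp del: of_real_diff)
    have c3: "0 < (1 - \<bar>c \<nu>\<bar>) ^ 3" using param_signs(2)[OF elim(7)] by simp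
    have "rescaled_connection (P \<nu>) (- Re \<kappa>0) (m1 \<nu>) (w1 \<nu>) m0 (w1 \<nu> + of_real (m0 - m1 \<nu>) * chord m1 \<nu>)"
    proof (rule orbit[OF P_def param_signs(2)[OF elim(7)]])
      show "\<bar>\<beta> \<nu>\<bar> * (c \<nu>)\<^sup>2 \<le> M * (1 - \<bar>c \<nu>\<bar>) ^ 3"
        using elim(1) c3 by (simp add: pos_divide_less_eq less_imp_le)
      show "norm (w1 \<nu>) \<le> M" "\<bar>m1 \<nu>\<bar> < 1" "\<bar>m0 - m1 \<nu>\<bar> \<le> \<eta>\<^sup>2" "norm (chord m1 \<nu> - \<kappa>0) \<le> \<eta>"
        "norm (2 * of_real m0 * w1 \<nu> + Complex (\<alpha> \<nu>) 1 * of_real (s \<nu>) - b0) \<le> \<eta>"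
        using elim(2-6) by (simp_all add: dist_norm a_def abs_minus_commute less_imp_le)
      show "Re (w1 \<nu>) = 0" by (simp add: w1_def)
      show "riccati (P \<nu>) (m1 \<nu>) (w1 \<nu>) = 0" by (rule z1)
      show "riccati (P \<nu>) m0 (w1 \<nu> + of_real (m0 - m1 \<nu>) * chord m1 \<nu>) = 0"
        unfolding W by (rule riccati_W)
    qed
    then obtain m w g e where g: "continuous_on UNIV g" "e > 0" "\<And>\<tau>. - Re \<kappa>0 * g \<tau> \<ge> e"
      and md: "\<And>\<tau>. (m has_real_derivative - g \<tau> * (1 - (m \<tau>)\<^sup>2) * Re (w \<tau>)) (at \<tau>)"
      and mb: "\<And>\<tau>. \<bar>m \<tau>\<bar> < 1"
      and wd: "\<And>\<tau>. (w has_vector_derivative g \<tau> *\<^sub>R riccati (P \<nu>) (m \<tau>) (w \<tau>)) (at \<tau>)"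
      and lim: "(m \<longlongrightarrow> m1 \<nu>) at_bot" "(w \<longlongrightarrow> w1 \<nu>) at_bot"
        "(m \<longlongrightarrow> m0) at_top" "(w \<longlongrightarrow> W \<nu>) at_top"
      unfolding W rescaled_connection_def by blast
    have mb': "-1 \<le> m0 * m \<tau>" "m0 * m \<tau> \<le> 1" for \<tau> using mb[of \<tau>] m0_cases by auto
    have m1b: "-1 < m0 * m1 \<nu>" "m0 * m1 \<nu> < 1" using elim(6) m0_cases by auto
    have arc: "((\<lambda>\<tau>. arccos (m0 * m \<tau>)) \<longlongrightarrow> arccos (m0 * x)) K"
      if "(m \<longlongrightarrow> x) K" "\<bar>x\<bar> \<le> 1" for x K
      using mb' that m0_cases
      by (intro continuous_on_tendsto_compose[OF continuous_on_arccos'] tendsto_intros) auto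
    have cos1: "cos (\<theta>0 + \<sigma> * arccos (m0 * m1 \<nu>)) = m1 \<nu>" if "\<sigma> \<in> {-1, 1}" for \<sigma> :: real
      using that m1b sin_\<theta>0 m0[symmetric] m0_sq by (auto simp: cos_add mult.assoc[symmetric])
    show ?case
    proof (intro allI impI, elim conjE)
      fix l \<sigma> :: real
      assume l: "0 < l * (\<gamma> * s \<nu>0)" and \<sigma>: "\<sigma> \<in> {-1, 1}"
      have lk: "0 < l / - Re \<kappa>0"
      proof -
        have "0 < (l * (\<gamma> * s \<nu>0)) * (- Re \<kappa>0 * (\<gamma> * s \<nu>0))" using l Re_\<kappa>0_sign by (rule mult_pos_pos)
        also have "\<dots> = (l * - Re \<kappa>0) * (\<gamma> * s \<nu>0)\<^sup>2" by (simp add: power2_eq_square)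
        finally have "0 < l * - Re \<kappa>0"
          by (rule zero_less_mult_pos2) (use \<gamma>(2) base_signs(3) in simp)
        then show ?thesis by (auto simp: mult_less_0_iff divide_less_0_iff)
      qed
      show "heteroclinic (coh_field (P \<nu>)) l (side_eq \<sigma> (m1 \<nu>) \<nu>)
         (plane_eq \<nu>)"
      proof (rule heteroclinic_of_rescaled_orbit[where g = g
            and Y = "\<lambda>\<tau>. (\<theta>0 + \<sigma> * arccos (m0 * m \<tau>), Re (w \<tau>), Im (w \<tau>))"])
        show "((\<lambda>\<tau>. (\<theta>0 + \<sigma> * arccos (m0 * m \<tau>), Re (w \<tau>), Im (w \<tau>))) has_vector_derivative
            g \<tau> *\<^sub>R coh_field (P \<nu>) (\<theta>0 + \<sigma> * arccos (m0 * m \<tau>), Re (w \<tau>), Im (w \<tau>))) (at \<tau>)" for \<tau>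
          by (rule orbit_lift[OF sin_\<theta>0 m0 \<sigma> md mb wd])
        show "continuous_on UNIV g" by (rule g(1))
        show "((\<lambda>\<tau>. (\<theta>0 + \<sigma> * arccos (m0 * m \<tau>), Re (w \<tau>), Im (w \<tau>))) \<longlongrightarrow>
            (side_eq \<sigma> (m1 \<nu>) \<nu>)) at_bot"
          using tendsto_Re[OF lim(2)] tendsto_Im[OF lim(2)] elim(6)
          by (intro tendsto_Pair tendsto_intros arc[OF lim(1)]) (auto simp: w1_def)
        have "((\<lambda>\<tau>. (\<theta>0 + \<sigma> * arccos (m0 * m \<tau>), Re (w \<tau>), Im (w \<tau>))) \<longlongrightarrow>
            (\<theta>0 + \<sigma> * arccos (m0 * m0), Re (W \<nu>), Im (W \<nu>))) at_top"
          by (intro tendsto_Pair tendsto_intros arc[OF lim(3)] lim(4) m0_le)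
        then show "((\<lambda>\<tau>. (\<theta>0 + \<sigma> * arccos (m0 * m \<tau>), Re (w \<tau>), Im (w \<tau>))) \<longlongrightarrow>
            (plane_eq \<nu>)) at_top" by (simp add: m0_sq)
        show "coh_field (P \<nu>) (side_eq \<sigma> (m1 \<nu>) \<nu>) = 0"
          using z1 unfolding coh_field_eq_0_iff cos1[OF \<sigma>] w1_def by simp
        show "coh_field (P \<nu>) (plane_eq \<nu>) = 0"
          using riccati_W unfolding coh_field_eq_0_iff sin_\<theta>0 m0[symmetric] by simp
        show "(side_eq \<sigma> (m1 \<nu>) \<nu>) \<noteq> (plane_eq \<nu>)"
          using \<sigma> arccos_lt_bounded[OF m1b] by auto
        show "0 < l / - Re \<kappa>0 * e" using lk g(2) by (rule mult_pos_pos)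
        show "l / - Re \<kappa>0 * e \<le> l * g \<tau>" for \<tau>
          using mult_left_mono[OF g(3)[of \<tau>] less_imp_le[OF lk]] Re_\<kappa>0_nz by (simp add: field_simps)
      qed
    qed
  qed
qed

text \<open>
  The bifurcating equilibrium has \<open>p = 0\<close>, so \<open>Re W\<close> is \<open>m0 - m1\<close> times the real part of the slope of the
  chord, and \<open>m0 - m1\<close> has the sign of \<open>m0\<close>.
\<close>

lemma Re_W_sign:
  assumes F: "((\<lambda>\<nu>. \<nu>) \<longlongrightarrow> \<nu>0) F" and m1: "(m1 \<longlongrightarrow> m0) F"
    and root: "\<forall>\<^sub>F \<nu> in F. \<bar>m1 \<nu>\<bar> < 1 \<and> Gamma_tilde (P \<nu>) (m1 \<nu>) = 0"
  shows "\<forall>\<^sub>F \<nu> in F. 0 < - m0 * Re (W \<nu>) * (\<gamma> * s \<nu>0)"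
proof -
  have "((\<lambda>\<nu>. - Re (chord m1 \<nu>) * (\<gamma> * s \<nu>0)) \<longlongrightarrow> - Re \<kappa>0 * (\<gamma> * s \<nu>0)) F"
    by (intro tendsto_intros chord_tendsto assms)
  then have "\<forall>\<^sub>F \<nu> in F. 0 < - Re (chord m1 \<nu>) * (\<gamma> * s \<nu>0)"
    using Re_\<kappa>0_sign by (rule order_tendstoD)
  with root show ?thesis
  proof eventually_elim
    case (elim \<nu>)
    have ne: "m0 - m1 \<nu> \<noteq> 0" "0 < m0 * (m0 - m1 \<nu>)" using elim(1) m0_cases by auto
    have "Re (W \<nu>) = Re (of_real (m0 - m1 \<nu>) * chord m1 \<nu>)"
      unfolding chord_def using ne(1) by (simp del: of_real_diff)
    then have eq: "Re (W \<nu>) = (m0 - m1 \<nu>) * Re (chord m1 \<nu>)" by (simp del: of_real_diff)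
    have "- m0 * Re (W \<nu>) * (\<gamma> * s \<nu>0)
        = (m0 * (m0 - m1 \<nu>)) * (- Re (chord m1 \<nu>) * (\<gamma> * s \<nu>0))"
      unfolding eq by (simp add: algebra_simps)
    with mult_pos_pos[OF ne(2) elim(2)] show ?case by (simp only:)
  qed
qed

section \<open>The bifurcating equilibria\<close>

text \<open>
  A neighbourhood on which \<open>\<Gamma>\<close> is strictly monotone in \<open>m\<close>, uniformly in the parameter.
\<close>

lemma slope_uniform:
  obtains \<rho> e where "0 < \<rho>" "\<rho> \<le> 1" "0 < e" "e \<le> \<delta>"
    and "\<And>\<nu> m n. \<bar>\<nu> - \<nu>0\<bar> < e \<Longrightarrow> \<bar>m - m0\<bar> < \<rho> \<Longrightarrow> \<bar>n - m0\<bar> < \<rho> \<Longrightarrow> \<gamma>\<^sup>2 / 2 < \<gamma> * Gamma_slope (P \<nu>) m n"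
proof -
  define F where "F = nhds \<nu>0 \<times>\<^sub>F (nhds m0 \<times>\<^sub>F nhds m0)"
  have t: "(fst \<longlongrightarrow> \<nu>0) F" "((\<lambda>x. fst (snd x)) \<longlongrightarrow> m0) F" "((\<lambda>x. snd (snd x)) \<longlongrightarrow> m0) F"
    unfolding F_def
    by (rule filterlim_fst filterlim_compose[OF filterlim_fst filterlim_snd]
        filterlim_compose[OF filterlim_snd filterlim_snd])+
  have "((\<lambda>x. \<gamma> * Gamma_slope (P (fst x)) (fst (snd x)) (snd (snd x))) \<longlongrightarrow> \<gamma> * \<gamma>) F"
    by (intro tendsto_intros slope_tendsto t)
  moreover have "\<gamma>\<^sup>2 / 2 < \<gamma> * \<gamma>"
    using \<gamma>(2) zero_less_power2[of \<gamma>] unfolding power2_eq_square by linarith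
  ultimately have "\<forall>\<^sub>F x in F. \<gamma>\<^sup>2 / 2 < \<gamma> * Gamma_slope (P (fst x)) (fst (snd x)) (snd (snd x))"
    by (rule order_tendstoD)
  then have "\<exists>A B. eventually A (nhds \<nu>0) \<and> eventually B (nhds m0 \<times>\<^sub>F nhds m0) \<and>
      (\<forall>\<nu> x. A \<nu> \<longrightarrow> B x \<longrightarrow> \<gamma>\<^sup>2 / 2 < \<gamma> * Gamma_slope (P (fst (\<nu>, x))) (fst (snd (\<nu>, x))) (snd (snd (\<nu>, x))))"
    unfolding F_def by (rule eventually_prod_filter[THEN iffD1])
  then obtain A B where A: "eventually A (nhds \<nu>0)" and B: "eventually B (nhds m0 \<times>\<^sub>F nhds m0)"
    and AB: "\<And>\<nu> x. A \<nu> \<Longrightarrow> B x \<Longrightarrow> \<gamma>\<^sup>2 / 2 < \<gamma> * Gamma_slope (P \<nu>) (fst x) (snd x)"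
    by auto
  from B obtain C D where C: "eventually C (nhds m0)" and D: "eventually D (nhds m0)"
    and CD: "\<And>m n. C m \<Longrightarrow> D n \<Longrightarrow> B (m, n)"
    unfolding eventually_prod_filter by auto
  obtain e1 where e1: "e1 > 0" "\<And>\<nu>. dist \<nu> \<nu>0 < e1 \<Longrightarrow> A \<nu>"
    using A unfolding eventually_nhds_metric by auto
  obtain \<rho>1 where \<rho>1: "\<rho>1 > 0" "\<And>m. dist m m0 < \<rho>1 \<Longrightarrow> C m \<and> D m"
    using eventually_conj[OF C D] unfolding eventually_nhds_metric by auto
  show thesis
  proof (rule that[of "min \<rho>1 1" "min e1 \<delta>"])
    show "\<gamma>\<^sup>2 / 2 < \<gamma> * Gamma_slope (P \<nu>) m n"
      if "\<bar>\<nu> - \<nu>0\<bar> < min e1 \<delta>" "\<bar>m - m0\<bar> < min \<rho>1 1" "\<bar>n - m0\<bar> < min \<rho>1 1" for \<nu> m n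
      using AB[OF e1(2) CD, of \<nu> m n] \<rho>1(2)[of m] \<rho>1(2)[of n] that by (simp add: dist_real_def)
  qed (use e1(1) \<rho>1(1) \<delta> in auto)
qed

text \<open>
  Near \<open>(\<theta>0, 0, q0)\<close> the equation \<open>sin \<theta> p = 0\<close> leaves two kinds of equilibria.  Two roots of the
  quadratic add up to \<open>- (\<alpha> + \<i>) s / m0\<close>, so that only one of them can have small real part.
\<close>

lemma zero_cases:
  assumes \<nu>: "\<bar>\<nu> - \<nu>0\<bar> < \<delta>" and r: "4 * r \<le> \<bar>\<alpha> \<nu> * s \<nu>\<bar>" "r \<le> pi"
    and W: "\<bar>Re (W \<nu>)\<bar> < r" and x: "\<bar>\<theta> - \<theta>0\<bar> < r" "\<bar>p\<bar> < r"
    and z: "coh_field (P \<nu>) (\<theta>, p, q) = 0"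
  shows "(\<theta>, p, q) = plane_eq \<nu> \<or>
    (\<theta> \<noteq> \<theta>0 \<and> p = 0 \<and> q = q_eq (P \<nu>) (cos \<theta>) \<and> Gamma_tilde (P \<nu>) (cos \<theta>) = 0 \<and> \<bar>cos \<theta>\<bar> < 1 \<and>
      \<bar>\<theta> - \<theta>0\<bar> = arccos (m0 * cos \<theta>))"
proof (cases "\<theta> = \<theta>0")
  case True
  then have "riccati (P \<nu>) m0 (Complex p q) = 0" using z unfolding coh_field_eq_0_iff m0 by simp
  moreover have "1 + c \<nu> * m0 \<noteq> 0" using param_signs(4)[OF \<nu> m0_le] by simp
  ultimately have "(W \<nu> - Complex p q) * (of_real m0 * (W \<nu> + Complex p q) + Complex (\<alpha> \<nu>) 1 * of_real (s \<nu>)) = 0"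
    using riccati_secant[OF P_def, of \<nu> m0 m0 "Complex p q" "W \<nu>"] riccati_W by simp
  moreover have "of_real m0 * (W \<nu> + Complex p q) + Complex (\<alpha> \<nu>) 1 * of_real (s \<nu>) \<noteq> 0"
  proof
    assume "of_real m0 * (W \<nu> + Complex p q) + Complex (\<alpha> \<nu>) 1 * of_real (s \<nu>) = 0"
    from arg_cong[OF this, of Re] have "\<alpha> \<nu> * s \<nu> = - (m0 * (Re (W \<nu>) + p))" by simp
    then have "\<bar>\<alpha> \<nu> * s \<nu>\<bar> = \<bar>Re (W \<nu>) + p\<bar>" using m0_cases by (auto simp: abs_if)
    then show False using r(1) W x(2) by linarith
  qed
  ultimately have "W \<nu> = Complex p q" by (metis mult_eq_0_iff right_minus_eq)
  then show ?thesis using True by simp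
next
  case False
  have cs: "cos (\<theta> - \<theta>0) = m0 * cos \<theta>" "sin (\<theta> - \<theta>0) = m0 * sin \<theta>"
    by (simp_all add: cos_diff sin_diff sin_\<theta>0 m0)
  have d: "\<bar>\<theta> - \<theta>0\<bar> < pi" using x(1) r(2) by linarith
  have "sin \<theta> \<noteq> 0"
  proof
    assume "sin \<theta> = 0"
    then have "sin \<bar>\<theta> - \<theta>0\<bar> = 0" using cs(2) by (cases "\<theta> - \<theta>0 \<ge> 0") (auto simp: abs_if sin_diff)
    then show False using sin_gt_zero[of "\<bar>\<theta> - \<theta>0\<bar>"] d False by simp
  qed
  then have p: "p = 0" using z unfolding coh_field_eq_0_iff by simp
  have "riccati (P \<nu>) (cos \<theta>) (Complex 0 q) = 0" using z unfolding coh_field_eq_0_iff p by simp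
  then have q: "q = q_eq (P \<nu>) (cos \<theta>) \<and> Gamma_tilde (P \<nu>) (cos \<theta>) = 0"
    using riccati_imaginary(2)[OF admP[OF \<nu>]] by blast
  have "(cos \<theta>)\<^sup>2 < 1" using \<open>sin \<theta> \<noteq> 0\<close> sin_cos_squared_add[of \<theta>] zero_less_power2[of "sin \<theta>"] by linarith
  then have "\<bar>cos \<theta>\<bar> < 1" by (simp add: abs_square_less_1)
  moreover have "arccos (m0 * cos \<theta>) = \<bar>\<theta> - \<theta>0\<bar>"
    using d arccos_cos[of "\<bar>\<theta> - \<theta>0\<bar>"] unfolding cs(1)[symmetric] by simp
  ultimately show ?thesis using False p q by simp
qed

lemma reflect_flip: "reflect_about flip_theta (\<theta>0, p0, q0') (\<theta>, p, q) = (2 * \<theta>0 - \<theta>, p, q)"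
  by (simp add: reflect_about_def)

text \<open>
  For roots \<open>m\<close> with \<open>\<bar>m\<bar> < 1\<close> the product \<open>m0 (m - m0)\<close> is negative.  As \<open>\<gamma>\<close> times the difference
  quotient of \<open>\<Gamma>\<close> is positive, such a root exists exactly when \<open>m0 \<gamma> \<Gamma>(m0) > 0\<close>, which happens for \<open>\<nu>\<close>
  on the side of \<open>\<nu>0\<close> selected by \<open>sg\<close>.  The rate at which \<open>m1\<close> leaves \<open>m0\<close> follows from
  \<open>(m0 - m1) slope = \<Gamma>(m0)\<close>.
\<close>

lemma branching:
  fixes sg :: real
  assumes G': "deriv G \<nu>0 \<noteq> 0" and sg: "sg = sgn (m0 * \<gamma> * deriv G \<nu>0)"
  defines "F \<equiv> at \<nu>0 within {\<nu>. sg * (\<nu> - \<nu>0) > 0}"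
  obtains e U m1 where "0 < e" "e \<le> \<delta>" "open U" "(\<theta>0, 0, q0) \<in> U"
    and "(m1 \<longlongrightarrow> m0) F" "\<forall>\<^sub>F \<nu> in F. \<bar>m1 \<nu>\<bar> < 1 \<and> Gamma_tilde (P \<nu>) (m1 \<nu>) = 0"
    and "((\<lambda>\<nu>. m0 * (m0 - m1 \<nu>) / (sg * (\<nu> - \<nu>0))) \<longlongrightarrow> \<bar>deriv G \<nu>0 / \<gamma>\<bar>) F"
    and "\<And>\<nu>. \<bar>\<nu> - \<nu>0\<bar> < e \<Longrightarrow> sg * (\<nu> - \<nu>0) \<le> 0 \<Longrightarrow>
      {x \<in> U. coh_field (P \<nu>) x = 0} = {plane_eq \<nu>}"
    and "\<And>\<nu>. \<bar>\<nu> - \<nu>0\<bar> < e \<Longrightarrow> sg * (\<nu> - \<nu>0) > 0 \<Longrightarrow> \<bar>m1 \<nu>\<bar> < 1 \<and>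
      {x \<in> U. coh_field (P \<nu>) x = 0} = {plane_eq \<nu>,
        (\<theta>0 + arccos (m0 * m1 \<nu>), 0, q_eq (P \<nu>) (m1 \<nu>)),
        (\<theta>0 - arccos (m0 * m1 \<nu>), 0, q_eq (P \<nu>) (m1 \<nu>))}"
proof -
  have sg': "sg = 1 \<or> sg = -1" using G' m0_nz \<gamma>(2) by (simp add: sg sgn_if)
  have sgabs: "sg * (m0 * \<gamma> * deriv G \<nu>0) = \<bar>m0 * \<gamma> * deriv G \<nu>0\<bar>" by (simp add: sg abs_sgn mult.commute)
  obtain \<rho> e0 where \<rho>: "0 < \<rho>" "\<rho> \<le> 1" and e0: "0 < e0" "e0 \<le> \<delta>"
    and slope: "\<And>\<nu> m n. \<bar>\<nu> - \<nu>0\<bar> < e0 \<Longrightarrow> \<bar>m - m0\<bar> < \<rho> \<Longrightarrow> \<bar>n - m0\<bar> < \<rho> \<Longrightarrow>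
        \<gamma>\<^sup>2 / 2 < \<gamma> * Gamma_slope (P \<nu>) m n"
    using slope_uniform by metis
  have \<gamma>2: "0 < \<gamma>\<^sup>2 / 2" using \<gamma>(2) by simp
  have root_unique: "m = n" if "\<bar>\<nu> - \<nu>0\<bar> < e0" "\<bar>m - m0\<bar> < \<rho>" "\<bar>n - m0\<bar> < \<rho>" "\<bar>m\<bar> \<le> 1" "\<bar>n\<bar> \<le> 1"
    "Gamma_tilde (P \<nu>) m = 0" "Gamma_tilde (P \<nu>) n = 0" for \<nu> m n
  proof -
    have "\<bar>\<nu> - \<nu>0\<bar> < \<delta>" using that(1) e0(2) by simp
    from Gamma_tilde_diff[OF admP[OF this] that(4,5)] show ?thesis
      using slope[OF that(1-3)] that(6,7) \<gamma>2 by auto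
  qed
  have idn: "((\<lambda>\<nu>. \<nu>) \<longlongrightarrow> \<nu>0) (nhds \<nu>0)" by (rule filterlim_ident)
  have idF: "((\<lambda>\<nu>. \<nu>) \<longlongrightarrow> \<nu>0) F" unfolding F_def by (rule tendsto_ident_at)
  obtain d where d: "d > 0" "\<And>\<theta>. \<bar>\<theta> - \<theta>0\<bar> < d \<Longrightarrow> \<bar>cos \<theta> - m0\<bar> < \<rho>"
    using isCont_cos[of \<theta>0] \<rho>(1) unfolding m0 continuous_at_eps_delta dist_real_def by blast
  \<comment> \<open>The size of the box \<open>U\<close> keeps \<open>cos \<theta>\<close> within \<open>\<rho>\<close> of \<open>m0\<close>, where the root of \<open>\<Gamma>\<close> is unique, and keeps
    \<open>\<bar>p\<bar>\<close> below \<open>\<bar>\<alpha> s\<bar> / 4\<close>, which excludes the second root of the quadratic.\<close>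
  define r where "r = min d (min 1 (\<bar>\<alpha> \<nu>0 * s \<nu>0\<bar> / 8))"
  have r: "0 < r" "r \<le> d" "r \<le> pi" "8 * r \<le> \<bar>\<alpha> \<nu>0 * s \<nu>0\<bar>"
    using d(1) base_signs pi_gt3 by (auto simp: r_def abs_mult)
  define U where "U = {\<theta>0 - r <..< \<theta>0 + r} \<times> ({- r <..< r} \<times> {q0 - r <..< q0 + r})"
  have U_iff: "(\<theta>, p, q) \<in> U \<longleftrightarrow> \<bar>\<theta> - \<theta>0\<bar> < r \<and> \<bar>p\<bar> < r \<and> \<bar>q - q0\<bar> < r" for \<theta> p q
    unfolding U_def by (auto simp: abs_less_iff)
  define m1 where "m1 \<nu> = (SOME m. \<bar>m\<bar> < 1 \<and> \<bar>m - m0\<bar> < \<rho> \<and> Gamma_tilde (P \<nu>) m = 0)" for \<nu>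
  have G_lim: "(G \<longlongrightarrow> 0) (nhds \<nu>0)"
    using isCont_tendsto_compose[OF DERIV_isCont[OF G_has_derivative] idn] by (simp add: G_base)
  have quot: "((\<lambda>\<nu>. G \<nu> / (\<nu> - \<nu>0)) \<longlongrightarrow> deriv G \<nu>0) (at \<nu>0)"
    using G_has_derivative by (simp add: has_field_derivative_iff G_base)
  have "((\<lambda>\<nu>. sg * (m0 * \<gamma> * (G \<nu> / (\<nu> - \<nu>0)))) \<longlongrightarrow> sg * (m0 * \<gamma> * deriv G \<nu>0)) (at \<nu>0)"
    by (intro tendsto_intros quot)
  then have "\<forall>\<^sub>F \<nu> in at \<nu>0. 0 < sg * (m0 * \<gamma> * (G \<nu> / (\<nu> - \<nu>0)))"
    by (rule order_tendstoD) (use G' m0_nz \<gamma>(2) in \<open>simp add: sgabs\<close>)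
  then have E1: "\<forall>\<^sub>F \<nu> in nhds \<nu>0. \<nu> \<noteq> \<nu>0 \<longrightarrow> 0 < sg * (m0 * \<gamma> * (G \<nu> / (\<nu> - \<nu>0)))"
    by (simp add: eventually_at_filter)
  have "((\<lambda>\<nu>. \<bar>m0 * \<gamma> * G \<nu>\<bar>) \<longlongrightarrow> \<bar>m0 * \<gamma> * 0\<bar>) (nhds \<nu>0)"
    by (intro tendsto_intros G_lim)
  then have E2: "\<forall>\<^sub>F \<nu> in nhds \<nu>0. \<bar>m0 * \<gamma> * G \<nu>\<bar> < \<rho> / 2 * (\<gamma>\<^sup>2 / 2)"
    by (rule order_tendstoD) (use \<rho>(1) \<gamma>(2) in simp)
  have "((\<lambda>\<nu>. \<bar>Re (W \<nu>)\<bar>) \<longlongrightarrow> \<bar>Re (Complex 0 q0)\<bar>) (nhds \<nu>0)"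
    "((\<lambda>\<nu>. \<bar>Im (W \<nu>) - q0\<bar>) \<longlongrightarrow> \<bar>Im (Complex 0 q0) - q0\<bar>) (nhds \<nu>0)"
    by (intro tendsto_intros W_tendsto idn)+
  then have E3: "\<forall>\<^sub>F \<nu> in nhds \<nu>0. \<bar>Re (W \<nu>)\<bar> < r" and E4: "\<forall>\<^sub>F \<nu> in nhds \<nu>0. \<bar>Im (W \<nu>) - q0\<bar> < r"
    using r(1) by (auto elim: order_tendstoD)
  have "((\<lambda>\<nu>. \<bar>\<alpha> \<nu> * s \<nu>\<bar>) \<longlongrightarrow> \<bar>\<alpha> \<nu>0 * s \<nu>0\<bar>) (nhds \<nu>0)"
    by (intro tendsto_intros params_tendsto idn)
  then have E5: "\<forall>\<^sub>F \<nu> in nhds \<nu>0. 4 * r < \<bar>\<alpha> \<nu> * s \<nu>\<bar>"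
    by (rule order_tendstoD) (use r in linarith)
  define good where "good \<nu> \<longleftrightarrow> \<bar>\<nu> - \<nu>0\<bar> < e0 \<and> (\<nu> \<noteq> \<nu>0 \<longrightarrow> 0 < sg * (m0 * \<gamma> * (G \<nu> / (\<nu> - \<nu>0)))) \<and>
    \<bar>m0 * \<gamma> * G \<nu>\<bar> < \<rho> / 2 * (\<gamma>\<^sup>2 / 2) \<and> \<bar>Re (W \<nu>)\<bar> < r \<and> \<bar>Im (W \<nu>) - q0\<bar> < r \<and> 4 * r < \<bar>\<alpha> \<nu> * s \<nu>\<bar>" for \<nu>
  have good_ev: "\<forall>\<^sub>F \<nu> in nhds \<nu>0. good \<nu>"
    unfolding good_def by (intro eventually_conj E1 E2 E3 E4 E5 eventually_near[OF idn e0(1)])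
  have G_pos: "0 < m0 * \<gamma> * G \<nu>" if "good \<nu>" "0 < sg * (\<nu> - \<nu>0)" for \<nu>
  proof -
    have ne: "\<nu> \<noteq> \<nu>0" using that(2) by auto
    then have "0 < sg * (m0 * \<gamma> * (G \<nu> / (\<nu> - \<nu>0)))" using that(1) unfolding good_def by blast
    with that(2) have "0 < (sg * (\<nu> - \<nu>0)) * (sg * (m0 * \<gamma> * (G \<nu> / (\<nu> - \<nu>0))))" by (rule mult_pos_pos)
    also have "\<dots> = m0 * \<gamma> * G \<nu>" using sg' ne by auto
    finally show ?thesis .
  qed
  have G_nonpos: "m0 * \<gamma> * G \<nu> \<le> 0" if "good \<nu>" "sg * (\<nu> - \<nu>0) \<le> 0" for \<nu>
  proof (cases "\<nu> = \<nu>0")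
    case False
    then have "0 < sg * (m0 * \<gamma> * (G \<nu> / (\<nu> - \<nu>0)))" using that(1) unfolding good_def by blast
    then have "(sg * (\<nu> - \<nu>0)) * (sg * (m0 * \<gamma> * (G \<nu> / (\<nu> - \<nu>0)))) \<le> 0"
      by (intro mult_nonpos_nonneg[OF that(2)] less_imp_le)
    also have "(sg * (\<nu> - \<nu>0)) * (sg * (m0 * \<gamma> * (G \<nu> / (\<nu> - \<nu>0)))) = m0 * \<gamma> * G \<nu>" using sg' False by auto
    finally show ?thesis .
  qed (simp add: G_base)
  have no_root: False if "good \<nu>" "sg * (\<nu> - \<nu>0) \<le> 0" "\<bar>m\<bar> < 1" "\<bar>m - m0\<bar> < \<rho>" "Gamma_tilde (P \<nu>) m = 0" for \<nu> m
  proof -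
    have \<nu>: "\<bar>\<nu> - \<nu>0\<bar> < e0" using that(1) by (simp add: good_def)
    have "- G \<nu> = (m - m0) * Gamma_slope (P \<nu>) m m0"
      using Gamma_tilde_diff[OF admP _ m0_le, of \<nu> m] \<nu> e0(2) that(3,5) by (simp add: G_def)
    then have "m0 * \<gamma> * G \<nu> = m0 * (m0 - m) * (\<gamma> * Gamma_slope (P \<nu>) m m0)"
      by (metis (no_types, opaque_lifting) minus_diff_eq minus_minus mult.assoc mult.left_commute mult_minus_left)
    also have "\<dots> > 0"
    proof (rule mult_pos_pos)
      show "0 < m0 * (m0 - m)" using that(3) m0_cases by auto
      show "0 < \<gamma> * Gamma_slope (P \<nu>) m m0"
        by (rule order.strict_trans[OF \<gamma>2 slope[OF \<nu> that(4)]]) (use \<rho>(1) in simp)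
    qed
    finally show False using G_nonpos[OF that(1,2)] by simp
  qed
  have root: "\<exists>m. \<bar>m\<bar> < 1 \<and> \<bar>m - m0\<bar> < \<rho> \<and> Gamma_tilde (P \<nu>) m = 0" if "good \<nu>" "0 < sg * (\<nu> - \<nu>0)" for \<nu>
  proof -
    have \<nu>: "\<bar>\<nu> - \<nu>0\<bar> < e0" "\<bar>\<nu> - \<nu>0\<bar> < \<delta>" using that(1) e0(2) by (auto simp: good_def)
    \<comment> \<open>The intermediate value theorem on the inward segment from \<open>m0\<close> to \<open>m0 (1 - \<rho> / 2)\<close>.\<close>
    define f where "f t = m0 * \<gamma> * Gamma_tilde (P \<nu>) (m0 * (1 - t))" for t
    have bd: "\<bar>m0 * (1 - t)\<bar> \<le> 1" if "t \<in> {0..\<rho>/2}" for t using that m0_cases \<rho> by auto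
    have "continuous_on {0..\<rho>/2} f"
    proof (intro continuous_at_imp_continuous_on ballI)
      fix t assume "t \<in> {0..\<rho>/2}"
      from DERIV_isCont[OF Gamma_tilde_has_derivative[OF admP[OF \<nu>(2)] bd[OF this]]]
      show "isCont f t" unfolding f_def by (intro continuous_intros isCont_o2[of t "\<lambda>t. m0 * (1 - t)"]) auto
    qed
    moreover have f0: "f 0 > 0" using G_pos[OF that] by (simp add: f_def G_def)
    moreover have "f (\<rho>/2) \<le> 0"
    proof -
      define n where "n = m0 * (1 - \<rho>/2)"
      have n: "\<bar>n - m0\<bar> < \<rho>" "\<bar>n\<bar> \<le> 1" "n - m0 = - m0 * (\<rho>/2)"
        using m0_cases \<rho> by (auto simp: n_def algebra_simps)
      have "Gamma_tilde (P \<nu>) n = G \<nu> + (n - m0) * Gamma_slope (P \<nu>) n m0"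
        using Gamma_tilde_diff[OF admP[OF \<nu>(2)] n(2) m0_le] by (simp add: G_def)
      moreover have "f (\<rho>/2) = m0 * \<gamma> * Gamma_tilde (P \<nu>) n" by (simp add: f_def n_def)
      ultimately have "f (\<rho>/2) = m0 * \<gamma> * (G \<nu> + - m0 * (\<rho>/2) * Gamma_slope (P \<nu>) n m0)"
        unfolding n(3) by simp
      also have "\<dots> = m0 * \<gamma> * G \<nu> - (m0 * m0) * (\<rho>/2) * (\<gamma> * Gamma_slope (P \<nu>) n m0)"
        by (simp add: algebra_simps)
      also have "\<dots> \<le> \<rho> / 2 * (\<gamma>\<^sup>2 / 2) - 1 * (\<rho>/2) * (\<gamma>\<^sup>2 / 2)"
      proof -
        have "\<rho>/2 * (\<gamma>\<^sup>2 / 2) \<le> \<rho>/2 * (\<gamma> * Gamma_slope (P \<nu>) n m0)"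
          using slope[OF \<nu>(1) n(1), of m0] \<rho>(1) by (intro mult_left_mono) auto
        moreover have "m0 * \<gamma> * G \<nu> \<le> \<rho> / 2 * (\<gamma>\<^sup>2 / 2)" using that(1) unfolding good_def by linarith
        ultimately show ?thesis unfolding m0_sq by simp
      qed
      finally show ?thesis by simp
    qed
    ultimately obtain t where t: "0 \<le> t" "t \<le> \<rho>/2" "f t = 0"
      using IVT2'[of f "\<rho>/2" 0 0] \<rho>(1) by auto
    have "t \<noteq> 0" using t(3) f0 by auto
    then show ?thesis
      using t \<rho> m0_cases m0_nz \<gamma>(2) unfolding f_def by (intro exI[of _ "m0 * (1 - t)"]) auto
  qed
  have m1: "\<bar>m1 \<nu>\<bar> < 1" "\<bar>m1 \<nu> - m0\<bar> < \<rho>" "Gamma_tilde (P \<nu>) (m1 \<nu>) = 0"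
    if "good \<nu>" "0 < sg * (\<nu> - \<nu>0)" for \<nu>
    using someI_ex[OF root[OF that]] unfolding m1_def by auto
  have goodF: "\<forall>\<^sub>F \<nu> in F. good \<nu> \<and> 0 < sg * (\<nu> - \<nu>0)"
    using good_ev unfolding F_def eventually_at_filter by (rule eventually_mono) auto
  have G_F: "(G \<longlongrightarrow> 0) F" unfolding F_def using G_lim tendsto_mono[OF at_within_le_nhds] by blast
  have rel: "(m0 - m1 \<nu>) * Gamma_slope (P \<nu>) (m1 \<nu>) m0 = G \<nu>" "\<gamma>\<^sup>2 / 2 < \<gamma> * Gamma_slope (P \<nu>) (m1 \<nu>) m0"
    if "good \<nu>" "0 < sg * (\<nu> - \<nu>0)" for \<nu>
  proof -
    have \<nu>: "\<bar>\<nu> - \<nu>0\<bar> < e0" using that(1) by (simp add: good_def)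
    show "(m0 - m1 \<nu>) * Gamma_slope (P \<nu>) (m1 \<nu>) m0 = G \<nu>"
      using Gamma_tilde_diff[OF admP _ m0_le, of \<nu> "m1 \<nu>"] \<nu> e0(2) m1[OF that] by (simp add: G_def algebra_simps)
    show "\<gamma>\<^sup>2 / 2 < \<gamma> * Gamma_slope (P \<nu>) (m1 \<nu>) m0"
      using slope[OF \<nu> m1(2)[OF that], of m0] \<rho>(1) by simp
  qed
  have "((\<lambda>\<nu>. m1 \<nu> - m0) \<longlongrightarrow> 0) F"
  proof (rule Lim_null_comparison)
    show "((\<lambda>\<nu>. \<bar>G \<nu>\<bar> * (2 / \<bar>\<gamma>\<bar>)) \<longlongrightarrow> 0) F"
      by (rule tendsto_mult_left_zero[OF tendsto_rabs_zero[OF G_F]])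
    show "\<forall>\<^sub>F \<nu> in F. norm (m1 \<nu> - m0) \<le> \<bar>G \<nu>\<bar> * (2 / \<bar>\<gamma>\<bar>)"
      using goodF
    proof eventually_elim
      case (elim \<nu>)
      let ?S = "Gamma_slope (P \<nu>) (m1 \<nu>) m0"
      have "\<bar>\<gamma>\<bar> * \<bar>\<gamma>\<bar> / 2 < \<bar>\<gamma>\<bar> * \<bar>?S\<bar>"
        using rel(2)[of \<nu>] elim abs_ge_self[of "\<gamma> * ?S"] by (simp add: abs_mult power2_eq_square)
      then have "\<bar>\<gamma>\<bar> * (\<bar>\<gamma>\<bar> / 2) < \<bar>\<gamma>\<bar> * \<bar>?S\<bar>" by simp
      from mult_left_less_imp_less[OF this abs_ge_zero] have S: "\<bar>\<gamma>\<bar> / 2 \<le> \<bar>?S\<bar>" by (rule less_imp_le)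
      have "\<bar>m1 \<nu> - m0\<bar> * (\<bar>\<gamma>\<bar> / 2) \<le> \<bar>m1 \<nu> - m0\<bar> * \<bar>?S\<bar>" using S by (intro mult_left_mono) auto
      also have "\<dots> = \<bar>G \<nu>\<bar>" using rel(1)[of \<nu>] elim by (metis abs_minus_commute abs_mult)
      finally show ?case using \<gamma>(2) by (simp add: field_simps)
    qed
  qed
  then have m1_lim: "(m1 \<longlongrightarrow> m0) F" by (rule LIM_zero_cancel)
  have rootF: "\<forall>\<^sub>F \<nu> in F. \<bar>m1 \<nu>\<bar> < 1 \<and> Gamma_tilde (P \<nu>) (m1 \<nu>) = 0"
    using goodF by eventually_elim (use m1 in auto)
  have ratio: "((\<lambda>\<nu>. m0 * (m0 - m1 \<nu>) / (sg * (\<nu> - \<nu>0))) \<longlongrightarrow> \<bar>deriv G \<nu>0 / \<gamma>\<bar>) F"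
  proof -
    have q: "((\<lambda>\<nu>. G \<nu> / (\<nu> - \<nu>0)) \<longlongrightarrow> deriv G \<nu>0) F"
      unfolding F_def by (rule tendsto_within_subset[OF quot]) simp
    have L: "((\<lambda>\<nu>. m0 * sg * (G \<nu> / (\<nu> - \<nu>0)) / Gamma_slope (P \<nu>) (m1 \<nu>) m0) \<longlongrightarrow> m0 * sg * deriv G \<nu>0 / \<gamma>) F"
      by (intro tendsto_intros q slope_tendsto idF m1_lim \<gamma>(2))
    have eq: "m0 * sg * deriv G \<nu>0 / \<gamma> = \<bar>deriv G \<nu>0 / \<gamma>\<bar>"
    proof -
      have "m0 * sg * deriv G \<nu>0 / \<gamma> = sg * (m0 * \<gamma> * deriv G \<nu>0) / \<gamma>\<^sup>2"
        using \<gamma>(2) by (simp add: field_simps power2_eq_square)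
      also have "\<dots> = \<bar>m0\<bar> * \<bar>\<gamma>\<bar> * \<bar>deriv G \<nu>0\<bar> / (\<bar>\<gamma>\<bar> * \<bar>\<gamma>\<bar>)"
        unfolding sgabs by (simp add: abs_mult power2_eq_square)
      also have "\<dots> = \<bar>deriv G \<nu>0 / \<gamma>\<bar>"
      proof -
        have "\<bar>m0\<bar> = 1" using m0_cases by auto
        then show ?thesis using \<gamma>(2) by (simp add: abs_divide del: abs_mult_self_eq)
      qed
      finally show ?thesis .
    qed
    have ev: "\<forall>\<^sub>F \<nu> in F. m0 * sg * (G \<nu> / (\<nu> - \<nu>0)) / Gamma_slope (P \<nu>) (m1 \<nu>) m0 = m0 * (m0 - m1 \<nu>) / (sg * (\<nu> - \<nu>0))"
      using goodF
    proof eventually_elim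
      case (elim \<nu>)
      have "Gamma_slope (P \<nu>) (m1 \<nu>) m0 \<noteq> 0" using rel(2)[of \<nu>] elim \<gamma>2 by auto
      then have "m0 - m1 \<nu> = G \<nu> / Gamma_slope (P \<nu>) (m1 \<nu>) m0" using rel(1)[of \<nu>] elim by (simp add: field_simps)
      moreover have "inverse sg = sg" using sg' by auto
      ultimately show ?case by (simp only: divide_inverse inverse_mult_distrib mult_ac)
    qed
    show ?thesis using Lim_transform_eventually[OF L ev] unfolding eq .
  qed
  have m1_Icc: "\<forall>\<^sub>F \<nu> in F. m0 * m1 \<nu> \<in> {-1..1}"
    using rootF by eventually_elim (use m0_cases in auto)
  have "((\<lambda>\<nu>. m0 * m1 \<nu>) \<longlongrightarrow> m0 * m0) F" by (intro tendsto_intros m1_lim)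
  from continuous_on_tendsto_compose[OF continuous_on_arccos' this _ m1_Icc]
  have "((\<lambda>\<nu>. arccos (m0 * m1 \<nu>)) \<longlongrightarrow> arccos (m0 * m0)) F" by (simp add: m0_sq)
  then have "\<forall>\<^sub>F \<nu> in F. arccos (m0 * m1 \<nu>) < r"
    by (rule order_tendstoD) (use r(1) in \<open>simp add: m0_sq\<close>)
  moreover have "((\<lambda>\<nu>. \<bar>q_eq (P \<nu>) (m1 \<nu>) - q0\<bar>) \<longlongrightarrow> \<bar>q0 - q0\<bar>) F"
    by (intro tendsto_intros q_eq_tendsto idF m1_lim)
  then have "\<forall>\<^sub>F \<nu> in F. \<bar>q_eq (P \<nu>) (m1 \<nu>) - q0\<bar> < r"
    by (rule order_tendstoD) (use r(1) in simp)
  ultimately have "\<forall>\<^sub>F \<nu> in F. arccos (m0 * m1 \<nu>) < r \<and> \<bar>q_eq (P \<nu>) (m1 \<nu>) - q0\<bar> < r"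
    by (rule eventually_conj)
  then have "\<forall>\<^sub>F \<nu> in nhds \<nu>0. 0 < sg * (\<nu> - \<nu>0) \<longrightarrow> arccos (m0 * m1 \<nu>) < r \<and> \<bar>q_eq (P \<nu>) (m1 \<nu>) - q0\<bar> < r"
    unfolding F_def eventually_at_filter by (auto elim: eventually_mono)
  from eventually_conj[OF good_ev this] obtain e where e: "e > 0"
    and near: "\<And>\<nu>. \<bar>\<nu> - \<nu>0\<bar> < e \<Longrightarrow> good \<nu> \<and>
      (0 < sg * (\<nu> - \<nu>0) \<longrightarrow> arccos (m0 * m1 \<nu>) < r \<and> \<bar>q_eq (P \<nu>) (m1 \<nu>) - q0\<bar> < r)"
    unfolding eventually_nhds_metric dist_real_def by blast
  have trivial: "plane_eq \<nu> \<in> U" "coh_field (P \<nu>) (plane_eq \<nu>) = 0"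
    if "good \<nu>" for \<nu>
    using that r(1) riccati_W unfolding U_iff good_def coh_field_eq_0_iff sin_\<theta>0 m0[symmetric] by auto
  have cases: "x = plane_eq \<nu> \<or> (\<exists>m \<sigma>. \<sigma> \<in> {-1, 1} \<and> \<bar>m\<bar> < 1 \<and> \<bar>m - m0\<bar> < \<rho> \<and>
      Gamma_tilde (P \<nu>) m = 0 \<and> x = (\<theta>0 + \<sigma> * arccos (m0 * m), 0, q_eq (P \<nu>) m))"
    if \<nu>: "good \<nu>" and x: "x \<in> U" "coh_field (P \<nu>) x = 0" for \<nu> x
  proof -
    obtain \<theta> p q where xe: "x = (\<theta>, p, q)" by (metis prod_cases3)
    have xr: "\<bar>\<theta> - \<theta>0\<bar> < r" "\<bar>p\<bar> < r" using x(1) unfolding xe U_iff by auto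
    have "\<bar>\<nu> - \<nu>0\<bar> < \<delta>" "4 * r \<le> \<bar>\<alpha> \<nu> * s \<nu>\<bar>" "\<bar>Re (W \<nu>)\<bar> < r" using \<nu> e0(2) unfolding good_def by auto
    from zero_cases[OF this(1,2) r(3) this(3) xr x(2)[unfolded xe]]
    consider "x = plane_eq \<nu>" | "p = 0" "q = q_eq (P \<nu>) (cos \<theta>)" "Gamma_tilde (P \<nu>) (cos \<theta>) = 0"
      "\<bar>cos \<theta>\<bar> < 1" "\<bar>\<theta> - \<theta>0\<bar> = arccos (m0 * cos \<theta>)" unfolding xe by blast
    then show ?thesis
    proof cases
      case 2
      have "\<bar>cos \<theta> - m0\<bar> < \<rho>" using d(2) xr(1) r(2) by simp
      moreover have "\<exists>\<sigma>\<in>{-1, 1}. \<theta> = \<theta>0 + \<sigma> * arccos (m0 * cos \<theta>)"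
        unfolding 2(5)[symmetric] by (cases "\<theta> \<ge> \<theta>0") auto
      ultimately show ?thesis using 2(1-4) unfolding xe by blast
    qed simp
  qed
  show thesis
  proof (rule that[of "min e e0" U m1])
    show "0 < min e e0" "min e e0 \<le> \<delta>" using e e0 by auto
    show "open U" unfolding U_def by (intro open_Times) auto
    show "(\<theta>0, 0, q0) \<in> U" unfolding U_iff using r(1) by simp
    show "(m1 \<longlongrightarrow> m0) F" by (rule m1_lim)
    show "\<forall>\<^sub>F \<nu> in F. \<bar>m1 \<nu>\<bar> < 1 \<and> Gamma_tilde (P \<nu>) (m1 \<nu>) = 0" by (rule rootF)
    show "((\<lambda>\<nu>. m0 * (m0 - m1 \<nu>) / (sg * (\<nu> - \<nu>0))) \<longlongrightarrow> \<bar>deriv G \<nu>0 / \<gamma>\<bar>) F" by (rule ratio)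
    fix \<nu> assume "\<bar>\<nu> - \<nu>0\<bar> < min e e0"
    then have n: "good \<nu>" "0 < sg * (\<nu> - \<nu>0) \<Longrightarrow> arccos (m0 * m1 \<nu>) < r \<and> \<bar>q_eq (P \<nu>) (m1 \<nu>) - q0\<bar> < r"
      and \<nu>: "\<bar>\<nu> - \<nu>0\<bar> < e0" "\<bar>\<nu> - \<nu>0\<bar> < \<delta>"
      using near e0(2) by auto
    show "{x \<in> U. coh_field (P \<nu>) x = 0} = {plane_eq \<nu>}" if "sg * (\<nu> - \<nu>0) \<le> 0"
      using trivial[OF n(1)] cases[OF n(1)] no_root[OF n(1) that] by blast
    show "\<bar>m1 \<nu>\<bar> < 1 \<and>
      {x \<in> U. coh_field (P \<nu>) x = 0} = {plane_eq \<nu>,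
        (\<theta>0 + arccos (m0 * m1 \<nu>), 0, q_eq (P \<nu>) (m1 \<nu>)),
        (\<theta>0 - arccos (m0 * m1 \<nu>), 0, q_eq (P \<nu>) (m1 \<nu>))}" (is "_ \<and> ?L = ?R") if pos: "0 < sg * (\<nu> - \<nu>0)"
    proof
      note m = m1[OF n(1) pos]
      show "\<bar>m1 \<nu>\<bar> < 1" by (rule m)
      have b: "-1 < m0 * m1 \<nu>" "m0 * m1 \<nu> < 1" using m(1) m0_cases by auto
      note ab = arccos_lt_bounded[OF b]
      have "x \<in> ?R" if "x \<in> ?L" for x
      proof -
        from cases[OF n(1)] that consider "x = plane_eq \<nu>"
          | m \<sigma> where "\<sigma> \<in> {-1, 1}" "\<bar>m\<bar> < 1" "\<bar>m - m0\<bar> < \<rho>" "Gamma_tilde (P \<nu>) m = 0"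
            "x = (\<theta>0 + \<sigma> * arccos (m0 * m), 0, q_eq (P \<nu>) m)" by blast
        then show ?thesis
        proof cases
          case (2 m' \<sigma>)
          have "m' = m1 \<nu>" by (rule root_unique[OF \<nu>(1) 2(3) m(2) _ _ 2(4) m(3)]) (use 2(2) m(1) in auto)
          then show ?thesis using 2(1,5) by auto
        qed simp
      qed
      moreover have "side_eq \<sigma> (m1 \<nu>) \<nu> \<in> ?L" if "\<sigma> \<in> {-1, 1}" for \<sigma> :: real
      proof -
        have "cos (\<theta>0 + \<sigma> * arccos (m0 * m1 \<nu>)) = m1 \<nu>"
          using that b sin_\<theta>0 m0[symmetric] m0_sq by (auto simp: cos_add mult.assoc[symmetric])
        then have "coh_field (P \<nu>) (side_eq \<sigma> (m1 \<nu>) \<nu>) = 0"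
          using riccati_imaginary(2)[OF admP[OF \<nu>(2)], of "m1 \<nu>"] m(3) unfolding coh_field_eq_0_iff by simp
        moreover have "side_eq \<sigma> (m1 \<nu>) \<nu> \<in> U"
          unfolding U_iff using that n(2)[OF pos] ab r(1) by auto
        ultimately show ?thesis by simp
      qed
      from this[of 1] this[of "-1"] have "(\<theta>0 + arccos (m0 * m1 \<nu>), 0, q_eq (P \<nu>) (m1 \<nu>)) \<in> ?L"
        "(\<theta>0 - arccos (m0 * m1 \<nu>), 0, q_eq (P \<nu>) (m1 \<nu>)) \<in> ?L" by simp_all
      moreover have "plane_eq \<nu> \<in> ?L" using trivial[OF n(1)] by simp
      ultimately show "?L = ?R" by blast
    qed
  qed
qed

section \<open>The pitchfork bifurcation\<close>

text \<open>
  By \<open>riccati_secant\<close>, \<open>W\<close> differs from a purely imaginary number by \<open>- \<Gamma>(m0)\<close> over a quantity that tends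
  to \<open>b0\<close>.  Since \<open>\<Gamma>(m0)\<close> vanishes at \<open>\<nu>0\<close>, no derivative of the denominator enters.
\<close>

lemma Re_W_has_derivative:
  "((\<lambda>\<nu>. Re (W \<nu>)) has_real_derivative - (deriv G \<nu>0) * (\<alpha> \<nu>0 * s \<nu>0) / (norm b0)\<^sup>2) (at \<nu>0)"
proof -
  define w1 where "w1 \<nu> = Complex 0 (q_eq (P \<nu>) m0)" for \<nu>
  define D where "D \<nu> = of_real m0 * (W \<nu> + w1 \<nu>) + a \<nu>" for \<nu>
  have id: "((\<lambda>\<nu>. \<nu>) \<longlongrightarrow> \<nu>0) (at \<nu>0)" by (rule tendsto_ident_at)
  have "(D \<longlongrightarrow> of_real m0 * (Complex 0 q0 + Complex 0 q0) + a \<nu>0) (at \<nu>0)"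
    unfolding D_def w1_def
    by (intro tendsto_intros tendsto_Complex W_tendsto q_eq_tendsto a_tendsto id)
  then have D: "(D \<longlongrightarrow> b0) (at \<nu>0)" by (simp add: b0_def algebra_simps)
  have "((\<lambda>\<nu>. G \<nu> / (\<nu> - \<nu>0)) \<longlongrightarrow> deriv G \<nu>0) (at \<nu>0)"
    using G_has_derivative by (simp add: has_field_derivative_iff G_base)
  then have "((\<lambda>\<nu>. Re (- of_real (G \<nu> / (\<nu> - \<nu>0)) / D \<nu>)) \<longlongrightarrow> Re (- of_real (deriv G \<nu>0) / b0)) (at \<nu>0)"
    by (intro tendsto_intros D b0_nz)
  moreover have "\<forall>\<^sub>F \<nu> in at \<nu>0. Re (- of_real (G \<nu> / (\<nu> - \<nu>0)) / D \<nu>) = (Re (W \<nu>) - Re (W \<nu>0)) / (\<nu> - \<nu>0)"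
    using tendsto_imp_eventually_ne[OF D b0_nz] eventually_near[OF id \<delta>]
  proof eventually_elim
    case (elim \<nu>)
    have "1 + c \<nu> * m0 \<noteq> 0" using param_signs(4)[OF elim(2) m0_le] by simp
    from riccati_secant[OF P_def this this, of "w1 \<nu>" "W \<nu>"]
    have "- of_real (G \<nu>) = (W \<nu> - w1 \<nu>) * D \<nu>"
      using riccati_imaginary(1)[OF admP[OF elim(2)], of m0] riccati_W
      by (simp add: w1_def D_def a_def G_def)
    then have "- of_real (G \<nu>) / D \<nu> = W \<nu> - w1 \<nu>" using elim(1) by simp
    then have "Re (W \<nu>) = Re (- of_real (G \<nu>) / D \<nu>)" by (simp add: w1_def)
    moreover have "- of_real (G \<nu> / (\<nu> - \<nu>0)) / D \<nu> = (- of_real (G \<nu>) / D \<nu>) / of_real (\<nu> - \<nu>0)"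
      by (simp add: divide_simps)
    ultimately show ?case by (simp only: Re_divide_of_real W_base complex.sel diff_0_right)
  qed
  ultimately have "((\<lambda>\<nu>. (Re (W \<nu>) - Re (W \<nu>0)) / (\<nu> - \<nu>0)) \<longlongrightarrow> Re (- of_real (deriv G \<nu>0) / b0)) (at \<nu>0)"
    by (rule Lim_transform_eventually)
  moreover have "Re (- of_real (deriv G \<nu>0) / b0) = - (deriv G \<nu>0) * (\<alpha> \<nu>0 * s \<nu>0) / (norm b0)\<^sup>2"
    by (simp add: Re_divide Re_b0 cmod_power2)
  ultimately show ?thesis by (simp add: has_field_derivative_iff)
qed

text \<open>
  In the direction of \<open>\<theta>\<close> the rate comes from \<open>arccos x \<approx> sqrt (2 (1 - x))\<close>.  The other two components are
  of the order of \<open>m0 - m1\<close>, hence linear in \<open>\<nu> - \<nu>0\<close>, and disappear after division by the square root.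
\<close>

lemma branch_root_rate:
  fixes sg :: real
  defines "F \<equiv> at \<nu>0 within {\<nu>. sg * (\<nu> - \<nu>0) > 0}"
  assumes m1: "(m1 \<longlongrightarrow> m0) F"
    and root: "\<forall>\<^sub>F \<nu> in F. \<bar>m1 \<nu>\<bar> < 1 \<and> Gamma_tilde (P \<nu>) (m1 \<nu>) = 0"
    and ratio: "((\<lambda>\<nu>. m0 * (m0 - m1 \<nu>) / (sg * (\<nu> - \<nu>0))) \<longlongrightarrow> C) F"
  shows "((\<lambda>\<nu>. ((\<theta>0 + arccos (m0 * m1 \<nu>), 0, q_eq (P \<nu>) (m1 \<nu>)) - (plane_eq \<nu>))
      /\<^sub>R sqrt (sg * (\<nu> - \<nu>0))) \<longlongrightarrow> (sqrt (2 * C), 0, 0)) F"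
proof -
  have id: "((\<lambda>\<nu>. \<nu>) \<longlongrightarrow> \<nu>0) F" unfolding F_def by (rule tendsto_ident_at)
  have pos: "\<forall>\<^sub>F \<nu> in F. 0 < sg * (\<nu> - \<nu>0)" unfolding F_def by (simp add: eventually_at_filter)
  have "((\<lambda>\<nu>. m0 * m1 \<nu>) \<longlongrightarrow> m0 * m0) F" by (intro tendsto_intros m1)
  then have "filterlim (\<lambda>\<nu>. m0 * m1 \<nu>) (at_left 1) F"
    unfolding filterlim_at m0_sq using m0_cases by (auto intro!: eventually_mono[OF root])
  from filterlim_compose[OF arccos_near_1 this]
  have "((\<lambda>\<nu>. arccos (m0 * m1 \<nu>) / sqrt (2 * (1 - m0 * m1 \<nu>))
      * sqrt (2 * (m0 * (m0 - m1 \<nu>) / (sg * (\<nu> - \<nu>0))))) \<longlongrightarrow> 1 * sqrt (2 * C)) F"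
    by (intro tendsto_intros ratio)
  moreover have "\<forall>\<^sub>F \<nu> in F. arccos (m0 * m1 \<nu>) / sqrt (2 * (1 - m0 * m1 \<nu>))
      * sqrt (2 * (m0 * (m0 - m1 \<nu>) / (sg * (\<nu> - \<nu>0)))) = inverse (sqrt (sg * (\<nu> - \<nu>0))) * arccos (m0 * m1 \<nu>)"
    using root pos
  proof eventually_elim
    case (elim \<nu>)
    have e: "m0 * (m0 - m1 \<nu>) = 1 - m0 * m1 \<nu>" using m0_sq by (simp add: algebra_simps)
    have "0 < sqrt (2 * (1 - m0 * m1 \<nu>))" using elim(1) m0_cases by auto
    moreover have "sqrt (2 * ((1 - m0 * m1 \<nu>) / (sg * (\<nu> - \<nu>0)))) = sqrt (2 * (1 - m0 * m1 \<nu>)) / sqrt (sg * (\<nu> - \<nu>0))"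
      by (simp only: times_divide_eq_right real_sqrt_divide)
    ultimately show ?case unfolding e by (simp add: divide_inverse)
  qed
  ultimately have 1: "((\<lambda>\<nu>. inverse (sqrt (sg * (\<nu> - \<nu>0))) * arccos (m0 * m1 \<nu>)) \<longlongrightarrow> sqrt (2 * C)) F"
    using Lim_transform_eventually by fastforce
  \<comment> \<open>\<open>u\<close> is \<open>- (m0 - m1)\<close> over the square root, written with the convergent ratio as a factor.\<close>
  define u where "u \<nu> = - (m0 * (m0 - m1 \<nu>) / (sg * (\<nu> - \<nu>0)) * (m0 * sqrt (sg * (\<nu> - \<nu>0))))" for \<nu>
  have "(u \<longlongrightarrow> - (C * (m0 * sqrt (sg * (\<nu>0 - \<nu>0))))) F"
    unfolding u_def by (intro tendsto_intros ratio id)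
  then have u: "(u \<longlongrightarrow> 0) F" by simp
  have "\<forall>\<^sub>F \<nu> in F. of_real (u \<nu>) * chord m1 \<nu>
      = of_real (inverse (sqrt (sg * (\<nu> - \<nu>0)))) * (Complex 0 (q_eq (P \<nu>) (m1 \<nu>)) - W \<nu>)"
    using root pos
  proof eventually_elim
    case (elim \<nu>)
    have ne: "m0 - m1 \<nu> \<noteq> 0" using elim(1) m0_cases by auto
    define t where "t = sg * (\<nu> - \<nu>0)"
    have t: "t > 0" using elim(2) by (simp add: t_def)
    have "u \<nu> = - ((m0 * m0) * (m0 - m1 \<nu>) * (sqrt t / t))" unfolding u_def t_def[symmetric] by simp
    also have "\<dots> = inverse (sqrt t) * - (m0 - m1 \<nu>)"
      unfolding m0_sq using t by (simp add: field_simps real_sqrt_mult_self flip: real_sqrt_mult)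
    finally have "of_real (u \<nu>) * chord m1 \<nu>
        = of_real (inverse (sqrt t)) * - (of_real (m0 - m1 \<nu>) * chord m1 \<nu>)"
      by (simp only: of_real_mult of_real_minus mult.assoc mult_minus_left mult_minus_right)
    also have "of_real (m0 - m1 \<nu>) * chord m1 \<nu> = W \<nu> - Complex 0 (q_eq (P \<nu>) (m1 \<nu>))"
      unfolding chord_def using ne by (simp del: of_real_diff)
    finally show ?case unfolding t_def by simp
  qed
  moreover have "((\<lambda>\<nu>. of_real (u \<nu>) * chord m1 \<nu>) \<longlongrightarrow> of_real 0 * \<kappa>0) F"
    by (intro tendsto_intros u chord_tendsto id m1 root)
  ultimately have z: "((\<lambda>\<nu>. of_real (inverse (sqrt (sg * (\<nu> - \<nu>0)))) * (Complex 0 (q_eq (P \<nu>) (m1 \<nu>)) - W \<nu>)) \<longlongrightarrow> 0) F"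
    using Lim_transform_eventually by fastforce
  have 2: "((\<lambda>\<nu>. inverse (sqrt (sg * (\<nu> - \<nu>0))) * (0 - Re (W \<nu>))) \<longlongrightarrow> 0) F"
    "((\<lambda>\<nu>. inverse (sqrt (sg * (\<nu> - \<nu>0))) * (q_eq (P \<nu>) (m1 \<nu>) - Im (W \<nu>))) \<longlongrightarrow> 0) F"
    using tendsto_Re[OF z[folded scaleR_conv_of_real]] tendsto_Im[OF z[folded scaleR_conv_of_real]] by simp_all
  show ?thesis
    using tendsto_Pair[OF 1 tendsto_Pair[OF 2]] by (simp add: inverse_eq_divide)
qed

text \<open>
  The critical eigenvector points along \<open>\<theta>\<close>, for all \<open>\<nu>\<close>, and its eigenvalue is \<open>m0 Re W\<close>.
\<close>

lemma pitchfork: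
  assumes f: "\<And>\<nu>. \<bar>\<nu> - \<nu>0\<bar> < \<delta> \<Longrightarrow> f \<nu> = coh_field (P \<nu>)" and G': "deriv G \<nu>0 \<noteq> 0"
  shows "pitchfork_bifurcation flip_theta f \<nu>0 (\<theta>0, 0, q0)"
proof -
  define sg where "sg = sgn (m0 * \<gamma> * deriv G \<nu>0)"
  define F where "F = at \<nu>0 within {\<nu>. sg * (\<nu> - \<nu>0) > 0}"
  obtain e U m1 where e: "0 < e" "e \<le> \<delta>" and U: "open U" "(\<theta>0, 0, q0) \<in> U"
    and m1: "(m1 \<longlongrightarrow> m0) F" "\<forall>\<^sub>F \<nu> in F. \<bar>m1 \<nu>\<bar> < 1 \<and> Gamma_tilde (P \<nu>) (m1 \<nu>) = 0"
    and ratio: "((\<lambda>\<nu>. m0 * (m0 - m1 \<nu>) / (sg * (\<nu> - \<nu>0))) \<longlongrightarrow> \<bar>deriv G \<nu>0 / \<gamma>\<bar>) F"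
    and none: "\<And>\<nu>. \<bar>\<nu> - \<nu>0\<bar> < e \<Longrightarrow> sg * (\<nu> - \<nu>0) \<le> 0 \<Longrightarrow>
      {x \<in> U. coh_field (P \<nu>) x = 0} = {plane_eq \<nu>}"
    and pair: "\<And>\<nu>. \<bar>\<nu> - \<nu>0\<bar> < e \<Longrightarrow> sg * (\<nu> - \<nu>0) > 0 \<Longrightarrow> \<bar>m1 \<nu>\<bar> < 1 \<and>
      {x \<in> U. coh_field (P \<nu>) x = 0} = {plane_eq \<nu>,
        (\<theta>0 + arccos (m0 * m1 \<nu>), 0, q_eq (P \<nu>) (m1 \<nu>)),
        (\<theta>0 - arccos (m0 * m1 \<nu>), 0, q_eq (P \<nu>) (m1 \<nu>))}"
    by (rule branching[OF G' sg_def, folded F_def]) (rule that, assumption+)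
  obtain e' where e': "0 < e'" "W C1_differentiable_on {\<nu>0 - e' <..< \<nu>0 + e'}" using W_C1 by metis
  define d where "d = min e e'"
  have d: "0 < d" "d \<le> e" "d \<le> \<delta>" using e e'(1) by (auto simp: d_def)
  define xs where "xs \<nu> = plane_eq \<nu>" for \<nu>
  define y where "y \<nu> = (\<theta>0 + arccos (m0 * m1 \<nu>), 0 :: real, q_eq (P \<nu>) (m1 \<nu>))" for \<nu>
  define v where "v = (sqrt (2 * \<bar>deriv G \<nu>0 / \<gamma>\<bar>), 0 :: real, 0 :: real)"
  define A where "A \<nu> = (\<lambda>(x, y, z). (m0 * Re (W \<nu>) * x,
      - (\<alpha> \<nu> * s \<nu> + 2 * m0 * Re (W \<nu>)) * y + (s \<nu> + 2 * m0 * Im (W \<nu>)) * z,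
      - (s \<nu> + 2 * m0 * Im (W \<nu>)) * y - (\<alpha> \<nu> * s \<nu> + 2 * m0 * Re (W \<nu>)) * z))" for \<nu>
  define lam where "lam = \<alpha> \<nu>0 * s \<nu>0"
  define om where "om = s \<nu>0 + 2 * m0 * q0"
  have lam: "lam \<noteq> 0" using base_signs by (simp add: lam_def)
  have A0: "A \<nu>0 (x, y, z) = (0, - lam * y + om * z, - om * y - lam * z)" for x y z
    by (simp add: A_def W_base lam_def om_def)
  have v1: "sqrt (2 * \<bar>deriv G \<nu>0 / \<gamma>\<bar>) \<noteq> 0" using G' \<gamma>(2) by simp
  have sg': "sg \<in> {-1, 1}" using G' m0_nz \<gamma>(2) by (simp add: sg_def sgn_if)
  have C1xs: "xs C1_differentiable_on {\<nu>0 - d <..< \<nu>0 + d}"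
  proof -
    have "W C1_differentiable_on {\<nu>0 - d <..< \<nu>0 + d}"
      by (rule C1_differentiable_on_subset[OF e'(2)]) (auto simp: d_def)
    note W = this
    show ?thesis
      unfolding xs_def
      by (rule C1_differentiable_on_Pair[OF C1_differentiable_on_const C1_differentiable_on_Pair[OF
          C1_differentiable_on_bounded_linear[OF bounded_linear_Re W]
          C1_differentiable_on_bounded_linear[OF bounded_linear_Im W]]])
  qed
  have refl: "reflect_about flip_theta (\<theta>0, 0, q0) (\<theta>, p, q) = (2 * \<theta>0 - \<theta>, p, q)" for \<theta> p q
    by (rule reflect_flip)
  have ker: "{x. A \<nu>0 x = 0} = span {v}"
  proof -
    have "y = 0 \<and> z = 0" if "- lam * y + om * z = 0" "- om * y - lam * z = 0" for y z
      using no_oscillation[OF lam, of y om z 0 0 0] that by simp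
    then have "A \<nu>0 x = 0 \<longleftrightarrow> snd x = 0" for x
      by (cases x) (auto simp: A0 zero_prod_def)
    moreover have "(snd x = 0) = (x \<in> range (\<lambda>k. k *\<^sub>R v))" for x :: state
    proof -
      have "x = (fst x / sqrt (2 * \<bar>deriv G \<nu>0 / \<gamma>\<bar>)) *\<^sub>R v" if "snd x = 0"
        using that v1 by (cases x) (auto simp: v_def zero_prod_def)
      then have "x \<in> range (\<lambda>k. k *\<^sub>R v)" if "snd x = 0" using that by (metis rangeI)
      moreover have "snd x = 0" if "x \<in> range (\<lambda>k. k *\<^sub>R v)"
        using that by (auto simp: v_def zero_prod_def)
      ultimately show ?thesis by blast
    qed
    ultimately show ?thesis unfolding span_singleton by blast
  qed
  have osc: "x = 0 \<and> z = 0" if "\<omega> \<noteq> 0" "A \<nu>0 x = - (\<omega> *\<^sub>R z)" "A \<nu>0 z = \<omega> *\<^sub>R x" for x z \<omega>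
  proof -
    obtain x0 x1 x2 z0 z1 z2 where xz: "x = (x0, x1, x2)" "z = (z0, z1, z2)" by (metis prod_cases3)
    show ?thesis
      using that no_oscillation[OF lam, of x1 om x2 \<omega> z1 z2] unfolding xz A0 by (auto simp: zero_prod_def)
  qed
  have bnd: "0 < arccos (m0 * m1 \<nu>)" if "\<bar>\<nu> - \<nu>0\<bar> < d" "0 < sg * (\<nu> - \<nu>0)" for \<nu>
    using pair[of \<nu>] that d(2) m0_cases arccos_lt_bounded[of "m0 * m1 \<nu>"] by auto
  have flip: "\<forall>x. flip_theta (flip_theta x) = x" by auto
  show ?thesis
    unfolding pitchfork_bifurcation_def
  proof (rule conjI[OF linear_flip_theta], rule conjI[OF flip], rule exI[of _ d], rule conjI[OF d(1)], rule exI[of _ U], rule exI[of _ xs], rule exI[of _ y], rule exI[of _ A],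
      rule exI[of _ "\<lambda>\<nu>. m0 * Re (W \<nu>)"], rule exI[of _ "m0 * (- (deriv G \<nu>0) * (\<alpha> \<nu>0 * s \<nu>0) / (norm b0)\<^sup>2)"],
      rule exI[of _ "\<lambda>_. v"], rule exI[of _ v], rule exI[of _ sg], intro conjI allI impI; (elim conjE)?)
    fix \<nu> assume nu: "\<bar>\<nu> - \<nu>0\<bar> < d"
    then have nu': "\<bar>\<nu> - \<nu>0\<bar> < \<delta>" "\<bar>\<nu> - \<nu>0\<bar> < e" using d by auto
    show "f \<nu> (reflect_about flip_theta (\<theta>0, 0, q0) x) = flip_theta (f \<nu> x)" for x
      unfolding f[OF nu'(1)] by (rule coh_field_flip[OF \<theta>0])
    show "(f \<nu> has_derivative A \<nu>) (at (xs \<nu>))"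
      unfolding f[OF nu'(1)] xs_def A_def P_def
      by (rule coh_field_has_derivative[OF param_signs(2)[OF nu'(1)] sin_\<theta>0 m0])
    show "reflect_about flip_theta (\<theta>0, 0, q0) (xs \<nu>) = xs \<nu>"
      unfolding xs_def refl by simp
    show "A \<nu> v = (m0 * Re (W \<nu>)) *\<^sub>R v" by (simp add: A_def v_def)
    show "{x \<in> U. f \<nu> x = 0} = {xs \<nu>}" if "sg * (\<nu> - \<nu>0) \<le> 0"
      unfolding f[OF nu'(1)] xs_def by (rule none[OF nu'(2) that])
    assume pos: "0 < sg * (\<nu> - \<nu>0)"
    show "reflect_about flip_theta (\<theta>0, 0, q0) (y \<nu>) \<noteq> y \<nu>"
      unfolding y_def refl using bnd[OF nu pos] by simp
    show "{x \<in> U. f \<nu> x = 0} = {xs \<nu>, y \<nu>, reflect_about flip_theta (\<theta>0, 0, q0) (y \<nu>)}"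
      unfolding y_def refl f[OF nu'(1)] xs_def using pair[OF nu'(2) pos] by simp
  next
    show "v \<noteq> 0" using v1 by (simp add: v_def zero_prod_def)
    show "flip_theta v = - v" "flip_theta v = - v" by (simp_all add: v_def)
    show "{x. A \<nu>0 x = 0} = span {v}" by (rule ker)
    show "v \<notin> range (A \<nu>0)" using v1 by (auto simp: A0 v_def)
    show "x = 0" "z = 0" if "\<omega> \<noteq> 0" "A \<nu>0 x = - (\<omega> *\<^sub>R z)" "A \<nu>0 z = \<omega> *\<^sub>R x" for x z \<omega>
      using osc[OF that] by auto
    show "xs C1_differentiable_on {\<nu>0 - d <..< \<nu>0 + d}" by (rule C1xs)
    show "xs \<nu>0 = (\<theta>0, 0, q0)" by (simp add: xs_def W_base)
    show "((\<lambda>\<nu>. m0 * Re (W \<nu>)) has_real_derivative m0 * (- (deriv G \<nu>0) * (\<alpha> \<nu>0 * s \<nu>0) / (norm b0)\<^sup>2)) (at \<nu>0)"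
      by (rule DERIV_cmult[OF Re_W_has_derivative])
    show "m0 * (- (deriv G \<nu>0) * (\<alpha> \<nu>0 * s \<nu>0) / (norm b0)\<^sup>2) \<noteq> 0"
      using G' m0_nz base_signs b0_nz by simp
    show "open U" "(\<theta>0, 0, q0) \<in> U" "sg \<in> {-1, 1}" by (rule U sg')+
    show "((\<lambda>\<nu>. (y \<nu> - xs \<nu>) /\<^sub>R sqrt (sg * (\<nu> - \<nu>0))) \<longlongrightarrow> v)
          (at \<nu>0 within {\<nu>. sg * (\<nu> - \<nu>0) > 0})"
      unfolding y_def xs_def v_def by (rule branch_root_rate[OF m1[unfolded F_def] ratio[unfolded F_def]])
  qed simp_all
qed

section \<open>Bifurcation along parameter curves\<close>

text \<open>
  Positivity of \<open>m0 \<gamma> \<partial>\<Gamma>\<close> means that the pair exists for increasing parameter.  Only the sign of the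
  direction \<open>l\<close> is fixed, so that the variable direction \<open>- m0 p\<close> and the constant ones are covered at
  once.
\<close>

lemma pair_bifurcation:
  assumes \<nu>0: "\<nu>0 = 0" and S: "\<And>\<epsilon>. S \<epsilon> = P \<epsilon>"
  shows "\<exists>\<epsilon>1 p q. 0 < \<epsilon>1 \<and> \<epsilon>1 \<le> \<delta> \<and> equilibrium_curve S \<theta>0 \<epsilon>1 p q \<and>
    (0 < m0 * \<gamma> * deriv G \<nu>0 \<longrightarrow>
      (\<forall>\<epsilon>\<in>{0<..<\<epsilon>1}. 0 < - m0 * p \<epsilon> * (\<gamma> * s \<nu>0)) \<and>
      (\<forall>l. (\<forall>\<epsilon>\<in>{0<..<\<epsilon>1}. 0 < l \<epsilon> * (\<gamma> * s \<nu>0)) \<longrightarrow> pair_bifurcates S \<theta>0 \<epsilon>1 p q l))"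
proof -
  obtain e' where e': "0 < e'" "e' \<le> \<delta>" "W C1_differentiable_on {\<nu>0 - e' <..< \<nu>0 + e'}" by (rule W_C1)
  define p where "p \<epsilon> = Re (W \<epsilon>)" for \<epsilon>
  define q where "q \<epsilon> = Im (W \<epsilon>)" for \<epsilon>
  have curve: "equilibrium_curve S \<theta>0 d p q" if "0 < d" "d \<le> e'" for d
  proof -
    have W: "W C1_differentiable_on {- d <..< d}"
      by (rule C1_differentiable_on_subset[OF e'(3)]) (use that \<nu>0 in auto)
    have "p C1_differentiable_on {- d <..< d}" "q C1_differentiable_on {- d <..< d}"
      unfolding p_def q_def
      by (rule C1_differentiable_on_bounded_linear[OF bounded_linear_Re W]
          C1_differentiable_on_bounded_linear[OF bounded_linear_Im W])+
    moreover have "p \<nu>0 = 0" "q \<nu>0 = q_eq (P \<nu>0) m0" by (simp_all add: p_def q_def W_base q0_def)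
    then have "p 0 = 0" "q 0 = q_eq (S 0) (cos \<theta>0)" unfolding S m0[symmetric] by (simp_all only: \<nu>0)
    ultimately show ?thesis
      unfolding equilibrium_curve_def S
      using riccati_W by (simp add: coh_field_eq_0_iff sin_\<theta>0 m0[symmetric] p_def q_def)
  qed
  show ?thesis
  proof (cases "0 < m0 * \<gamma> * deriv G \<nu>0")
    case False
    then show ?thesis using curve[OF e'(1) order_refl] e'(1,2) by (intro exI[of _ e'] exI[of _ p] exI[of _ q]) simp
  next
    case True
    then have G': "deriv G \<nu>0 \<noteq> 0" and sg: "1 = sgn (m0 * \<gamma> * deriv G \<nu>0)" by auto
    define F where "F = at \<nu>0 within {\<nu>. 1 * (\<nu> - \<nu>0) > 0}"
    have F: "F = at_right 0" unfolding F_def \<nu>0 by (simp add: greaterThan_def)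
    have id: "((\<lambda>\<nu>. \<nu>) \<longlongrightarrow> \<nu>0) F" unfolding F_def by (rule tendsto_ident_at)
    obtain e U m1 where e: "0 < e" "e \<le> \<delta>" and U: "open U" "(\<theta>0, 0, q0) \<in> U"
      and m1: "(m1 \<longlongrightarrow> m0) F" "\<forall>\<^sub>F \<nu> in F. \<bar>m1 \<nu>\<bar> < 1 \<and> Gamma_tilde (P \<nu>) (m1 \<nu>) = 0"
      and ratio: "((\<lambda>\<nu>. m0 * (m0 - m1 \<nu>) / (1 * (\<nu> - \<nu>0))) \<longlongrightarrow> \<bar>deriv G \<nu>0 / \<gamma>\<bar>) F"
      and none: "\<And>\<nu>. \<bar>\<nu> - \<nu>0\<bar> < e \<Longrightarrow> 1 * (\<nu> - \<nu>0) \<le> 0 \<Longrightarrow>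
        {x \<in> U. coh_field (P \<nu>) x = 0} = {plane_eq \<nu>}"
      and pair: "\<And>\<nu>. \<bar>\<nu> - \<nu>0\<bar> < e \<Longrightarrow> 1 * (\<nu> - \<nu>0) > 0 \<Longrightarrow> \<bar>m1 \<nu>\<bar> < 1 \<and>
        {x \<in> U. coh_field (P \<nu>) x = 0} = {plane_eq \<nu>,
          (\<theta>0 + arccos (m0 * m1 \<nu>), 0, q_eq (P \<nu>) (m1 \<nu>)),
          (\<theta>0 - arccos (m0 * m1 \<nu>), 0, q_eq (P \<nu>) (m1 \<nu>))}"
      by (rule branching[OF G' sg, folded F_def]) (rule that, assumption+)
    have "\<forall>\<^sub>F \<nu> in F. 0 < - m0 * Re (W \<nu>) * (\<gamma> * s \<nu>0) \<and>
      (\<forall>l \<sigma>. 0 < l * (\<gamma> * s \<nu>0) \<and> \<sigma> \<in> {-1, 1} \<longrightarrow>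
        heteroclinic (coh_field (P \<nu>)) l (side_eq \<sigma> (m1 \<nu>) \<nu>)
          (plane_eq \<nu>))"
      by (rule eventually_conj[OF Re_W_sign[OF id m1] connecting_orbits[OF id m1]])
    then obtain b where b: "0 < b" and dyn: "\<And>\<nu>. 0 < \<nu> \<Longrightarrow> \<nu> < b \<Longrightarrow> 0 < - m0 * Re (W \<nu>) * (\<gamma> * s \<nu>0) \<and>
      (\<forall>l \<sigma>. 0 < l * (\<gamma> * s \<nu>0) \<and> \<sigma> \<in> {-1, 1} \<longrightarrow>
        heteroclinic (coh_field (P \<nu>)) l (side_eq \<sigma> (m1 \<nu>) \<nu>)
          (plane_eq \<nu>))"
      unfolding F eventually_at_right_field by auto
    define d where "d = min b (min e e')"
    have d: "0 < d" "d \<le> b" "d \<le> e" "d \<le> e'" "d \<le> \<delta>" using b e e' by (auto simp: d_def)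
    define y where "y \<nu> = (\<theta>0 + arccos (m0 * m1 \<nu>), 0 :: real, q_eq (P \<nu>) (m1 \<nu>))" for \<nu>
    have base: "(\<theta>0, p 0, q 0) = (\<theta>0, 0, q0)" using W_base by (simp add: p_def q_def \<nu>0)
    have R: "reflect_about flip_theta (\<theta>0, 0, q0) (y \<nu>) = (\<theta>0 - arccos (m0 * m1 \<nu>), 0, q_eq (P \<nu>) (m1 \<nu>))" for \<nu>
      unfolding y_def reflect_flip by simp
    have m1_Icc: "\<forall>\<^sub>F \<nu> in F. m0 * m1 \<nu> \<in> {-1..1}"
      using m1(2) by eventually_elim (use m0_cases in auto)
    have "((\<lambda>\<nu>. m0 * m1 \<nu>) \<longlongrightarrow> m0 * m0) F" by (intro tendsto_intros m1)
    from continuous_on_tendsto_compose[OF continuous_on_arccos' this _ m1_Icc]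
    have "((\<lambda>\<nu>. arccos (m0 * m1 \<nu>)) \<longlongrightarrow> arccos (m0 * m0)) F" by (simp add: m0_sq)
    then have "((\<lambda>\<nu>. \<theta>0 + arccos (m0 * m1 \<nu>)) \<longlongrightarrow> \<theta>0 + 0) F"
      by (intro tendsto_intros) (simp add: m0_sq)
    then have y_lim: "(y \<longlongrightarrow> (\<theta>0, 0, q0)) (at_right 0)"
      unfolding y_def F[symmetric] by (intro tendsto_Pair tendsto_const q_eq_tendsto id m1) simp
    have "pair_bifurcates S \<theta>0 d p q l" if l: "\<forall>\<epsilon>\<in>{0<..<d}. 0 < l \<epsilon> * (\<gamma> * s \<nu>0)" for l
      unfolding pair_bifurcates_def Let_def base S
    proof (rule exI[of _ U], rule exI[of _ y], intro conjI ballI U y_lim)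
      fix \<epsilon> assume "\<epsilon> \<in> {- d <.. 0}"
      then show "{x \<in> U. coh_field (P \<epsilon>) x = 0} = {(\<theta>0, p \<epsilon>, q \<epsilon>)}"
        unfolding p_def q_def using d(3) by (intro none) (auto simp: \<nu>0)
    next
      fix \<epsilon> assume "\<epsilon> \<in> {0 <..< d}"
      then have \<epsilon>: "0 < \<epsilon>" "\<epsilon> < b" "\<bar>\<epsilon> - \<nu>0\<bar> < e" "1 * (\<epsilon> - \<nu>0) > 0" "0 < l \<epsilon> * (\<gamma> * s \<nu>0)"
        using d l by (auto simp: \<nu>0)
      have het: "heteroclinic (coh_field (P \<epsilon>)) (l \<epsilon>) (\<theta>0 + \<sigma> * arccos (m0 * m1 \<epsilon>), 0, q_eq (P \<epsilon>) (m1 \<epsilon>)) (\<theta>0, p \<epsilon>, q \<epsilon>)"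
        if "\<sigma> \<in> {-1, 1}" for \<sigma>
        unfolding p_def q_def using dyn[OF \<epsilon>(1,2)] \<epsilon>(5) that by blast
      show "fst (y \<epsilon>) \<noteq> \<theta>0"
      proof -
        have "-1 < m0 * m1 \<epsilon>" "m0 * m1 \<epsilon> < 1" using pair[OF \<epsilon>(3,4)] m0_cases by auto
        from arccos_lt_bounded[OF this] show ?thesis by (simp add: y_def)
      qed
      show "{x \<in> U. coh_field (P \<epsilon>) x = 0} = {(\<theta>0, p \<epsilon>, q \<epsilon>), y \<epsilon>, reflect_about flip_theta (\<theta>0, 0, q0) (y \<epsilon>)}"
        unfolding R unfolding y_def p_def q_def using pair[OF \<epsilon>(3,4)] by blast
      show "heteroclinic (coh_field (P \<epsilon>)) (l \<epsilon>) (y \<epsilon>) (\<theta>0, p \<epsilon>, q \<epsilon>)"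
        using het[of 1] by (simp add: y_def)
      show "heteroclinic (coh_field (P \<epsilon>)) (l \<epsilon>) (reflect_about flip_theta (\<theta>0, 0, q0) (y \<epsilon>)) (\<theta>0, p \<epsilon>, q \<epsilon>)"
        using het[of "-1"] unfolding R by simp
    qed
    moreover have "\<forall>\<epsilon>\<in>{0<..<d}. 0 < - m0 * p \<epsilon> * (\<gamma> * s \<nu>0)"
      unfolding p_def using dyn d(2) by auto
    ultimately show ?thesis
      using curve[OF d(1,4)] d(1,5) by (intro exI[of _ d] exI[of _ p] exI[of _ q]) blast
  qed
qed

end

lemma coherent_family_of_curve:
  fixes S :: "real \<Rightarrow> params"
  assumes "\<theta>0 \<in> {0, pi}" and "m0 = cos \<theta>0" and "Gamma_tilde (S \<nu>0) m0 = 0"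
    and "\<gamma> = deriv (Gamma_tilde (S \<nu>0)) m0" and "\<gamma> \<noteq> 0" and "\<delta> > 0"
    and S: "S C1_differentiable_on {\<nu>0 - \<delta> <..< \<nu>0 + \<delta>}"
    and adm: "\<forall>\<nu> \<in> {\<nu>0 - \<delta> <..< \<nu>0 + \<delta>}. admissible (S \<nu>)"
  shows "coherent_family (\<lambda>\<nu>. fst (S \<nu>)) (\<lambda>\<nu>. fst (snd (S \<nu>))) (\<lambda>\<nu>. fst (snd (snd (S \<nu>))))
    (\<lambda>\<nu>. fst (snd (snd (snd (S \<nu>))))) (\<lambda>\<nu>. fst (snd (snd (snd (snd (S \<nu>))))))
    (\<lambda>\<nu>. fst (snd (snd (snd (snd (snd (S \<nu>))))))) (\<lambda>\<nu>. snd (snd (snd (snd (snd (snd (S \<nu>)))))))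
    \<nu>0 \<delta> \<theta>0 m0 \<gamma>"
proof
  let ?I = "{\<nu>0 - \<delta> <..< \<nu>0 + \<delta>}"
  have fst: "(\<lambda>\<nu>. fst (f \<nu>)) C1_differentiable_on ?I"
    if "f C1_differentiable_on ?I" for f :: "real \<Rightarrow> 'a::real_normed_vector \<times> 'b::real_normed_vector"
    by (rule C1_differentiable_on_bounded_linear[OF bounded_linear_fst that])
  have snd: "(\<lambda>\<nu>. snd (f \<nu>)) C1_differentiable_on ?I"
    if "f C1_differentiable_on ?I" for f :: "real \<Rightarrow> 'a::real_normed_vector \<times> 'b::real_normed_vector"
    by (rule C1_differentiable_on_bounded_linear[OF bounded_linear_snd that])
  note S2 = snd[OF S] note S3 = snd[OF S2] note S4 = snd[OF S3] note S5 = snd[OF S4] note S6 = snd[OF S5]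
  show "(\<lambda>\<nu>. fst (S \<nu>)) C1_differentiable_on ?I" "(\<lambda>\<nu>. fst (snd (S \<nu>))) C1_differentiable_on ?I"
    "(\<lambda>\<nu>. fst (snd (snd (S \<nu>)))) C1_differentiable_on ?I"
    "(\<lambda>\<nu>. fst (snd (snd (snd (S \<nu>))))) C1_differentiable_on ?I"
    "(\<lambda>\<nu>. fst (snd (snd (snd (snd (S \<nu>)))))) C1_differentiable_on ?I"
    "(\<lambda>\<nu>. fst (snd (snd (snd (snd (snd (S \<nu>))))))) C1_differentiable_on ?I"
    "(\<lambda>\<nu>. snd (snd (snd (snd (snd (snd (S \<nu>))))))) C1_differentiable_on ?I"
    by (rule fst[OF S] fst[OF S2] fst[OF S3] fst[OF S4] fst[OF S5] fst[OF S6] snd[OF S6])+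
qed (use assms in \<open>auto simp: abs_less_iff\<close>)

lemma pitchfork_along_curve:
  fixes S :: "real \<Rightarrow> params"
  assumes "\<theta>0 \<in> {0, pi}" and "m0 = cos \<theta>0" and "Gamma_tilde (S \<nu>0) m0 = 0"
    and "\<gamma> = deriv (Gamma_tilde (S \<nu>0)) m0" and "\<gamma> \<noteq> 0" and "\<delta> > 0"
    and "S C1_differentiable_on {\<nu>0 - \<delta> <..< \<nu>0 + \<delta>}"
    and "\<forall>\<nu> \<in> {\<nu>0 - \<delta> <..< \<nu>0 + \<delta>}. admissible (S \<nu>)"
    and G': "deriv (\<lambda>\<nu>. Gamma_tilde (S \<nu>) m0) \<nu>0 \<noteq> 0"
  shows "pitchfork_bifurcation flip_theta (\<lambda>\<nu>. coh_field (S \<nu>)) \<nu>0 (\<theta>0, 0, q_eq (S \<nu>0) m0)"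
proof -
  interpret coherent_family "\<lambda>\<nu>. fst (S \<nu>)" "\<lambda>\<nu>. fst (snd (S \<nu>))" "\<lambda>\<nu>. fst (snd (snd (S \<nu>)))"
    "\<lambda>\<nu>. fst (snd (snd (snd (S \<nu>))))" "\<lambda>\<nu>. fst (snd (snd (snd (snd (S \<nu>)))))"
    "\<lambda>\<nu>. fst (snd (snd (snd (snd (snd (S \<nu>))))))" "\<lambda>\<nu>. snd (snd (snd (snd (snd (snd (S \<nu>))))))"
    \<nu>0 \<delta> \<theta>0 m0 \<gamma>
    by (rule coherent_family_of_curve[OF assms(1-8)])
  have SP: "S \<epsilon> = P \<epsilon>" for \<epsilon> by (simp add: P_def)
  have "G = (\<lambda>\<nu>. Gamma_tilde (S \<nu>) m0)" by (simp only: fun_eq_iff G_def SP[symmetric] simp_thms)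
  with pitchfork[of "\<lambda>\<nu>. coh_field (S \<nu>)"] G' show ?thesis
    by (simp only: q0_def SP[symmetric] simp_thms)
qed

lemma pair_along_curve:
  fixes S :: "real \<Rightarrow> params"
  assumes "\<theta>0 \<in> {0, pi}" and "m0 = cos \<theta>0" and "Gamma_tilde (S 0) m0 = 0"
    and "\<gamma> = deriv (Gamma_tilde (S 0)) m0" and "\<gamma> \<noteq> 0" and "\<epsilon>0 > 0"
    and "S C1_differentiable_on {-\<epsilon>0 <..< \<epsilon>0}" and "\<forall>\<epsilon> \<in> {-\<epsilon>0 <..< \<epsilon>0}. admissible (S \<epsilon>)"
    and S0: "S 0 = (\<alpha>, \<beta>, h, \<mu>, \<Omega>, c, s)"
  obtains \<epsilon>1 p q where "0 < \<epsilon>1" "\<epsilon>1 \<le> \<epsilon>0" "equilibrium_curve S \<theta>0 \<epsilon>1 p q"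
    and "0 < m0 * \<gamma> * deriv (\<lambda>\<epsilon>. Gamma_tilde (S \<epsilon>) m0) 0 \<Longrightarrow> \<forall>\<epsilon>\<in>{0<..<\<epsilon>1}. 0 < - m0 * p \<epsilon> * (\<gamma> * s)"
    and "\<And>l. 0 < m0 * \<gamma> * deriv (\<lambda>\<epsilon>. Gamma_tilde (S \<epsilon>) m0) 0 \<Longrightarrow>
      \<forall>\<epsilon>\<in>{0<..<\<epsilon>1}. 0 < l \<epsilon> * (\<gamma> * s) \<Longrightarrow> pair_bifurcates S \<theta>0 \<epsilon>1 p q l"
proof -
  interpret coherent_family "\<lambda>\<nu>. fst (S \<nu>)" "\<lambda>\<nu>. fst (snd (S \<nu>))" "\<lambda>\<nu>. fst (snd (snd (S \<nu>)))"
    "\<lambda>\<nu>. fst (snd (snd (snd (S \<nu>))))" "\<lambda>\<nu>. fst (snd (snd (snd (snd (S \<nu>)))))"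
    "\<lambda>\<nu>. fst (snd (snd (snd (snd (snd (S \<nu>))))))" "\<lambda>\<nu>. snd (snd (snd (snd (snd (snd (S \<nu>))))))"
    0 \<epsilon>0 \<theta>0 m0 \<gamma>
    by (rule coherent_family_of_curve) (use assms in simp_all)
  have SP: "S \<epsilon> = P \<epsilon>" for \<epsilon> by (simp add: P_def)
  have "G = (\<lambda>\<epsilon>. Gamma_tilde (S \<epsilon>) m0)" by (simp only: fun_eq_iff G_def SP[symmetric] simp_thms)
  with pair_bifurcation[OF refl SP] have "\<exists>\<epsilon>1 p q. 0 < \<epsilon>1 \<and> \<epsilon>1 \<le> \<epsilon>0 \<and> equilibrium_curve S \<theta>0 \<epsilon>1 p q \<and>
    (0 < m0 * \<gamma> * deriv (\<lambda>\<epsilon>. Gamma_tilde (S \<epsilon>) m0) 0 \<longrightarrow>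
      (\<forall>\<epsilon>\<in>{0<..<\<epsilon>1}. 0 < - m0 * p \<epsilon> * (\<gamma> * s)) \<and>
      (\<forall>l. (\<forall>\<epsilon>\<in>{0<..<\<epsilon>1}. 0 < l \<epsilon> * (\<gamma> * s)) \<longrightarrow> pair_bifurcates S \<theta>0 \<epsilon>1 p q l))"
    by (simp only: S0 fst_conv snd_conv)
  then obtain \<epsilon>1 p q where curve: "0 < \<epsilon>1" "\<epsilon>1 \<le> \<epsilon>0" "equilibrium_curve S \<theta>0 \<epsilon>1 p q"
    and pair: "0 < m0 * \<gamma> * deriv (\<lambda>\<epsilon>. Gamma_tilde (S \<epsilon>) m0) 0 \<longrightarrow>
      (\<forall>\<epsilon>\<in>{0<..<\<epsilon>1}. 0 < - m0 * p \<epsilon> * (\<gamma> * s)) \<and>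
      (\<forall>l. (\<forall>\<epsilon>\<in>{0<..<\<epsilon>1}. 0 < l \<epsilon> * (\<gamma> * s)) \<longrightarrow> pair_bifurcates S \<theta>0 \<epsilon>1 p q l)"
    by (elim exE conjE) (rule that)
  show thesis
    by (rule that[OF curve pair[THEN mp, THEN conjunct1] pair[THEN mp, THEN conjunct2, THEN spec, THEN mp]])
qed

lemma pair_with_constant_direction:
  fixes S :: "real \<Rightarrow> params"
  assumes "\<theta>0 \<in> {0, pi}" and "m0 = cos \<theta>0" and "Gamma_tilde (S 0) m0 = 0"
    and "\<gamma> = deriv (Gamma_tilde (S 0)) m0" and "\<gamma> \<noteq> 0"
    and "S C1_differentiable_on {-1 <..< 1}" and "\<forall>\<epsilon>. admissible (S \<epsilon>)"
    and "S 0 = (\<alpha>, \<beta>, h, \<mu>, \<Omega>, c, s)"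
    and G: "((\<lambda>\<epsilon>. Gamma_tilde (S \<epsilon>) m0) has_real_derivative D) (at 0)" "0 < m0 * \<gamma> * D"
    and l: "0 < l * (\<gamma> * s)"
  shows "\<exists>\<epsilon>1 p q. 0 < \<epsilon>1 \<and> equilibrium_curve S \<theta>0 \<epsilon>1 p q \<and> pair_bifurcates S \<theta>0 \<epsilon>1 p q (\<lambda>\<epsilon>. l)"
proof -
  have "0 < m0 * \<gamma> * deriv (\<lambda>\<epsilon>. Gamma_tilde (S \<epsilon>) m0) 0"
    using G(2) unfolding DERIV_imp_deriv[OF G(1)] .
  note slope = this
  have adm: "\<forall>\<epsilon>\<in>{-1<..<1}. admissible (S \<epsilon>)" using assms(7) by blast
  obtain \<epsilon>1 p q where "0 < \<epsilon>1" "\<epsilon>1 \<le> 1" "equilibrium_curve S \<theta>0 \<epsilon>1 p q"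
    and "0 < m0 * \<gamma> * deriv (\<lambda>\<epsilon>. Gamma_tilde (S \<epsilon>) m0) 0 \<Longrightarrow> \<forall>\<epsilon>\<in>{0<..<\<epsilon>1}. 0 < - m0 * p \<epsilon> * (\<gamma> * s)"
    and "\<And>l. 0 < m0 * \<gamma> * deriv (\<lambda>\<epsilon>. Gamma_tilde (S \<epsilon>) m0) 0 \<Longrightarrow>
      \<forall>\<epsilon>\<in>{0<..<\<epsilon>1}. 0 < l \<epsilon> * (\<gamma> * s) \<Longrightarrow> pair_bifurcates S \<theta>0 \<epsilon>1 p q l"
    by (rule pair_along_curve[where ?\<epsilon>0.0 = 1, OF assms(1-5) zero_less_one assms(6) adm assms(8)]) (rule that)
  note curve = this
  have "pair_bifurcates S \<theta>0 \<epsilon>1 p q (\<lambda>\<epsilon>. l)" by (rule curve(5)[OF slope]) (use l in simp)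
  then show ?thesis using curve(1,3) by blast
qed

lemma Gamma_tilde_parameter_derivatives:
  fixes k :: real
  shows "((\<lambda>\<epsilon>. Gamma_tilde (\<alpha>, \<beta>, h + k * \<epsilon>, \<mu>, \<Omega>, c, s) m) has_real_derivative - k) (at \<epsilon>)"
    and "((\<lambda>\<epsilon>. Gamma_tilde (\<alpha>, \<beta>, h, \<mu> + k * \<epsilon>, \<Omega>, c, s) m) has_real_derivative k * m) (at \<epsilon>)"
    and "s \<noteq> 0 \<Longrightarrow> ((\<lambda>\<epsilon>. Gamma_tilde (\<alpha>, \<beta> + k * \<epsilon>, h, \<mu>, \<Omega>, c, s) m) has_real_derivative
      k / ((1 + c * m) * \<alpha> * s) * (2 * q_eq (\<alpha>, \<beta> + k * \<epsilon>, h, \<mu>, \<Omega>, c, s) m * m + s)) (at \<epsilon>)"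
proof -
  show "((\<lambda>\<epsilon>. Gamma_tilde (\<alpha>, \<beta>, h + k * \<epsilon>, \<mu>, \<Omega>, c, s) m) has_real_derivative - k) (at \<epsilon>)"
    by (auto intro!: derivative_eq_intros)
  show "((\<lambda>\<epsilon>. Gamma_tilde (\<alpha>, \<beta>, h, \<mu> + k * \<epsilon>, \<Omega>, c, s) m) has_real_derivative k * m) (at \<epsilon>)"
    by (auto intro!: derivative_eq_intros)
  assume s: "s \<noteq> 0"
  define B where "B \<epsilon> = (\<beta> + k * \<epsilon>) / (1 + c * m) / \<alpha>" for \<epsilon>
  define j where "j = k / (1 + c * m) / \<alpha>"
  have B: "(B has_real_derivative j) (at \<epsilon>)"
    unfolding B_def j_def by (intro DERIV_cdivide) (auto intro!: derivative_eq_intros)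
  have q: "((\<lambda>\<epsilon>. (\<Omega> - B \<epsilon>) / s) has_real_derivative - j / s) (at \<epsilon>)"
    by (intro DERIV_cdivide) (auto intro!: derivative_eq_intros B)
  have "((\<lambda>\<epsilon>. B \<epsilon> - (((\<Omega> - B \<epsilon>) / s)\<^sup>2 - \<mu>) * m - h) has_real_derivative
      j - (2 * ((\<Omega> - B \<epsilon>) / s) * (- j / s)) * m) (at \<epsilon>)"
    by (rule derivative_eq_intros B q refl | simp)+
  moreover have "j - (2 * ((\<Omega> - B \<epsilon>) / s) * (- j / s)) * m = j / s * (2 * ((\<Omega> - B \<epsilon>) / s) * m + s)"
    using s by (simp add: divide_simps) (simp add: algebra_simps)
  moreover have "j / s = k / ((1 + c * m) * \<alpha> * s)" by (simp add: j_def)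
  ultimately show "((\<lambda>\<epsilon>. Gamma_tilde (\<alpha>, \<beta> + k * \<epsilon>, h, \<mu>, \<Omega>, c, s) m) has_real_derivative
      k / ((1 + c * m) * \<alpha> * s) * (2 * q_eq (\<alpha>, \<beta> + k * \<epsilon>, h, \<mu>, \<Omega>, c, s) m * m + s)) (at \<epsilon>)"
    unfolding Gamma_tilde.simps q_eq.simps beta_tilde.simps B_def[symmetric] by simp
qed

theorem theorem7:
  fixes \<theta>0 m0 \<alpha> \<beta> h \<mu> \<Omega> c s q0 \<gamma> :: real
  assumes "\<theta>0 \<in> {0, pi}" and "m0 = cos \<theta>0"
    and "\<alpha> > 0" and "\<bar>c\<bar> < 1" and "s \<noteq> 0"
    and "q0 = q_eq (\<alpha>, \<beta>, h, \<mu>, \<Omega>, c, s) m0"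
    and "Gamma_tilde (\<alpha>, \<beta>, h, \<mu>, \<Omega>, c, s) m0 = 0"
    and "\<gamma> = deriv (Gamma_tilde (\<alpha>, \<beta>, h, \<mu>, \<Omega>, c, s)) m0" and "\<gamma> \<noteq> 0"
  shows
    "pitchfork_bifurcation flip_theta (\<lambda>\<nu>. coh_field (\<alpha>, \<beta>, \<nu>, \<mu>, \<Omega>, c, s)) h (\<theta>0, 0, q0) \<and>
     pitchfork_bifurcation flip_theta (\<lambda>\<nu>. coh_field (\<alpha>, \<beta>, h, \<nu>, \<Omega>, c, s)) \<mu> (\<theta>0, 0, q0) \<and>
     (\<forall>S. \<forall>\<epsilon>0>0.
        S C1_differentiable_on {-\<epsilon>0 <..< \<epsilon>0} \<and> S 0 = (\<alpha>, \<beta>, h, \<mu>, \<Omega>, c, s) \<and>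
        (\<forall>\<epsilon> \<in> {-\<epsilon>0 <..< \<epsilon>0}. admissible (S \<epsilon>)) \<longrightarrow>
        (\<exists>\<epsilon>1 p q. 0 < \<epsilon>1 \<and> \<epsilon>1 \<le> \<epsilon>0 \<and> equilibrium_curve S \<theta>0 \<epsilon>1 p q \<and>
           (m0 * \<gamma> * deriv (\<lambda>\<epsilon>. Gamma_tilde (S \<epsilon>) m0) 0 > 0 \<longrightarrow>
              pair_bifurcates S \<theta>0 \<epsilon>1 p q (\<lambda>\<epsilon>. - m0 * p \<epsilon>)))) \<and>
     (let S = (\<lambda>\<epsilon>. (\<alpha>, \<beta>, h - m0 * \<gamma> * \<epsilon>, \<mu>, \<Omega>, c, s)) in
        \<exists>\<epsilon>1 p q. 0 < \<epsilon>1 \<and> equilibrium_curve S \<theta>0 \<epsilon>1 p q \<and>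
          pair_bifurcates S \<theta>0 \<epsilon>1 p q (\<lambda>\<epsilon>. \<gamma> * s)) \<and>
     (let S = (\<lambda>\<epsilon>. (\<alpha>, \<beta>, h, \<mu> + \<gamma> * \<epsilon>, \<Omega>, c, s)) in
        \<exists>\<epsilon>1 p q. 0 < \<epsilon>1 \<and> equilibrium_curve S \<theta>0 \<epsilon>1 p q \<and>
          pair_bifurcates S \<theta>0 \<epsilon>1 p q (\<lambda>\<epsilon>. \<gamma> * s)) \<and>
     (s * (2 * q0 * m0 + s) > 0 \<longrightarrow>
      (let S = (\<lambda>\<epsilon>. (\<alpha>, \<beta> + m0 * \<gamma> * \<epsilon>, h, \<mu>, \<Omega>, c, s)) in
         \<exists>\<epsilon>1 p q. 0 < \<epsilon>1 \<and> equilibrium_curve S \<theta>0 \<epsilon>1 p q \<and>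
           pair_bifurcates S \<theta>0 \<epsilon>1 p q (\<lambda>\<epsilon>. (2 * q0 * m0 + s) * \<gamma>))) \<and>
     (s * (2 * q0 * m0 + s) < 0 \<longrightarrow>
      (let S = (\<lambda>\<epsilon>. (\<alpha>, \<beta> - m0 * \<gamma> * \<epsilon>, h, \<mu>, \<Omega>, c, s)) in
         \<exists>\<epsilon>1 p q. 0 < \<epsilon>1 \<and> equilibrium_curve S \<theta>0 \<epsilon>1 p q \<and>
           pair_bifurcates S \<theta>0 \<epsilon>1 p q (\<lambda>\<epsilon>. - (2 * q0 * m0 + s) * \<gamma>)))"
proof -
  note base = assms
  let ?P = "(\<alpha>, \<beta>, h, \<mu>, \<Omega>, c, s)"
  have m0: "m0 = 1 \<or> m0 = -1" using assms(1,2) by auto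
  have cm: "0 < 1 + c * m0" using one_plus_mult_pos[OF assms(4), of m0] m0 by auto
  have adm: "admissible (\<alpha>, \<beta>', h', \<mu>', \<Omega>, c, s)" for \<beta>' h' \<mu>' using assms(3-5) by simp
  note C1 = C1_differentiable_on_Pair C1_differentiable_on_const C1_differentiable_on_ident
    C1_differentiable_on_add C1_differentiable_on_diff C1_differentiable_on_mult
  note dG = Gamma_tilde_parameter_derivatives
  have "0 < (m0 * \<gamma>)\<^sup>2" "0 < (\<gamma> * s)\<^sup>2" using m0 assms(5,9) by auto
  then have ms: "0 < m0 * \<gamma> * (m0 * \<gamma>)" "0 < \<gamma> * s * (\<gamma> * s)" "0 < m0 * \<gamma> * (\<gamma> * m0)"
    by (simp_all only: power2_eq_square mult_ac)
  have h: "pitchfork_bifurcation flip_theta (\<lambda>\<nu>. coh_field (\<alpha>, \<beta>, \<nu>, \<mu>, \<Omega>, c, s)) h (\<theta>0, 0, q0)"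
  proof -
    have "deriv (\<lambda>\<nu>. Gamma_tilde (\<alpha>, \<beta>, \<nu>, \<mu>, \<Omega>, c, s) m0) h = - 1"
      using dG(1)[of \<alpha> \<beta> 0 1 \<mu> \<Omega> c s m0 h] by (intro DERIV_imp_deriv) simp
    then show ?thesis
      unfolding assms(6)
      by (intro pitchfork_along_curve[where \<delta> = 1 and S = "\<lambda>\<nu>. (\<alpha>, \<beta>, \<nu>, \<mu>, \<Omega>, c, s)", OF assms(1,2,7,8,9)] C1 ballI adm) simp_all
  qed
  have \<mu>: "pitchfork_bifurcation flip_theta (\<lambda>\<nu>. coh_field (\<alpha>, \<beta>, h, \<nu>, \<Omega>, c, s)) \<mu> (\<theta>0, 0, q0)"
  proof -
    have "deriv (\<lambda>\<nu>. Gamma_tilde (\<alpha>, \<beta>, h, \<nu>, \<Omega>, c, s) m0) \<mu> = m0"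
      using dG(2)[of \<alpha> \<beta> h 0 1 \<Omega> c s m0 \<mu>] by (intro DERIV_imp_deriv) simp
    moreover have "m0 \<noteq> 0" using m0 by auto
    ultimately show ?thesis
      unfolding assms(6)
      by (intro pitchfork_along_curve[where \<delta> = 1 and S = "\<lambda>\<nu>. (\<alpha>, \<beta>, h, \<nu>, \<Omega>, c, s)", OF assms(1,2,7,8,9)] C1 ballI adm) simp_all
  qed
  have gen: "\<exists>\<epsilon>1 p q. 0 < \<epsilon>1 \<and> \<epsilon>1 \<le> \<epsilon>0 \<and> equilibrium_curve S \<theta>0 \<epsilon>1 p q \<and>
      (m0 * \<gamma> * deriv (\<lambda>\<epsilon>. Gamma_tilde (S \<epsilon>) m0) 0 > 0 \<longrightarrow> pair_bifurcates S \<theta>0 \<epsilon>1 p q (\<lambda>\<epsilon>. - m0 * p \<epsilon>))"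
    if e0: "\<epsilon>0 > 0" and S: "S C1_differentiable_on {-\<epsilon>0 <..< \<epsilon>0}" "S 0 = ?P"
      "\<forall>\<epsilon> \<in> {-\<epsilon>0 <..< \<epsilon>0}. admissible (S \<epsilon>)" for S \<epsilon>0
  proof -
    have z: "Gamma_tilde (S 0) m0 = 0" "\<gamma> = deriv (Gamma_tilde (S 0)) m0"
      unfolding S(2) by (rule assms(7,8))+
    obtain \<epsilon>1 p q where "0 < \<epsilon>1" "\<epsilon>1 \<le> \<epsilon>0" "equilibrium_curve S \<theta>0 \<epsilon>1 p q"
    and "0 < m0 * \<gamma> * deriv (\<lambda>\<epsilon>. Gamma_tilde (S \<epsilon>) m0) 0 \<Longrightarrow> \<forall>\<epsilon>\<in>{0<..<\<epsilon>1}. 0 < - m0 * p \<epsilon> * (\<gamma> * s)"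
    and "\<And>l. 0 < m0 * \<gamma> * deriv (\<lambda>\<epsilon>. Gamma_tilde (S \<epsilon>) m0) 0 \<Longrightarrow>
      \<forall>\<epsilon>\<in>{0<..<\<epsilon>1}. 0 < l \<epsilon> * (\<gamma> * s) \<Longrightarrow> pair_bifurcates S \<theta>0 \<epsilon>1 p q l"
      by (rule pair_along_curve[OF assms(1,2) z assms(9) e0 S(1,3,2)]) (rule that)
    note curve = this
    show ?thesis
      by (intro exI[of _ \<epsilon>1] exI[of _ p] exI[of _ q] conjI impI curve(1-3) curve(5)[OF _ curve(4)])
  qed
  have pair: "\<exists>\<epsilon>1 p q. 0 < \<epsilon>1 \<and> equilibrium_curve S \<theta>0 \<epsilon>1 p q \<and> pair_bifurcates S \<theta>0 \<epsilon>1 p q (\<lambda>\<epsilon>. l)"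
    if "S C1_differentiable_on {-1 <..< 1}" "\<And>\<epsilon>. admissible (S \<epsilon>)" and S: "S 0 = ?P"
      and "((\<lambda>\<epsilon>. Gamma_tilde (S \<epsilon>) m0) has_real_derivative D) (at 0)" "0 < m0 * \<gamma> * D" "0 < l * (\<gamma> * s)" for S D l
    by (rule pair_with_constant_direction[OF assms(1,2) _ _ assms(9) that(1) _ S that(4-6)])
       (use assms(7,8) that(2) in \<open>simp_all only: S simp_thms\<close>)
  have h': "\<exists>\<epsilon>1 p q. 0 < \<epsilon>1 \<and> equilibrium_curve (\<lambda>\<epsilon>. (\<alpha>, \<beta>, h - m0 * \<gamma> * \<epsilon>, \<mu>, \<Omega>, c, s)) \<theta>0 \<epsilon>1 p q \<and>
      pair_bifurcates (\<lambda>\<epsilon>. (\<alpha>, \<beta>, h - m0 * \<gamma> * \<epsilon>, \<mu>, \<Omega>, c, s)) \<theta>0 \<epsilon>1 p q (\<lambda>\<epsilon>. \<gamma> * s)"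
    by (rule pair[where D = "m0 * \<gamma>"], (intro C1), rule adm)
       (use dG(1)[of \<alpha> \<beta> h "- (m0 * \<gamma>)" \<mu> \<Omega> c s m0 0] ms in simp_all)
  have \<mu>': "\<exists>\<epsilon>1 p q. 0 < \<epsilon>1 \<and> equilibrium_curve (\<lambda>\<epsilon>. (\<alpha>, \<beta>, h, \<mu> + \<gamma> * \<epsilon>, \<Omega>, c, s)) \<theta>0 \<epsilon>1 p q \<and>
      pair_bifurcates (\<lambda>\<epsilon>. (\<alpha>, \<beta>, h, \<mu> + \<gamma> * \<epsilon>, \<Omega>, c, s)) \<theta>0 \<epsilon>1 p q (\<lambda>\<epsilon>. \<gamma> * s)"
    by (rule pair[where D = "\<gamma> * m0"], (intro C1), rule adm)
       (use dG(2)[of \<alpha> \<beta> h \<mu> \<gamma> \<Omega> c s m0 0] ms in simp_all)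
  \<comment> \<open>The factor \<open>t\<close> will be 1 or -1, according to the sign of \<open>s (2 q0 m0 + s)\<close>.\<close>
  have \<beta>: "\<exists>\<epsilon>1 p q. 0 < \<epsilon>1 \<and> equilibrium_curve (\<lambda>\<epsilon>. (\<alpha>, \<beta> + t * (m0 * \<gamma>) * \<epsilon>, h, \<mu>, \<Omega>, c, s)) \<theta>0 \<epsilon>1 p q \<and>
      pair_bifurcates (\<lambda>\<epsilon>. (\<alpha>, \<beta> + t * (m0 * \<gamma>) * \<epsilon>, h, \<mu>, \<Omega>, c, s)) \<theta>0 \<epsilon>1 p q (\<lambda>\<epsilon>. t * (2 * q0 * m0 + s) * \<gamma>)"
    if t: "0 < t * (s * (2 * q0 * m0 + s))" for t
  proof (rule pair[where D = "t * (m0 * \<gamma>) / ((1 + c * m0) * \<alpha> * s) * (2 * q0 * m0 + s)"])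
    show "(\<lambda>\<epsilon>. (\<alpha>, \<beta> + t * (m0 * \<gamma>) * \<epsilon>, h, \<mu>, \<Omega>, c, s)) C1_differentiable_on {-1<..<1}" by (intro C1)
    show "((\<lambda>\<epsilon>. Gamma_tilde (\<alpha>, \<beta> + t * (m0 * \<gamma>) * \<epsilon>, h, \<mu>, \<Omega>, c, s) m0) has_real_derivative
        t * (m0 * \<gamma>) / ((1 + c * m0) * \<alpha> * s) * (2 * q0 * m0 + s)) (at 0)"
      using dG(3)[OF assms(5), of \<alpha> \<beta> "t * (m0 * \<gamma>)" h \<mu> \<Omega> c m0 0] unfolding assms(6) by simp
    have "m0 * \<gamma> * (t * (m0 * \<gamma>) / ((1 + c * m0) * \<alpha> * s) * (2 * q0 * m0 + s))
        = (m0 * \<gamma>)\<^sup>2 * (t * (s * (2 * q0 * m0 + s))) / ((1 + c * m0) * \<alpha> * s\<^sup>2)"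
      using assms(5) by (simp add: power2_eq_square mult_ac)
    also have "\<dots> > 0"
      using t cm m0 assms(3,5,9) by (intro divide_pos_pos mult_pos_pos[OF _ t]) (auto simp: power2_eq_square zero_less_mult_iff linorder_neq_iff)
    finally show "0 < m0 * \<gamma> * (t * (m0 * \<gamma>) / ((1 + c * m0) * \<alpha> * s) * (2 * q0 * m0 + s))" .
    have "t * (2 * q0 * m0 + s) * \<gamma> * (\<gamma> * s) = \<gamma>\<^sup>2 * (t * (s * (2 * q0 * m0 + s)))"
      by (simp add: power2_eq_square)
    also have "\<dots> > 0" using assms(9) by (intro mult_pos_pos[OF _ t]) simp
    finally show "0 < t * (2 * q0 * m0 + s) * \<gamma> * (\<gamma> * s)" .
  qed (use assms(3-5) in simp_all)
  show ?thesis
    unfolding Let_def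
    using h \<mu> gen h' \<mu>' \<beta>[of 1] \<beta>[of "-1"] by (intro conjI allI impI) (simp_all add: mult_less_0_iff)
qed

end
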